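(* Let $k$ be a field and let $g(x,y)\in k[x,y]$ be a polynomial of degree $3$ in which the coefficients of $x^3$, $y^3$ and $1$ are nonzero. Let $S_g:=\bigl(xyz=g(x,y)\bigr)\subset\mathbb{A}^3_k$. Then the group $\mathrm{Aut}_k(S_g)$ of $k$-automorphisms of $S_g$ contains a subgroup of finite index isomorphic to $\mathbb{Z}$.
   Context: The conditions on the coefficients are equivalent to: the curve at infinity of the projective closure of $S_g$ in $\mathbb{P}^3$ is an irreducible nodal cubic, and the projective closure has an $A_2$ singularity at the node. *)

theory Defs
  imports
    "HOL-Algebra.Elementary_Groups"
    "HOL-Algebra.QuotRing"
    "HOL-Algebra.Bij"
    "HOL-Algebra.Algebraic_Closure_Type"
begin

text \<open>
  The ring \<open>k[x,y]\<close> is \<open>k[x][y]\<close>, i.e. \<^typ>\<open>'k poly poly\<close>, and \<open>k[x,y,z]\<close> is \<open>k[x][y][z]\<close>: the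
  innermost variable is \<open>x\<close>, the outermost one is \<open>z\<close>.  Constructors are qualified because
  HOL-Algebra has its own \<open>coeff\<close>.
\<close>

definition coeff_xy :: "'k::zero poly poly \<Rightarrow> nat \<Rightarrow> nat \<Rightarrow> 'k" where
  "coeff_xy g i j = Polynomial.coeff (Polynomial.coeff g j) i"

text \<open>The total degree; it is 0 for the zero polynomial, as for \<^const>\<open>Polynomial.degree\<close>.\<close>

definition degree_xy :: "'k::zero poly poly \<Rightarrow> nat" where
  "degree_xy g = Max (insert 0 {i + j | i j. coeff_xy g i j \<noteq> 0})"

definition var_x :: "'k::comm_ring_1 poly poly poly" where
  "var_x = [:[:[:0, 1:]:]:]"

definition var_y :: "'k::comm_ring_1 poly poly poly" where
  "var_y = [:[:0, 1:]:]"

definition var_z :: "'k::comm_ring_1 poly poly poly" where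
  "var_z = [:0, 1:]"

abbreviation ring_xyz :: "'k::comm_ring_1 poly poly poly ring" where
  "ring_xyz \<equiv> ring_of_type_algebra"

text \<open>The ideal \<open>(xyz - g(x,y))\<close>, where \<open>[:g:]\<close> is \<open>g\<close> viewed as an element of \<open>k[x,y,z]\<close>.\<close>

definition surface_ideal :: "'k::comm_ring_1 poly poly \<Rightarrow> 'k poly poly poly set" where
  "surface_ideal g = genideal ring_xyz {var_x * var_y * var_z - [:g:]}"

definition surface_ring :: "'k::comm_ring_1 poly poly \<Rightarrow> 'k poly poly poly set ring" where
  "surface_ring g = ring_xyz Quot surface_ideal g"

definition surface_const :: "'k::comm_ring_1 poly poly \<Rightarrow> 'k \<Rightarrow> 'k poly poly poly set" where
  "surface_const g c = surface_ideal g +>\<^bsub>ring_xyz\<^esub> [:[:[:c:]:]:]"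

text \<open>
  \<open>S\<^sub>g\<close> is the affine scheme \<open>Spec k[x,y,z]/(xyz - g)\<close>, so its \<open>k\<close>-automorphisms are the
  \<open>k\<close>-algebra automorphisms of the coordinate ring.  An automorphism \<open>\<phi>\<close> of \<open>S\<^sub>g\<close> is represented by
  the algebra automorphism \<open>(\<phi>\<^sup>*)\<^sup>-\<^sup>1\<close>, so that composition is not reversed.  (Permutations of the set
  of \<open>k\<close>-points would be the wrong notion, e.g. over finite fields.)  As for \<^const>\<open>AutoGroup\<close>,
  maps are extensional on the carrier, and the group operation is composition.
\<close>

definition surface_auts ::
    "'k::comm_ring_1 poly poly \<Rightarrow> ('k poly poly poly set \<Rightarrow> 'k poly poly poly set) set" where
  "surface_auts g =
     {f \<in> ring_hom (surface_ring g) (surface_ring g) \<inter> Bij (carrier (surface_ring g)).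
        \<forall>c. f (surface_const g c) = surface_const g c}"

definition surface_Aut ::
    "'k::comm_ring_1 poly poly \<Rightarrow> ('k poly poly poly set \<Rightarrow> 'k poly poly poly set) monoid" where
  "surface_Aut g = BijGroup (carrier (surface_ring g)) \<lparr>carrier := surface_auts g\<rparr>"

end

theory Submission
  imports Defs
    "HOL-Computational_Algebra.Formal_Laurent_Series"
    "HOL-Library.Product_Lexorder"
    "HOL-Library.Product_Plus"
begin

text \<open>
  The coordinate ring embeds into the Laurent polynomials in \<open>x, y\<close> and is a generalised cluster
  algebra of rank two: with \<open>p = g(x, 0)\<close>, \<open>q = g(0, y)\<close>, \<open>c = g(0, 0)\<close> it is also generated by
  \<open>x\<close>, \<open>y\<close> and \<open>(p(x) + q(y) - c) / (x y)\<close>, and the mutation \<open>(x, y) \<mapsto> (y, q(y) / x)\<close> produces a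
  triple of generators of the same shape.  After four mutations the exchange polynomials return
  to \<open>(p, q)\<close>, which gives an automorphism \<open>s\<close> shifting the cluster variables \<open>y\<^sub>n\<close> by four.

  For an automorphism \<open>f\<close> the degrees \<open>d\<^sub>n\<close> of \<open>f(y\<^sub>n)\<close> are positive and satisfy
  \<open>d\<^sub>n\<^sub>+\<^sub>1 = 3 d\<^sub>n - d\<^sub>n\<^sub>-\<^sub>1\<close>, so after composing with a power of \<open>s\<close> some neighbouring pair
  \<open>(X, Y)\<close> among the first few \<open>f(y\<^sub>n)\<close> has degrees of ratio at most \<open>3/2\<close>.  The Poisson bracket
  with \<open>{x, y} = x y\<close> is preserved up to a constant, which forces the leading exponents of
  \<open>X, Y\<close> to be linearly independent; hence degrees can be read off Laurent expansions in \<open>X, Y\<close>.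
  Because the polar parts of these expansions are divisible by powers of the exchange polynomials,
  every nonconstant element has degree at least \<open>min (deg X) (deg Y)\<close>.  As \<open>x\<close> has degree 1, so
  have \<open>X\<close> and \<open>Y\<close>, and then they are scalar multiples of \<open>x, y\<close> with finitely many possible factors.
\<close>

text \<open>The constant 3/2 is where two arguments meet. The two neighbours of a term of the
  recurrence add up to three times that term, so the smaller one is at most 3/2 times it, and a
  local minimum belongs to a balanced pair. On the other side, a column of the Newton polygon at
  distance \<open>l\<close> left of the axis spans at least \<open>3 l\<close>; while the ratio of
  the degrees is at most 3/2, it reaches so far below the axis that the rows met there extend even
  further left, which is absurd for the leftmost column. The obstacle is that the degree of a
  polynomial in \<open>X\<close>, \<open>Y\<close> could drop because top terms cancel. The
  independence of leading exponents that excludes this must be proved in every characteristic, where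
  a bracket can vanish on algebraically independent elements (derivations kill \<open>p\<close>-th
  powers). So the bracket is shown to be nonzero because each cluster generates the whole ring, and
  \<open>{X, Y} / (X Y)\<close> is shown to be constant because it has no poles and its degree is at
  most 0. The logarithmic form of the bracket fits: it maps the ring to itself and acts on two
  monomials by the determinant of their exponents.\<close>

no_notation Polynomials.var ("X\<index>")

section \<open>The field of iterated Laurent series\<close>

text \<open>With the lexicographic order on pairs this is a valuation of rank two, except that
  \<open>0\<close> gets the value \<open>(0, 0)\<close> instead of infinity; hence the separate
  treatment of zero below.\<close>

definition lval :: "'k::field fls fls \<Rightarrow> int \<times> int" where
  "lval f = (fls_subdegree f, fls_subdegree (fls_nth f (fls_subdegree f)))"

definition lead :: "'k::field fls fls \<Rightarrow> 'k" where
  "lead f = fls_nth (fls_nth f (fst (lval f))) (snd (lval f))"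

definition tdeg :: "'k::field fls fls \<Rightarrow> int" where
  "tdeg f = - fls_subdegree f"

definition scal :: "'k::field \<Rightarrow> 'k fls fls" where
  "scal c = fls_const (fls_const c)"

lemma fst_lval: "fst (lval f) = - tdeg f"
  by (simp add: lval_def tdeg_def)

lemma lead_nonzero: "f \<noteq> 0 \<Longrightarrow> lead f \<noteq> 0"
  by (simp add: lead_def lval_def)

lemma lval_mult:
  assumes "f \<noteq> 0" "g \<noteq> 0"
  shows "lval (f * g) = lval f + lval g"
  using assms by (simp add: lval_def fls_times_base)

lemma tdeg_mult: "f \<noteq> 0 \<Longrightarrow> g \<noteq> 0 \<Longrightarrow> tdeg (f * g) = tdeg f + tdeg g"
  by (simp add: tdeg_def)

lemma lval_1: "lval 1 = 0"
  by (simp add: lval_def zero_prod_def)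

lemma tdeg_1 [simp]: "tdeg 1 = 0"
  by (simp add: tdeg_def)

lemma lval_power:
  assumes "f \<noteq> 0"
  shows "lval (f ^ n) = (int n * fst (lval f), int n * snd (lval f))"
proof (induction n)
  case 0
  then show ?case by (simp add: lval_1 zero_prod_def)
next
  case (Suc n)
  then show ?case using assms
    by (simp add: lval_mult prod_eq_iff algebra_simps)
qed

lemma tdeg_power: "f \<noteq> 0 \<Longrightarrow> tdeg (f ^ n) = int n * tdeg f"
  using lval_power[of f n] by (auto simp: fst_lval prod_eq_iff)

lemma lval_add_lt:
  assumes "f \<noteq> 0" "lval f < lval g \<or> g = 0"
  shows "f + g \<noteq> 0 \<and> lval (f + g) = lval f"
proof (cases "g = 0")
  case False
  define a where "a = fls_subdegree f"
  have lt: "lval f < lval g" using assms False by simp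
  then consider "a < fls_subdegree g" | "a = fls_subdegree g"
    "fls_subdegree (fls_nth f a) < fls_subdegree (fls_nth g a)"
    by (auto simp: lval_def a_def less_prod_def le_less)
  then have *: "fls_nth (f + g) a \<noteq> 0 \<and> fls_subdegree (fls_nth (f + g) a) = fls_subdegree (fls_nth f a)"
  proof cases
    case 1
    then show ?thesis using assms(1) by (simp add: a_def)
  next
    case 2
    have nz: "fls_nth f a \<noteq> 0" using assms(1) by (simp add: a_def)
    then have "fls_subdegree (fls_nth f a + fls_nth g a) = fls_subdegree (fls_nth f a)"
      using 2(2) by (rule fls_subdegree_add_eq1)
    moreover have "fls_nth f a + fls_nth g a \<noteq> 0"
    proof
      assume "fls_nth f a + fls_nth g a = 0"
      then have "fls_nth g a = - fls_nth f a" by (simp add: eq_neg_iff_add_eq_0 add.commute)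
      then show False using 2(2) by simp
    qed
    ultimately show ?thesis by simp
  qed
  have "a \<le> fls_subdegree g" using lt by (auto simp: lval_def a_def less_prod_def)
  then have "fls_subdegree (f + g) = a"
    using * by (intro fls_subdegree_eqI) (auto simp: a_def)
  moreover have "f + g \<noteq> 0" using * by force
  ultimately show ?thesis using * by (simp add: lval_def a_def)
qed (use assms in simp)

text \<open>Terms with pairwise distinct values cannot cancel at the smallest one.\<close>

lemma lval_sum:
  assumes "finite S" "S \<noteq> {}" "\<And>i. i \<in> S \<Longrightarrow> f i \<noteq> 0" "inj_on (lval \<circ> f) S"
  shows "sum f S \<noteq> 0 \<and> lval (sum f S) = Min ((lval \<circ> f) ` S)"
  using assms
proof (induction S rule: finite_ne_induct)
  case (singleton i)
  then show ?case by simp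
next
  case (insert i F)
  define m where "m = Min ((lval \<circ> f) ` F)"
  have IH: "sum f F \<noteq> 0" "lval (sum f F) = m"
    using insert by (auto simp: m_def)
  have "m \<in> (lval \<circ> f) ` F" unfolding m_def using insert by (intro Min_in) auto
  moreover have "lval (f i) \<notin> (lval \<circ> f) ` F"
    using insert.prems(2) insert.hyps(3) by (auto simp: inj_on_def)
  ultimately have ne: "lval (f i) \<noteq> m" by metis
  have Min: "Min ((lval \<circ> f) ` insert i F) = min (lval (f i)) m"
    using insert by (simp add: m_def)
  have fi: "f i \<noteq> 0" using insert.prems by simp
  have sum: "sum f (insert i F) = f i + sum f F" using insert by simp
  from ne consider "lval (f i) < m" | "m < lval (f i)" by (meson linorder_cases)
  then show ?case
  proof cases
    case 1
    then have "f i + sum f F \<noteq> 0 \<and> lval (f i + sum f F) = lval (f i)"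
      using lval_add_lt[of "f i" "sum f F"] fi IH by simp
    moreover have "min (lval (f i)) m = lval (f i)" using 1 by (meson min.absorb3)
    ultimately show ?thesis using Min sum by simp
  next
    case 2
    then have "sum f F + f i \<noteq> 0 \<and> lval (sum f F + f i) = m"
      using lval_add_lt[of "sum f F" "f i"] fi IH by simp
    moreover have "min (lval (f i)) m = m" using 2 by (meson min.absorb4)
    ultimately show ?thesis using Min sum by (simp add: add.commute)
  qed
qed

lemma scal_simps [simp]:
  "scal 0 = 0" "scal 1 = 1" "scal (a + b) = scal a + scal b" "scal (a * b) = scal a * scal b"
  "scal (- a) = - scal a" "scal (a - b) = scal a - scal b" "scal a = 0 \<longleftrightarrow> a = 0"
  by (simp_all add: scal_def fls_plus_const fls_minus_const)

lemma lval_scal [simp]: "c \<noteq> 0 \<Longrightarrow> lval (scal c) = 0"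
  by (simp add: lval_def scal_def zero_prod_def)

lemma tdeg_scal [simp]: "tdeg (scal c) = 0"
  by (simp add: tdeg_def scal_def)

text \<open>
  In \<open>k((s))((t))\<close> put \<open>x = 1/t\<close> and \<open>y = s/t\<close>.  Then the order in \<open>t\<close> is minus the total degree, and
  the order in \<open>s\<close> of the leading coefficient breaks ties; it is the exponent of \<open>y\<close> of the
  leading monomial.
\<close>

definition tx :: "'k::field fls fls" where "tx = fls_X_inv"
definition ty :: "'k::field fls fls" where "ty = fls_const fls_X * fls_X_inv"

lemma tx_ty_nonzero [simp]: "tx \<noteq> 0" "ty \<noteq> 0"
  by (auto simp: tx_def ty_def)

lemma lval_tx: "lval tx = (-1, 0)"
  by (simp add: lval_def tx_def)

lemma lval_ty: "lval ty = (-1, 1)"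
proof -
  have "lval (fls_const fls_X :: 'a fls fls) = (0, 1)" by (simp add: lval_def)
  then show ?thesis
    using lval_tx[where 'a = 'a] lval_mult[of "fls_const fls_X" "fls_X_inv :: 'a fls fls"]
    by (simp add: ty_def tx_def plus_prod_def)
qed

lemma tdeg_tx_ty [simp]: "tdeg tx = 1" "tdeg ty = 1"
  using lval_tx lval_ty by (auto simp: tdeg_def lval_def)

section \<open>Euler derivations and the logarithmic Poisson bracket\<close>

definition fls_euler :: "'a::comm_ring_1 fls \<Rightarrow> 'a fls" where
  "fls_euler f = fls_X * fls_deriv f"

definition fls_map :: "('a::zero \<Rightarrow> 'a) \<Rightarrow> 'a fls \<Rightarrow> 'a fls" where
  "fls_map d f = Abs_fls (\<lambda>n. d (fls_nth f n))"

lemma fls_euler_nth: "fls_nth (fls_euler f) n = of_int n * fls_nth f n"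
  by (simp add: fls_euler_def fls_X_times_conv_shift)

lemma fls_euler_add: "fls_euler (f + g) = fls_euler f + fls_euler g"
  by (simp add: fls_euler_def algebra_simps)

lemma fls_euler_mult: "fls_euler (f * g) = fls_euler f * g + f * fls_euler g"
  by (simp add: fls_euler_def algebra_simps)

lemma fls_map_nth: "d 0 = 0 \<Longrightarrow> fls_nth (fls_map d f) n = d (fls_nth f n)"
  unfolding fls_map_def
  by (rule nth_Abs_fls_lower_bound[of "fls_subdegree f"]) auto

lemma fls_times_nth_bounds:
  fixes f g :: "'a::comm_ring_1 fls"
  assumes "a \<le> fls_subdegree f" "b \<le> fls_subdegree g"
  shows "fls_nth (f * g) n = (\<Sum>i=a..n-b. fls_nth f i * fls_nth g (n - i))"
  unfolding fls_times_nth(2)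
  using assms by (intro sum.mono_neutral_left) (auto simp: not_le)

lemma fls_map_mult:
  fixes f g :: "'a::comm_ring_1 fls"
  assumes add: "\<And>x y. d (x + y) = d x + d y" and mult: "\<And>x y. d (x * y) = d x * y + x * d y"
  shows "fls_map d (f * g) = fls_map d f * g + f * fls_map d g"
proof (rule fls_eqI)
  fix n
  have d0: "d 0 = 0" using add[of 0 0] by simp
  have dsum: "d (sum h S) = (\<Sum>i\<in>S. d (h i))" for h and S :: "int set"
    by (induction S rule: infinite_finite_induct) (auto simp: d0 add)
  \<comment> \<open>Common lower bounds for a series and its image under \<open>d\<close> put all
    three convolutions on the same finite interval.\<close>
  define a where "a = min (fls_subdegree f) (fls_subdegree (fls_map d f))"
  define b where "b = min (fls_subdegree g) (fls_subdegree (fls_map d g))"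
  have "fls_nth (fls_map d (f * g)) n = d (\<Sum>i=a..n-b. fls_nth f i * fls_nth g (n - i))"
    by (subst fls_map_nth[of d, OF d0], subst fls_times_nth_bounds[of a f b g]) (auto simp: a_def b_def)
  also have "\<dots> = (\<Sum>i=a..n-b. fls_nth (fls_map d f) i * fls_nth g (n - i))
      + (\<Sum>i=a..n-b. fls_nth f i * fls_nth (fls_map d g) (n - i))"
    by (simp add: dsum mult sum.distrib fls_map_nth d0)
  also have "\<dots> = fls_nth (fls_map d f * g + f * fls_map d g) n"
    by (simp, subst (1 2) fls_times_nth_bounds[of a _ b]) (auto simp: a_def b_def)
  finally show "fls_nth (fls_map d (f * g)) n = fls_nth (fls_map d f * g + f * fls_map d g) n" .
qed

text \<open>These are \<open>t d/dt\<close> and, coefficientwise, \<open>s d/ds\<close>. Both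
  multiply every monomial by an integer, so they never lower an order.\<close>

definition dout :: "'k::field fls fls \<Rightarrow> 'k fls fls" where "dout = fls_euler"
definition dinn :: "'k::field fls fls \<Rightarrow> 'k fls fls" where "dinn = fls_map fls_euler"

text \<open>The logarithmic Poisson bracket, normalised by \<open>{x, y} = x y\<close>.\<close>

definition br :: "'k::field fls fls \<Rightarrow> 'k fls fls \<Rightarrow> 'k fls fls" where
  "br f h = dinn f * dout h - dout f * dinn h"

lemma dout_add: "dout (f + g) = dout f + dout g"
  by (simp add: dout_def fls_euler_add)

lemma dout_mult: "dout (f * g) = dout f * g + f * dout g"
  by (simp add: dout_def fls_euler_mult)

lemma fls_euler_0 [simp]: "fls_euler 0 = 0"
  by (simp add: fls_euler_def)

lemma dinn_nth: "fls_nth (dinn f) n = fls_euler (fls_nth f n)"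
  by (simp add: dinn_def fls_map_nth)

lemma dinn_add: "dinn (f + g) = dinn f + dinn g"
  by (rule fls_eqI) (simp add: dinn_nth fls_euler_add)

lemma dinn_mult: "dinn (f * g) = dinn f * g + f * dinn g"
  unfolding dinn_def by (rule fls_map_mult) (auto simp: fls_euler_add fls_euler_mult)

lemma br_add: "br f (g + h) = br f g + br f h" "br (f + g) h = br f h + br g h"
  by (simp_all add: br_def dinn_add dout_add algebra_simps)

lemma br_mult: "br f (g * h) = br f g * h + g * br f h"
  by (simp add: br_def dinn_mult dout_mult algebra_simps)

lemma br_swap: "br g f = - br f g"
  by (simp add: br_def)

lemma br_self [simp]: "br f f = 0"
  by (simp add: br_def algebra_simps)

lemma fls_euler_const [simp]: "fls_euler (fls_const c) = 0"
  by (simp add: fls_euler_def)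

lemma dinn_dout_scal: "dout (scal c) = 0" "dinn (scal c) = 0"
proof -
  show "dout (scal c) = 0" by (simp add: dout_def scal_def)
  show "dinn (scal c) = 0"
    by (rule fls_eqI) (simp add: dinn_nth scal_def)
qed

lemma br_scal [simp]: "br f (scal c) = 0" "br (scal c) f = 0"
  by (simp_all add: br_def dinn_dout_scal)

lemma br_tx_ty: "br tx ty = tx * ty"
proof -
  have 1: "dout tx = - tx"
    by (simp add: dout_def tx_def fls_euler_def power2_eq_square flip: mult.assoc)
       (simp add: fls_X_times_conv_shift)
  have 2: "dinn tx = 0"
    by (rule fls_eqI) (auto simp: dinn_nth tx_def fls_euler_def)
  have c: "dout (fls_const fls_X) = 0" "dinn (fls_const fls_X) = fls_const fls_X"
    subgoal by (simp add: dout_def)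
    subgoal by (rule fls_eqI) (auto simp: dinn_nth fls_euler_def)
    done
  have ty: "ty = fls_const fls_X * tx" by (simp add: ty_def tx_def)
  have 3: "dout ty = - ty" unfolding ty by (simp add: dout_mult c 1)
  have 4: "dinn ty = ty" unfolding ty by (simp add: dinn_mult c 2)
  show ?thesis by (simp add: br_def 1 2 3 4)
qed

lemma fls_times_nth_low:
  fixes f g :: "'a::comm_ring_1 fls"
  assumes "\<And>i. i < a \<Longrightarrow> fls_nth f i = 0" "\<And>i. i < b \<Longrightarrow> fls_nth g i = 0"
  shows "fls_nth (f * g) (a + b) = fls_nth f a * fls_nth g b"
    and "n < a + b \<Longrightarrow> fls_nth (f * g) n = 0"
proof -
  have *: "fls_nth (f * g) n = (\<Sum>i\<in>{a..n-b}. fls_nth f i * fls_nth g (n - i))" for n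
  proof -
    define a' where "a' = min a (fls_subdegree f)"
    define b' where "b' = min b (fls_subdegree g)"
    have "fls_nth (f * g) n = (\<Sum>i=a'..n-b'. fls_nth f i * fls_nth g (n - i))"
      by (rule fls_times_nth_bounds) (auto simp: a'_def b'_def)
    also have "\<dots> = (\<Sum>i\<in>{a..n-b}. fls_nth f i * fls_nth g (n - i))"
      by (intro sum.mono_neutral_right)
         (auto simp: a'_def b'_def not_le assms)
    finally show ?thesis .
  qed
  show "fls_nth (f * g) (a + b) = fls_nth f a * fls_nth g b" by (simp add: *)
  show "n < a + b \<Longrightarrow> fls_nth (f * g) n = 0" by (simp add: *)
qed

text \<open>The bracket of two monomials is their product times the determinant \<open>w\<close> of
  their exponents, so only the leading monomials contribute at the lowest place. The coefficient
  there can vanish, also when the characteristic divides \<open>w\<close>.\<close>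

lemma br_lead:
  fixes f h :: "'k::field fls fls"
  defines "w \<equiv> snd (lval f) * fst (lval h) - fst (lval f) * snd (lval h)"
  shows "fls_nth (fls_nth (br f h) (fst (lval f) + fst (lval h))) (snd (lval f) + snd (lval h))
           = of_int w * (lead f * lead h)" (is "?L = _")
    and "n < fst (lval f) + fst (lval h) \<Longrightarrow> fls_nth (br f h) n = 0"
proof -
  obtain a b where f: "lval f = (a, b)" by force
  obtain c d where h: "lval h = (c, d)" by force
  have f0: "fls_nth f i = 0" if "i < a" for i using f that by (auto simp: lval_def)
  have h0: "fls_nth h i = 0" if "i < c" for i using h that by (auto simp: lval_def)
  have f1: "fls_nth (fls_nth f a) i = 0" if "i < b" for i using f that by (auto simp: lval_def)
  have h1: "fls_nth (fls_nth h c) i = 0" if "i < d" for i using h that by (auto simp: lval_def)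
  have z: "fls_nth (dout f) i = 0" "fls_nth (dinn f) i = 0" if "i < a" for i
    using that by (simp_all add: dout_def dinn_nth fls_euler_nth f0)
  have z': "fls_nth (dout h) i = 0" "fls_nth (dinn h) i = 0" if "i < c" for i
    using that by (simp_all add: dout_def dinn_nth fls_euler_nth h0)
  have oi: "fls_nth (of_int k * u) i = of_int k * fls_nth u i" for k i and u :: "'k fls"
    by (simp add: fls_of_int)
  have "fls_nth (br f h) (a + c) = fls_euler (fls_nth f a) * (of_int c * fls_nth h c)
      - of_int a * fls_nth f a * fls_euler (fls_nth h c)"
    unfolding br_def
    using fls_times_nth_low(1)[of a "dinn f" c "dout h"] fls_times_nth_low(1)[of a "dout f" c "dinn h"] z z'
    by (simp add: dinn_nth dout_def fls_euler_nth)
  then have "fls_nth (fls_nth (br f h) (a + c)) (b + d) =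
     fls_nth (fls_euler (fls_nth f a)) b * fls_nth (of_int c * fls_nth h c) d
     - fls_nth (of_int a * fls_nth f a) b * fls_nth (fls_euler (fls_nth h c)) d"
    using fls_times_nth_low(1)[of b "fls_euler (fls_nth f a)" d "of_int c * fls_nth h c"]
      fls_times_nth_low(1)[of b "of_int a * fls_nth f a" d "fls_euler (fls_nth h c)"] f1 h1
    by (simp add: fls_euler_nth oi)
  also have "\<dots> = of_int (b * c - a * d) * (lead f * lead h)"
    by (simp add: fls_euler_nth oi lead_def f h algebra_simps)
  finally show "?L = of_int w * (lead f * lead h)" by (simp add: w_def f h)
  show "fls_nth (br f h) n = 0" if "n < fst (lval f) + fst (lval h)"
    using that fls_times_nth_low(2)[of a "dinn f" c "dout h" n] fls_times_nth_low(2)[of a "dout f" c "dinn h" n] z z'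
    unfolding br_def by (simp add: f h)
qed

lemma tdeg_br_le:
  assumes "br f h \<noteq> 0"
  shows "tdeg (br f h) \<le> tdeg f + tdeg h"
proof -
  have "fst (lval f) + fst (lval h) \<le> fls_subdegree (br f h)"
    using assms br_lead(2)[of _ f h] by (intro fls_subdegree_geI) auto
  then show ?thesis by (simp add: tdeg_def fst_lval)
qed

text \<open>A zero determinant would kill the coefficient of \<open>br f h\<close> at
  \<open>lval f + lval h\<close>, but under the hypothesis this is its leading coefficient.\<close>

lemma lval_br_wedge:
  assumes "f \<noteq> 0" "h \<noteq> 0" "br f h = scal J * (f * h)" "J \<noteq> 0"
  shows "snd (lval f) * fst (lval h) \<noteq> fst (lval f) * snd (lval h)"
proof
  assume *: "snd (lval f) * fst (lval h) = fst (lval f) * snd (lval h)"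
  have nz: "br f h \<noteq> 0" using assms by simp
  have "lval (br f h) = lval f + lval h"
    using assms by (simp add: lval_mult zero_prod_def)
  then have "lead (br f h) = 0"
    using br_lead(1)[of f h] * by (simp add: lead_def)
  then show False using lead_nonzero[OF nz] by simp
qed

section \<open>Evaluation and algebraic independence\<close>

text \<open>The coefficient map is a parameter so that evaluations nest: the coefficient map of
  \<open>ev2\<close> is \<open>ev1 X\<close>, again a ring map by
  \<open>ring_map_eval_with\<close>.\<close>

definition eval_with :: "('a::comm_ring_1 \<Rightarrow> 'b::comm_ring_1) \<Rightarrow> 'b \<Rightarrow> 'a poly \<Rightarrow> 'b" where
  "eval_with h x p = poly (map_poly h p) x"

definition ring_map :: "('a::comm_ring_1 \<Rightarrow> 'b::comm_ring_1) \<Rightarrow> bool" where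
  "ring_map h \<longleftrightarrow> h 1 = 1 \<and> (\<forall>a b. h (a + b) = h a + h b) \<and> (\<forall>a b. h (a * b) = h a * h b)"

lemma ring_mapD:
  assumes "ring_map h"
  shows "h 0 = 0" "h 1 = 1" "h (a + b) = h a + h b" "h (a * b) = h a * h b"
    "h (- a) = - h a" "h (a - b) = h a - h b" "h (a ^ n) = h a ^ n" "h (sum f S) = (\<Sum>i\<in>S. h (f i))"
proof -
  have add: "h (a + b) = h a + h b" for a b using assms by (simp add: ring_map_def)
  then show "h (a + b) = h a + h b" .
  show one: "h 1 = 1" using assms by (simp add: ring_map_def)
  show mult: "h (a * b) = h a * h b" for a b using assms by (simp add: ring_map_def)
  show z: "h 0 = 0" using add[of 0 0] by simp
  show neg: "h (- a) = - h a" for a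
  proof -
    have "h a + h (- a) = 0" using add[of a "- a"] z by simp
    then show ?thesis by (metis minus_unique)
  qed
  show "h (a - b) = h a - h b" using add[of a "- b"] neg by simp
  show "h (a ^ n) = h a ^ n" by (induction n) (auto simp: one mult)
  show "h (sum f S) = (\<Sum>i\<in>S. h (f i))"
    by (induction S rule: infinite_finite_induct) (auto simp: z add)
qed

lemma ring_map_scal: "ring_map scal"
  by (simp add: ring_map_def)

context
  fixes h :: "'a::comm_ring_1 \<Rightarrow> 'b::comm_ring_1"
  assumes h: "ring_map h"
begin

lemma eval_with_pCons: "eval_with h x (pCons a p) = h a + x * eval_with h x p"
  by (simp add: eval_with_def map_poly_pCons ring_mapD(1)[OF h])

lemma eval_with_0: "eval_with h x 0 = 0"
  by (simp add: eval_with_def)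

lemma eval_with_const: "eval_with h x [:a:] = h a"
  using eval_with_pCons[of x a 0] eval_with_0[of x] by simp

lemma eval_with_add: "eval_with h x (p + q) = eval_with h x p + eval_with h x q"
proof (induction p arbitrary: q)
  case (pCons a p)
  then show ?case
    by (cases q) (simp add: eval_with_pCons ring_mapD[OF h] algebra_simps)
qed (simp add: eval_with_0)

lemma eval_with_smult: "eval_with h x (smult c p) = h c * eval_with h x p"
  by (induction p) (auto simp: eval_with_0 eval_with_pCons ring_mapD[OF h] algebra_simps)

lemma eval_with_mult: "eval_with h x (p * q) = eval_with h x p * eval_with h x q"
  by (induction p) (auto simp: eval_with_0 eval_with_pCons eval_with_add eval_with_smult ring_mapD[OF h] algebra_simps)

lemma ring_map_eval_with: "ring_map (eval_with h x)"
  unfolding ring_map_def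
  using eval_with_const[of x 1]
  by (simp add: eval_with_add eval_with_mult ring_mapD[OF h] one_pCons)

lemma eval_with_altdef:
  assumes "degree p \<le> n"
  shows "eval_with h x p = (\<Sum>i\<le>n. h (coeff p i) * x ^ i)"
proof -
  have co: "coeff (map_poly h p) i = h (coeff p i)" for i
    by (rule coeff_map_poly) (rule ring_mapD(1)[OF h])
  have "\<forall>i>n. coeff (map_poly h p) i = 0"
    using assms by (auto simp: co coeff_eq_0 ring_mapD(1)[OF h])
  then have deg: "degree (map_poly h p) \<le> n" by (rule degree_le)
  have "eval_with h x p = (\<Sum>i\<le>degree (map_poly h p). coeff (map_poly h p) i * x ^ i)"
    by (simp add: eval_with_def poly_altdef)
  also have "\<dots> = (\<Sum>i\<le>n. coeff (map_poly h p) i * x ^ i)"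
    using deg by (intro sum.mono_neutral_left) (auto simp: coeff_eq_0)
  finally show ?thesis by (simp add: co)
qed

lemma eval_with_monom: "eval_with h x (monom c n) = h c * x ^ n"
proof (induction n)
  case 0
  then show ?case by (simp add: monom_0 eval_with_const)
next
  case (Suc n)
  then show ?case by (simp add: monom_Suc eval_with_pCons ring_mapD(1)[OF h] mult_ac)
qed

end

abbreviation ev1 :: "'k::field fls fls \<Rightarrow> 'k poly \<Rightarrow> 'k fls fls" where
  "ev1 X \<equiv> eval_with scal X"
abbreviation ev2 :: "'k::field fls fls \<Rightarrow> 'k fls fls \<Rightarrow> 'k poly poly \<Rightarrow> 'k fls fls" where
  "ev2 X Y \<equiv> eval_with (ev1 X) Y"
abbreviation ev3 :: "'k::field fls fls \<Rightarrow> 'k fls fls \<Rightarrow> 'k fls fls \<Rightarrow> 'k poly poly poly \<Rightarrow> 'k fls fls" where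
  "ev3 X Y Z \<equiv> eval_with (ev2 X Y) Z"

lemmas ring_map_ev1 = ring_map_eval_with[OF ring_map_scal]
lemmas ring_map_ev2 = ring_map_eval_with[OF ring_map_ev1]
lemmas ring_map_ev3 = ring_map_eval_with[OF ring_map_ev2]

lemmas ev1_simps = eval_with_pCons[OF ring_map_scal] eval_with_monom[OF ring_map_scal] eval_with_smult[OF ring_map_scal]
lemmas ev2_simps = eval_with_pCons[OF ring_map_ev1] eval_with_monom[OF ring_map_ev1] eval_with_smult[OF ring_map_ev1]
lemmas ev3_simps = eval_with_pCons[OF ring_map_ev2] eval_with_monom[OF ring_map_ev2] eval_with_smult[OF ring_map_ev2]
lemmas ev1_hom [simp] = ring_mapD(1-7)[OF ring_map_ev1]
lemmas ev2_hom [simp] = ring_mapD(1-7)[OF ring_map_ev2]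
lemmas ev3_hom [simp] = ring_mapD(1-7)[OF ring_map_ev3]

definition bsupp :: "'k::zero poly poly \<Rightarrow> (nat \<times> nat) set" where
  "bsupp F = {(i, j). coeff (coeff F j) i \<noteq> 0}"

text \<open>A crude bound for both exponents; only the finiteness of the box matters.\<close>

definition bdim :: "'k::zero poly poly \<Rightarrow> nat" where
  "bdim F = degree F + (\<Sum>j\<le>degree F. degree (coeff F j))"

lemma bsupp_subset: "bsupp F \<subseteq> {..bdim F} \<times> {..bdim F}"
proof safe
  fix i j assume "(i, j) \<in> bsupp F"
  then have ij: "coeff (coeff F j) i \<noteq> 0" by (simp add: bsupp_def)
  then have j: "j \<le> degree F" by (metis coeff_0 le_degree)
  then show "j \<le> bdim F" by (simp add: bdim_def)
  have "degree (coeff F j) \<le> (\<Sum>j\<le>degree F. degree (coeff F j))"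
    using j member_le_sum[of j "{..degree F}" "\<lambda>j. degree (coeff F j)"] by simp
  then show "i \<le> bdim F" using le_degree[OF ij] by (simp add: bdim_def)
qed

lemma finite_bsupp: "finite (bsupp F)"
  by (rule finite_subset[OF bsupp_subset]) simp

lemma bsupp_empty_iff: "bsupp F = {} \<longleftrightarrow> F = 0"
  by (auto simp: bsupp_def poly_eq_iff)

lemma ev2_bsum:
  assumes "bsupp F \<subseteq> {..n} \<times> {..n}"
  shows "ev2 X Y F = (\<Sum>(i,j)\<in>bsupp F. scal (coeff (coeff F j) i) * (X ^ i * Y ^ j))"
proof -
  have inner: "ev1 X (coeff F j) = (\<Sum>i\<le>n. scal (coeff (coeff F j) i) * X ^ i)" for j
  proof -
    have "degree (coeff F j) \<le> n"
    proof (rule degree_le, safe)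
      fix i assume "n < i"
      then have "(i, j) \<notin> bsupp F" using assms by auto
      then show "coeff (coeff F j) i = 0" by (simp add: bsupp_def)
    qed
    then show ?thesis by (rule eval_with_altdef[OF ring_map_scal])
  qed
  have "degree F \<le> n"
  proof (rule degree_le, safe)
    fix j assume "n < j"
    then have "(i, j) \<notin> bsupp F" for i using assms by auto
    then show "coeff F j = 0" by (intro poly_eqI) (simp add: bsupp_def)
  qed
  then have "ev2 X Y F = (\<Sum>j\<le>n. ev1 X (coeff F j) * Y ^ j)"
    by (rule eval_with_altdef[OF ring_map_ev1])
  also have "\<dots> = (\<Sum>j\<le>n. \<Sum>i\<le>n. scal (coeff (coeff F j) i) * (X ^ i * Y ^ j))"
    by (simp add: inner sum_distrib_right mult.assoc)
  also have "\<dots> = (\<Sum>i\<le>n. \<Sum>j\<le>n. scal (coeff (coeff F j) i) * (X ^ i * Y ^ j))"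
    by (rule sum.swap)
  also have "\<dots> = (\<Sum>(i,j)\<in>{..n} \<times> {..n}. scal (coeff (coeff F j) i) * (X ^ i * Y ^ j))"
    by (simp add: sum.cartesian_product)
  also have "\<dots> = (\<Sum>(i,j)\<in>bsupp F. scal (coeff (coeff F j) i) * (X ^ i * Y ^ j))"
    using assms by (intro sum.mono_neutral_right) (auto simp: bsupp_def)
  finally show ?thesis .
qed

section \<open>Leading exponents and algebraic independence\<close>

definition wedge :: "'k::field fls fls \<Rightarrow> 'k fls fls \<Rightarrow> int" where
  "wedge X Y = snd (lval X) * fst (lval Y) - fst (lval X) * snd (lval Y)"

lemma wedge_cancel:
  fixes a b c d i j i' j' :: int
  assumes "b * c - a * d \<noteq> 0" "i * a + j * c = i' * a + j' * c" "i * b + j * d = i' * b + j' * d"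
  shows "i = i' \<and> j = j'"
proof -
  have 1: "(i - i') * a = (j' - j) * c" using assms(2) by (simp add: algebra_simps)
  have 2: "(i - i') * b = (j' - j) * d" using assms(3) by (simp add: algebra_simps)
  have "(i - i') * (b * c - a * d) = ((i - i') * b) * c - ((i - i') * a) * d"
    by (simp add: algebra_simps)
  also have "\<dots> = 0" unfolding 1 2 by simp
  finally have "i = i'" using assms(1) by simp
  moreover have "(j' - j) * (b * c - a * d) = b * ((j' - j) * c) - a * ((j' - j) * d)"
    by (simp add: algebra_simps)
  then have "(j' - j) * (b * c - a * d) = 0" unfolding 1[symmetric] 2[symmetric] by simp
  then have "j = j'" using assms(1) by simp
  ultimately show ?thesis by simp
qed

text \<open>Independent leading exponents give distinct monomials in \<open>X\<close>,
  \<open>Y\<close> distinct values, so \<open>lval_sum\<close> applies and the value is the minimum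
  over the support of \<open>F\<close>.\<close>

lemma ev2_lval:
  assumes w: "wedge X Y \<noteq> 0" and nz: "X \<noteq> 0" "Y \<noteq> 0" and F: "F \<noteq> 0"
  shows "ev2 X Y F \<noteq> 0"
    and "\<And>i j. coeff (coeff F j) i \<noteq> 0 \<Longrightarrow> int i * tdeg X + int j * tdeg Y \<le> tdeg (ev2 X Y F)"
    and "\<exists>i j. coeff (coeff F j) i \<noteq> 0 \<and> lval (ev2 X Y F) = lval (X ^ i * Y ^ j)"
    and "\<And>i j. coeff (coeff F j) i \<noteq> 0 \<Longrightarrow> lval (ev2 X Y F) \<le> lval (X ^ i * Y ^ j)"
proof -
  define t where "t = (\<lambda>(i,j). scal (coeff (coeff F j) i) * (X ^ i * Y ^ j))"
  have t0: "t s \<noteq> 0" if "s \<in> bsupp F" for s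
    using that nz by (auto simp: t_def bsupp_def)
  have tval: "lval (t s) = lval (X ^ fst s * Y ^ snd s)" if "s \<in> bsupp F" for s
    using that nz by (auto simp: t_def bsupp_def lval_mult)
  have tval': "lval (X ^ i * Y ^ j) = (int i * fst (lval X) + int j * fst (lval Y), int i * snd (lval X) + int j * snd (lval Y))" for i j
    using nz by (simp add: lval_mult lval_power)
  have inj: "inj_on (lval \<circ> t) (bsupp F)"
  proof (rule inj_onI)
    fix s s' assume s: "s \<in> bsupp F" "s' \<in> bsupp F" "(lval \<circ> t) s = (lval \<circ> t) s'"
    obtain i j where ij: "s = (i, j)" by force
    obtain i' j' where ij': "s' = (i', j')" by force
    have "int i = int i' \<and> int j = int j'"
      by (rule wedge_cancel[of "snd (lval X)" "fst (lval Y)" "fst (lval X)" "snd (lval Y)"])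
         (use w s tval tval' in \<open>auto simp: wedge_def ij ij'\<close>)
    then show "s = s'" by (simp add: ij ij')
  qed
  have ev: "ev2 X Y F = sum t (bsupp F)"
    unfolding t_def by (rule ev2_bsum[OF bsupp_subset])
  have ne: "bsupp F \<noteq> {}" using F by (simp add: bsupp_empty_iff)
  have *: "sum t (bsupp F) \<noteq> 0 \<and> lval (sum t (bsupp F)) = Min ((lval \<circ> t) ` bsupp F)"
    by (rule lval_sum) (use finite_bsupp ne t0 inj in auto)
  then show "ev2 X Y F \<noteq> 0" by (simp add: ev)
  have "Min ((lval \<circ> t) ` bsupp F) \<in> (lval \<circ> t) ` bsupp F"
    using finite_bsupp ne by (intro Min_in) auto
  then obtain s where s: "s \<in> bsupp F" "lval (sum t (bsupp F)) = lval (t s)" using * by auto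
  then show "\<exists>i j. coeff (coeff F j) i \<noteq> 0 \<and> lval (ev2 X Y F) = lval (X ^ i * Y ^ j)"
    using tval[OF s(1)] by (cases s) (auto simp: ev bsupp_def)
  show le: "lval (ev2 X Y F) \<le> lval (X ^ i * Y ^ j)" if "coeff (coeff F j) i \<noteq> 0" for i j
  proof -
    have s: "(i, j) \<in> bsupp F" using that by (simp add: bsupp_def)
    then have "lval (sum t (bsupp F)) \<le> lval (t (i, j))"
      using * finite_bsupp by (auto intro!: Min_le)
    then show ?thesis using tval[OF s] by (simp add: ev)
  qed
  show "int i * tdeg X + int j * tdeg Y \<le> tdeg (ev2 X Y F)" if "coeff (coeff F j) i \<noteq> 0" for i j
  proof -
    have "fst (lval (ev2 X Y F)) \<le> fst (lval (X ^ i * Y ^ j))"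
      using le[OF that] by (auto simp: less_eq_prod_def)
    then show ?thesis using tval'[of i j] by (simp add: fst_lval)
  qed
qed

definition indep :: "'k::field fls fls \<Rightarrow> 'k fls fls \<Rightarrow> bool" where
  "indep X Y \<longleftrightarrow> (\<forall>F. ev2 X Y F = 0 \<longrightarrow> F = 0)"

lemma indep_nonzero:
  assumes "indep X Y" shows "X \<noteq> 0" "Y \<noteq> 0"
proof -
  have "ev2 X Y [:[:0, 1:]:] = X" "ev2 X Y [:0, 1:] = Y" by (simp_all add: ev2_simps ev1_simps)
  then show "X \<noteq> 0" "Y \<noteq> 0"
    using assms unfolding indep_def by fastforce+
qed

lemma indep_wedge: "wedge X Y \<noteq> 0 \<Longrightarrow> X \<noteq> 0 \<Longrightarrow> Y \<noteq> 0 \<Longrightarrow> indep X Y"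
  unfolding indep_def using ev2_lval(1) by blast

lemma indep_inj: "indep X Y \<Longrightarrow> ev2 X Y F = ev2 X Y G \<Longrightarrow> F = G"
  unfolding indep_def by (metis ev2_hom(6) right_minus_eq)

lemma wedge_tx_ty: "wedge tx ty = 1"
  by (simp add: wedge_def lval_tx lval_ty)

lemma indep_tx_ty: "indep tx ty"
  by (rule indep_wedge) (simp_all add: wedge_tx_ty)

text \<open>Divisibility of rows by powers of one polynomial and of columns by powers of another is
  visible only for opposite nestings of the variables; this transposition passes between
  them.\<close>

definition bswap :: "'k::comm_ring_1 poly poly \<Rightarrow> 'k poly poly" where
  "bswap F = (\<Sum>(i,j)\<in>bsupp F. monom (monom (coeff (coeff F j) i) j) i)"

lemma coeff_bswap: "coeff (coeff (bswap F) i) j = coeff (coeff F j) i"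
proof -
  have "coeff (coeff (bswap F) i) j =
    (\<Sum>s\<in>bsupp F. if s = (i, j) then coeff (coeff F j) i else 0)"
    unfolding bswap_def coeff_sum
    by (intro sum.cong) (auto simp: coeff_monom split: if_splits)
  also have "\<dots> = coeff (coeff F j) i"
    by (subst sum.delta[OF finite_bsupp]) (auto simp: bsupp_def)
  finally show ?thesis .
qed

lemma ev2_bswap: "ev2 X Y (bswap F) = ev2 Y X F"
  unfolding bswap_def ev2_bsum[OF bsupp_subset[of F], of Y X]
  by (simp add: ring_mapD(8)[OF ring_map_ev2] case_prod_unfold ev1_simps ev2_simps mult_ac)

lemma indep_swap:
  assumes "indep X Y"
  shows "indep Y X"
  unfolding indep_def
proof (intro allI impI)
  fix F assume "ev2 Y X F = 0"
  then have "bswap F = 0" using assms ev2_bswap[of X Y F] by (simp add: indep_def)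
  then have "coeff (coeff F j) i = 0" for i j using coeff_bswap[of F i j] by simp
  then show "F = 0" by (intro poly_eqI) simp
qed

lemma ev2_swap_coeff:
  assumes "indep X Y" "ev2 X Y F = ev2 Y X G"
  shows "coeff (coeff F j) i = coeff (coeff G i) j"
  using assms indep_inj[of X Y F "bswap G"] by (simp add: ev2_bswap coeff_bswap)

lemma ev2_const_poly: "ev2 X Y [:p:] = ev1 X p"
  by (simp add: ev2_simps)

section \<open>Clusters\<close>

definition subalg :: "'k::field fls fls set \<Rightarrow> bool" where
  "subalg A \<longleftrightarrow> (\<forall>c. scal c \<in> A) \<and> (\<forall>f\<in>A. \<forall>h\<in>A. f + h \<in> A \<and> f * h \<in> A)"

definition galg :: "'k::field fls fls \<Rightarrow> 'k fls fls \<Rightarrow> 'k fls fls \<Rightarrow> 'k fls fls set" where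
  "galg X Y Z = range (ev3 X Y Z)"

lemma subalgD:
  assumes "subalg A"
  shows "scal c \<in> A" "f \<in> A \<Longrightarrow> h \<in> A \<Longrightarrow> f + h \<in> A" "f \<in> A \<Longrightarrow> h \<in> A \<Longrightarrow> f * h \<in> A"
    "0 \<in> A" "1 \<in> A" "f \<in> A \<Longrightarrow> - f \<in> A" "f \<in> A \<Longrightarrow> h \<in> A \<Longrightarrow> f - h \<in> A" "f \<in> A \<Longrightarrow> f ^ n \<in> A"
proof -
  show s: "scal c \<in> A" for c using assms by (simp add: subalg_def)
  show add: "f \<in> A \<Longrightarrow> h \<in> A \<Longrightarrow> f + h \<in> A" for f h using assms by (simp add: subalg_def)
  show mult: "f \<in> A \<Longrightarrow> h \<in> A \<Longrightarrow> f * h \<in> A" for f h using assms by (simp add: subalg_def)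
  show "0 \<in> A" using s[of 0] by simp
  show one: "1 \<in> A" using s[of 1] by simp
  show neg: "f \<in> A \<Longrightarrow> - f \<in> A" for f using mult[OF s[of "-1"], of f] by simp
  show "f \<in> A \<Longrightarrow> h \<in> A \<Longrightarrow> f - h \<in> A" using add[of f "- h"] neg[of h] by simp
  show "f \<in> A \<Longrightarrow> f ^ n \<in> A" by (induction n) (auto simp: one mult)
qed

lemma subalg_sum: "subalg A \<Longrightarrow> (\<And>i. i \<in> S \<Longrightarrow> f i \<in> A) \<Longrightarrow> sum f S \<in> A"
  by (induction S rule: infinite_finite_induct) (auto simp: subalgD)

lemma subalg_ev1: "subalg A \<Longrightarrow> X \<in> A \<Longrightarrow> ev1 X p \<in> A"
  by (induction p) (auto simp: ev1_simps subalgD)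

lemma subalg_ev2: "subalg A \<Longrightarrow> X \<in> A \<Longrightarrow> Y \<in> A \<Longrightarrow> ev2 X Y p \<in> A"
  by (induction p) (auto simp: ev2_simps subalgD subalg_ev1)

lemma subalg_ev3: "subalg A \<Longrightarrow> X \<in> A \<Longrightarrow> Y \<in> A \<Longrightarrow> Z \<in> A \<Longrightarrow> ev3 X Y Z p \<in> A"
  by (induction p) (auto simp: ev3_simps subalgD subalg_ev2)

lemma ev3_var: "ev3 X Y Z [:[:[:c:]:]:] = scal c" "ev3 X Y Z [:[:[:0, 1:]:]:] = X"
  "ev3 X Y Z [:[:0, 1:]:] = Y" "ev3 X Y Z [:0, 1:] = Z"
  by (simp_all add: ev3_simps ev2_simps ev1_simps)

lemma galg_gen: "scal c \<in> galg X Y Z" "X \<in> galg X Y Z" "Y \<in> galg X Y Z" "Z \<in> galg X Y Z"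
  unfolding galg_def by (metis ev3_var rangeI)+

lemma subalg_galg: "subalg (galg X Y Z)"
  unfolding subalg_def
proof (intro conjI ballI allI galg_gen)
  fix f h assume "f \<in> galg X Y Z" "h \<in> galg X Y Z"
  then obtain p q where "f = ev3 X Y Z p" "h = ev3 X Y Z q" by (auto simp: galg_def)
  then have "f + h = ev3 X Y Z (p + q)" "f * h = ev3 X Y Z (p * q)" by simp_all
  then show "f + h \<in> galg X Y Z" "f * h \<in> galg X Y Z" unfolding galg_def by blast+
qed

lemma galg_subset: "subalg A \<Longrightarrow> X \<in> A \<Longrightarrow> Y \<in> A \<Longrightarrow> Z \<in> A \<Longrightarrow> galg X Y Z \<subseteq> A"
  by (auto simp: galg_def subalg_ev3)

lemma galg_swap: "galg X Y Z = galg Y X Z"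
  by (intro equalityI galg_subset subalg_galg galg_gen)

text \<open>The mixed terms of a cubic are \<open>X * Y\<close> times a linear polynomial and can be
  moved into the third generator. This normal form keeps the two univariate parts, whose common
  constant term would otherwise be counted twice.\<close>

definition zof :: "'k::field fls fls \<Rightarrow> 'k fls fls \<Rightarrow> 'k poly \<Rightarrow> 'k poly \<Rightarrow> 'k fls fls" where
  "zof X Y P Q = (ev1 X P + ev1 Y Q - scal (coeff P 0)) / (X * Y)"

definition cubic_pair :: "'k::field poly \<Rightarrow> 'k poly \<Rightarrow> bool" where
  "cubic_pair P Q \<longleftrightarrow> degree P = 3 \<and> degree Q = 3 \<and> coeff P 0 = coeff Q 0 \<and> coeff P 0 \<noteq> 0"

definition cluster :: "'k::field fls fls set \<Rightarrow> 'k fls fls \<Rightarrow> 'k fls fls \<Rightarrow> 'k poly \<Rightarrow> 'k poly \<Rightarrow> bool" where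
  "cluster A X Y P Q \<longleftrightarrow> indep X Y \<and> cubic_pair P Q \<and> A = galg X Y (zof X Y P Q)"

lemma cubic_pair_swap: "cubic_pair P Q \<Longrightarrow> cubic_pair Q P"
  unfolding cubic_pair_def by metis

lemma cubic_pair_nonzero: "cubic_pair P Q \<Longrightarrow> coeff P 0 \<noteq> 0 \<and> coeff Q 0 \<noteq> 0"
  unfolding cubic_pair_def by metis

lemma zof_swap: "cubic_pair P Q \<Longrightarrow> zof X Y P Q = zof Y X Q P"
  by (simp add: zof_def cubic_pair_def algebra_simps)

lemma cluster_swap: "cluster A X Y P Q \<Longrightarrow> cluster A Y X Q P"
  unfolding cluster_def using indep_swap cubic_pair_swap zof_swap galg_swap by metis

lemma cubic_coeffs:
  assumes "degree P = 3"
  shows "P = [:coeff P 0, coeff P 1, coeff P 2, coeff P 3:]"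
proof (rule poly_eqI)
  fix n
  show "coeff P n = coeff [:coeff P 0, coeff P 1, coeff P 2, coeff P 3:] n"
  proof (cases "n \<le> 3")
    case True
    then have "n = 0 \<or> n = 1 \<or> n = 2 \<or> n = 3" by auto
    then show ?thesis by (auto simp: numeral_2_eq_2 numeral_3_eq_3)
  next
    case False
    then have "degree [:coeff P 0, coeff P 1, coeff P 2, coeff P 3:] < n"
      by (intro le_less_trans[OF degree_pCons_le]) auto
    then show ?thesis using False assms by (simp only: coeff_eq_0 not_le)
  qed
qed

lemma ev1_cubic:
  assumes "degree P = 3"
  shows "ev1 X P = scal (coeff P 0) + scal (coeff P 1) * X + scal (coeff P 2) * X ^ 2 + scal (coeff P 3) * X ^ 3"
  by (subst cubic_coeffs[OF assms])
     (simp add: ev1_simps algebra_simps power2_eq_square power3_eq_cube)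

text \<open>This is \<open>T\<^sup>3 P(c/T)\<close>, where \<open>c = P(0)\<close>, rescaled to have constant coefficient \<open>c\<close> again.\<close>

definition mutp :: "'k::field poly \<Rightarrow> 'k poly" where
  "mutp P = [:coeff P 0, coeff P 2 / coeff P 3, coeff P 1 / (coeff P 3 * coeff P 0), 1 / (coeff P 3 * coeff P 0):]"

lemma coeff_3_nonzero: "cubic_pair P Q \<Longrightarrow> coeff P 3 \<noteq> 0" "cubic_pair P Q \<Longrightarrow> coeff Q 3 \<noteq> 0"
  unfolding cubic_pair_def
  by (metis coeff_0 leading_coeff_0_iff)+

lemma coeff_mutp: "coeff (mutp P) 0 = coeff P 0" "coeff (mutp P) 1 = coeff P 2 / coeff P 3"
   "coeff (mutp P) 2 = coeff P 1 / (coeff P 3 * coeff P 0)" "coeff (mutp P) 3 = 1 / (coeff P 3 * coeff P 0)"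
  by (simp_all add: mutp_def numeral_2_eq_2 numeral_3_eq_3)

lemma cubic_pair_mutp:
  assumes "cubic_pair P Q"
  shows "cubic_pair (mutp P) Q"
proof -
  have "coeff P 3 \<noteq> 0" "coeff P 0 \<noteq> 0"
    using coeff_3_nonzero[OF assms] cubic_pair_nonzero[OF assms] by auto
  then have "degree (mutp P) = 3" by (simp add: mutp_def)
  then show ?thesis using assms unfolding cubic_pair_def by (metis coeff_mutp(1))
qed

text \<open>The substitution of \<open>c/T\<close> for \<open>T\<close> is an involution, and the
  chosen scaling keeps it an exact one. Hence the exchange polynomials repeat exactly after four
  mutations.\<close>

lemma mutp_mutp:
  assumes "cubic_pair P Q"
  shows "mutp (mutp P) = P"
proof -
  have "coeff P 3 \<noteq> 0" "coeff P 0 \<noteq> 0" using assms coeff_3_nonzero[OF assms] by (auto simp: cubic_pair_def)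
  then have "mutp (mutp P) = [:coeff P 0, coeff P 1, coeff P 2, coeff P 3:]"
    unfolding mutp_def[of "mutp P"] coeff_mutp by simp
  then show ?thesis using cubic_coeffs[of P] assms by (simp add: cubic_pair_def)
qed

lemma zof_mult: "X \<noteq> 0 \<Longrightarrow> Y \<noteq> 0 \<Longrightarrow> X * Y * zof X Y P Q = ev1 X P + ev1 Y Q - scal (coeff P 0)"
  by (simp add: zof_def)

text \<open>\<open>P(X) - c\<close> is divisible by \<open>X\<close>, so dividing
  \<open>X * Y * Z = Q(Y) + (P(X) - c)\<close> by \<open>X\<close> expresses the new variable as a
  polynomial in the generators.\<close>

lemma neighbour_formula:
  assumes PQ: "cubic_pair P Q" and nz: "X \<noteq> 0" "Y \<noteq> 0"
  shows "ev1 Y Q / X = Y * zof X Y P Q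
    - (scal (coeff P 3) * X ^ 2 + scal (coeff P 2) * X + scal (coeff P 1))"
proof -
  have "X * (Y * zof X Y P Q - (scal (coeff P 3) * X ^ 2 + scal (coeff P 2) * X + scal (coeff P 1))) = ev1 Y Q"
    using zof_mult[OF nz, of P Q] PQ
    by (simp add: ev1_cubic cubic_pair_def algebra_simps power2_eq_square power3_eq_cube)
  then show ?thesis using nz by (simp add: field_simps)
qed

text \<open>Modulo \<open>Y\<close> one has \<open>X * u = c\<close>, so \<open>mutp P\<close> at
  \<open>u\<close> is a multiple of \<open>u ^ 3 * P(X)\<close>, and \<open>P(X)\<close> vanishes
  there since \<open>X * Y * Z = P(X) + Q(Y) - c\<close>. So the numerator of the new third
  generator is divisible by \<open>Y\<close>; it is divisible by \<open>u\<close> because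
  \<open>ev1 Y Q = X * u\<close>. The proof computes the quotient.\<close>

lemma mut_subset:
  assumes PQ: "cubic_pair P Q" and nz: "X \<noteq> 0" "Y \<noteq> 0" "ev1 Y Q \<noteq> 0"
  shows "galg Y (ev1 Y Q / X) (zof Y (ev1 Y Q / X) Q (mutp P)) \<subseteq> galg X Y (zof X Y P Q)"
proof -
  define Z where "Z = zof X Y P Q"
  define u where "u = ev1 Y Q / X"
  define a where "a = scal (coeff P 3)"
  define a2 where "a2 = scal (coeff P 2)"
  define a1 where "a1 = scal (coeff P 1)"
  define c where "c = scal (coeff P 0)"
  define r where "r = scal (coeff Q 1) + scal (coeff Q 2) * Y + scal (coeff Q 3) * Y ^ 2"
  note A = subalgD[OF subalg_galg[of X Y Z]] galg_gen
  have nz': "a \<noteq> 0" "c \<noteq> 0" "u \<noteq> 0"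
    using PQ coeff_3_nonzero[OF PQ] nz by (auto simp: a_def c_def u_def cubic_pair_def)
  have u: "u = Y * Z - (a * X ^ 2 + a2 * X + a1)"
    unfolding u_def Z_def a_def a2_def a1_def by (rule neighbour_formula[OF PQ nz(1,2)])
  have uA: "u \<in> galg X Y Z" unfolding u a_def a2_def a1_def by (intro A)
  have Xu: "X * u = ev1 Y Q" using nz by (simp add: u_def)
  have Qr: "ev1 Y Q = c + Y * r"
    using PQ by (simp add: ev1_cubic cubic_pair_def c_def r_def algebra_simps power2_eq_square power3_eq_cube)
  have "scal (coeff (mutp P) 1) = a2 * scal (inverse (coeff P 3))" 
       "scal (coeff (mutp P) 2) = a1 * scal (inverse (coeff P 3 * coeff P 0))" 
       "scal (coeff (mutp P) 3) = scal (inverse (coeff P 3 * coeff P 0))"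
    by (simp_all add: coeff_mutp coeff_mutp(2)[unfolded One_nat_def] divide_inverse a2_def a1_def flip: scal_simps(4))
  moreover have inv3: "a * scal (inverse (coeff P 3)) = 1"
    using nz' by (simp add: a_def flip: scal_simps(2,4))
  moreover have inv30: "a * c * scal (inverse (coeff P 3 * coeff P 0)) = 1"
  proof -
    have "coeff P 3 * coeff P 0 * inverse (coeff P 3 * coeff P 0) = 1"
      using nz' by (intro right_inverse) (auto simp: a_def c_def)
    then show ?thesis unfolding a_def c_def scal_simps(4)[symmetric] by (simp only: scal_simps(2))
  qed
  ultimately have co: "a * c * scal (coeff (mutp P) 1) = c * a2" "a * c * scal (coeff (mutp P) 2) = a1" 
       "a * c * scal (coeff (mutp P) 3) = 1" by (simp_all add: algebra_simps)
  have "a * c * ev1 u (mutp P) = a * c * c + (a * c * scal (coeff (mutp P) 1)) * u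
     + (a * c * scal (coeff (mutp P) 2)) * u ^ 2 + (a * c * scal (coeff (mutp P) 3)) * u ^ 3"
    using cubic_pair_mutp[OF PQ] by (simp add: ev1_cubic cubic_pair_def c_def coeff_mutp(1) algebra_simps)
  then have mp: "a * c * ev1 u (mutp P) = a * c * c + c * a2 * u + a1 * u ^ 2 + u ^ 3"
    by (simp only: co) simp
  have c': "scal (coeff Q 0) = c" using PQ by (simp add: cubic_pair_def c_def)
  have "a * c * (Y * u * zof Y u Q (mutp P)) = a * c * (ev1 Y Q + ev1 u (mutp P) - c)"
    using zof_mult[of Y u Q "mutp P"] nz nz' c' by simp
  also have "\<dots> = Y * u * (u * Z - (a * X + a2) * r)"
  proof -
    have "a * c * (ev1 Y Q + ev1 u (mutp P) - c) = a * c * (X * u) + c * a2 * u + a1 * u ^ 2 + u ^ 3"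
      using mp by (simp add: algebra_simps Xu)
    \<comment> \<open>Rearranged to exhibit the two factors divisible by \<open>Y\<close>, which are
      \<open>Y * Z\<close> and \<open>X * u - c = Y * r\<close>.\<close>
    also have "\<dots> = u * (u * (u + (a * X ^ 2 + a2 * X + a1)) - (a * X + a2) * (X * u - c))"
      by (simp add: algebra_simps power2_eq_square power3_eq_cube)
    also have "u + (a * X ^ 2 + a2 * X + a1) = Y * Z" using u by simp
    also have "X * u - c = Y * r" using Xu Qr by simp
    also have "u * (u * (Y * Z) - (a * X + a2) * (Y * r)) = Y * u * (u * Z - (a * X + a2) * r)"
      by (simp add: algebra_simps)
    finally show ?thesis .
  qed
  finally have "a * c * zof Y u Q (mutp P) = u * Z - (a * X + a2) * r"
    using nz nz' by (simp add: mult.assoc mult.left_commute)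
  then have "scal (inverse (coeff P 3 * coeff P 0)) * (a * c * zof Y u Q (mutp P))
      = scal (inverse (coeff P 3 * coeff P 0)) * (u * Z - (a * X + a2) * r)" by simp
  moreover have "scal (inverse (coeff P 3 * coeff P 0)) * (a * c) = 1"
    using inv30 by (simp only: mult.commute)
  ultimately have "zof Y u Q (mutp P) = scal (inverse (coeff P 3 * coeff P 0)) * (u * Z - (a * X + a2) * r)"
    by (metis mult.assoc mult_1)
  also have "\<dots> \<in> galg X Y Z"
    unfolding a_def a2_def r_def by (intro A uA)
  finally have "zof Y u Q (mutp P) \<in> galg X Y Z" .
  then show ?thesis
    unfolding u_def[symmetric] Z_def[symmetric]
    by (intro galg_subset subalg_galg A uA)
qed

lemma cluster_nonzero:
  assumes "cluster A X Y P Q"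
  shows "X \<noteq> 0" "Y \<noteq> 0" "ev1 X P \<noteq> 0" "ev1 Y Q \<noteq> 0"
proof -
  have i: "indep X Y" "indep Y X" using assms indep_swap by (auto simp: cluster_def)
  show "X \<noteq> 0" "Y \<noteq> 0" using indep_nonzero i by auto
  have "P \<noteq> 0" "Q \<noteq> 0" using assms by (auto simp: cluster_def cubic_pair_def)
  then show "ev1 X P \<noteq> 0" "ev1 Y Q \<noteq> 0"
    using i unfolding indep_def by (metis ev2_const_poly pCons_eq_0_iff)+
qed

text \<open>One inclusion is \<open>mut_subset\<close>. The other is \<open>mut_subset\<close> for
  the mutated cluster, which mutates back because \<open>ev1 Y Q / u = X\<close> and
  \<open>mutp\<close> is an involution.\<close>

lemma cluster_mutate:
  assumes cl: "cluster A X Y P Q" and ind: "indep Y (ev1 Y Q / X)"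
  shows "cluster A Y (ev1 Y Q / X) Q (mutp P)"
proof -
  define u where "u = ev1 Y Q / X"
  have PQ: "cubic_pair P Q" using cl by (simp add: cluster_def)
  note nz = cluster_nonzero[OF cl]
  have u: "u \<noteq> 0" "ev1 Y Q / u = X" using nz by (auto simp: u_def)
  have 1: "galg Y u (zof Y u Q (mutp P)) \<subseteq> galg X Y (zof X Y P Q)"
    unfolding u_def by (rule mut_subset[OF PQ nz(1,2,4)])
  have "galg Y X (zof Y X Q P) \<subseteq> galg u Y (zof u Y (mutp P) Q)"
    using mut_subset[OF cubic_pair_mutp[OF PQ] u(1) nz(2,4)] by (simp add: u(2) mutp_mutp[OF PQ])
  then have "galg X Y (zof X Y P Q) \<subseteq> galg Y u (zof Y u Q (mutp P))"
    using zof_swap[OF PQ] zof_swap[OF cubic_pair_mutp[OF PQ]] by (simp add: galg_swap)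
  then show ?thesis
    using 1 cl ind cubic_pair_swap[OF cubic_pair_mutp[OF PQ]] by (auto simp: cluster_def u_def)
qed

lemma cluster_subalg:
  assumes "cluster A X Y P Q"
  shows "subalg A" "X \<in> A" "Y \<in> A" "zof X Y P Q \<in> A"
  using assms subalg_galg galg_gen unfolding cluster_def by metis+

lemma cluster_neighbour:
  assumes cl: "cluster A X Y P Q"
  shows "ev1 Y Q / X \<in> A"
proof -
  have PQ: "cubic_pair P Q" using cl by (simp add: cluster_def)
  show ?thesis
    unfolding neighbour_formula[OF PQ cluster_nonzero(1,2)[OF cl]]
    by (intro subalgD[OF cluster_subalg(1)[OF cl]] cluster_subalg[OF cl])
qed

text \<open>
  A Laurent expansion of \<open>f\<close> that exhibits it as an element of \<open>k[Y, 1/Y][X, Q(Y)/X]\<close>.  The outer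
  variable of the bivariate polynomial is \<open>X\<close>; the exponent \<open>M - i\<close> is truncated at 0.
\<close>

definition lrep :: "'k::field fls fls \<Rightarrow> 'k fls fls \<Rightarrow> 'k poly \<Rightarrow> nat \<Rightarrow> nat \<Rightarrow> 'k fls fls \<Rightarrow> bool" where
  "lrep X Y Q M N f \<longleftrightarrow> (\<exists>F. X ^ M * Y ^ N * f = ev2 Y X F \<and> (\<forall>i. Q ^ (M - i) dvd coeff F i))"

lemma lrep_mono:
  assumes "lrep X Y Q M N f" "M \<le> M'" "N \<le> N'"
  shows "lrep X Y Q M' N' f"
proof -
  obtain F where F: "X ^ M * Y ^ N * f = ev2 Y X F" "\<And>i. Q ^ (M - i) dvd coeff F i"
    using assms by (auto simp: lrep_def)
  define G where "G = monom (monom 1 (N' - N)) (M' - M) * F"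
  have "X ^ M' * Y ^ N' * f = X ^ (M' - M) * Y ^ (N' - N) * (X ^ M * Y ^ N * f)"
    using assms by (simp add: algebra_simps flip: power_add)
  also have "\<dots> = ev2 Y X G"
    unfolding F G_def by (simp add: ev1_simps ev2_simps mult_ac)
  finally have "X ^ M' * Y ^ N' * f = ev2 Y X G" .
  moreover have "Q ^ (M' - i) dvd coeff G i" for i
  proof (cases "i < M' - M")
    case False
    then have "M' - i = M - (i - (M' - M))" using assms by simp
    then show ?thesis using F(2)[of "i - (M' - M)"] False by (simp add: G_def coeff_monom_mult)
  qed (simp add: G_def coeff_monom_mult)
  ultimately show ?thesis by (auto simp: lrep_def)
qed

lemma lrep_add:
  assumes "lrep X Y Q M N f" "lrep X Y Q M N g"
  shows "lrep X Y Q M N (f + g)"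
proof -
  obtain F where F: "X ^ M * Y ^ N * f = ev2 Y X F" "\<And>i. Q ^ (M - i) dvd coeff F i"
    using assms by (auto simp: lrep_def)
  obtain G where G: "X ^ M * Y ^ N * g = ev2 Y X G" "\<And>i. Q ^ (M - i) dvd coeff G i"
    using assms by (auto simp: lrep_def)
  have "X ^ M * Y ^ N * (f + g) = ev2 Y X (F + G)"
    unfolding ev2_hom F(1)[symmetric] G(1)[symmetric] by (simp only: distrib_left)
  moreover have "Q ^ (M - i) dvd coeff (F + G) i" for i using F(2) G(2) by simp
  ultimately show ?thesis unfolding lrep_def by blast
qed

lemma lrep_mult:
  assumes "lrep X Y Q M N f" "lrep X Y Q M' N' g"
  shows "lrep X Y Q (M + M') (N + N') (f * g)"
proof -
  obtain F where F: "X ^ M * Y ^ N * f = ev2 Y X F" "\<And>i. Q ^ (M - i) dvd coeff F i"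
    using assms by (auto simp: lrep_def)
  obtain G where G: "X ^ M' * Y ^ N' * g = ev2 Y X G" "\<And>i. Q ^ (M' - i) dvd coeff G i"
    using assms by (auto simp: lrep_def)
  have "X ^ (M + M') * Y ^ (N + N') * (f * g) = ev2 Y X (F * G)"
    unfolding ev2_hom F(1)[symmetric] G(1)[symmetric] by (simp add: power_add mult_ac)
  moreover have "Q ^ (M + M' - i) dvd coeff (F * G) i" for i
    unfolding coeff_mult
  proof (rule dvd_sum)
    fix j assume "j \<in> {..i}"
    have "Q ^ (M + M' - i) dvd Q ^ (M - j) * Q ^ (M' - (i - j))"
      unfolding power_add[symmetric] by (rule le_imp_power_dvd) (use \<open>j \<in> {..i}\<close> in auto)
    also have "\<dots> dvd coeff F j * coeff G (i - j)" by (intro mult_dvd_mono F G)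
    finally show "Q ^ (M + M' - i) dvd coeff F j * coeff G (i - j)" .
  qed
  ultimately show ?thesis unfolding lrep_def by blast
qed

text \<open>The elements with such an expansion form a subalgebra, so only generators matter. In the
  third one, the coefficient of \<open>1/X\<close> is \<open>Q(Y) / Y\<close>.\<close>

lemma cluster_lrep:
  assumes cl: "cluster A X Y P Q" and f: "f \<in> A"
  shows "\<exists>M N. lrep X Y Q M N f"
proof -
  define S where "S = {f. \<exists>M N. lrep X Y Q M N f}"
  have PQ: "cubic_pair P Q" and A: "A = galg X Y (zof X Y P Q)" using cl by (auto simp: cluster_def)
  note nz = cluster_nonzero[OF cl]
  have "lrep X Y Q 0 0 (scal c)" for c
    unfolding lrep_def by (rule exI[of _ "[:[:c:]:]"]) (auto simp: ev2_simps ev1_simps)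
  then have 1: "scal c \<in> S" for c by (auto simp: S_def)
  have "lrep X Y Q 0 0 X"
    unfolding lrep_def by (rule exI[of _ "[:0, 1:]"]) (auto simp: ev2_simps ev1_simps)
  then have 2: "X \<in> S" by (auto simp: S_def)
  have "lrep X Y Q 0 0 Y"
    unfolding lrep_def by (rule exI[of _ "[:[:0, 1:]:]"]) (auto simp: ev2_simps ev1_simps)
  then have 3: "Y \<in> S" by (auto simp: S_def)
  have "lrep X Y Q 1 1 (zof X Y P Q)"
    unfolding lrep_def
  proof (rule exI[of _ "[:Q, [:coeff P 1:], [:coeff P 2:], [:coeff P 3:]:]"], intro conjI allI)
    show "X ^ 1 * Y ^ 1 * zof X Y P Q = ev2 Y X [:Q, [:coeff P 1:], [:coeff P 2:], [:coeff P 3:]:]"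
      using zof_mult[OF nz(1,2), of P Q] PQ
      by (simp add: ev1_simps ev2_simps ev1_cubic[of P] cubic_pair_def algebra_simps power2_eq_square power3_eq_cube)
    show "Q ^ (1 - i) dvd coeff [:Q, [:coeff P 1:], [:coeff P 2:], [:coeff P 3:]:] i" for i
      by (cases i) auto
  qed
  then have 4: "zof X Y P Q \<in> S" by (auto simp: S_def)
  have "subalg S"
    unfolding subalg_def
  proof (intro conjI allI ballI 1)
    fix f g assume "f \<in> S" "g \<in> S"
    then obtain M N M' N' where *: "lrep X Y Q M N f" "lrep X Y Q M' N' g" by (auto simp: S_def)
    have "lrep X Y Q (max M M') (max N N') f" "lrep X Y Q (max M M') (max N N') g"
      by (rule lrep_mono[OF *(1)]; simp) (rule lrep_mono[OF *(2)]; simp)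
    then show "f + g \<in> S" using lrep_add unfolding S_def by blast
    show "f * g \<in> S" using lrep_mult[OF *] unfolding S_def by blast
  qed
  then have "A \<subseteq> S" unfolding A by (intro galg_subset 2 3 4)
  then show ?thesis using f by (auto simp: S_def)
qed

text \<open>The expansions for the two orders of the variables belong to the same Laurent
  polynomial, so with common denominators both divisibilities hold for one \<open>F\<close>.\<close>

lemma cluster_birep:
  assumes cl: "cluster A X Y P Q" and f: "f \<in> A"
  shows "\<exists>M N F. X ^ M * Y ^ N * f = ev2 X Y F \<and> (\<forall>j. P ^ (N - j) dvd coeff F j)
    \<and> (\<forall>i. Q ^ (M - i) dvd coeff (bswap F) i)"
proof -
  have ind: "indep X Y" using cl by (simp add: cluster_def)
  obtain M1 N1 where 1: "lrep X Y Q M1 N1 f" using cluster_lrep[OF assms] by auto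
  obtain M2 N2 where 2: "lrep Y X P N2 M2 f" using cluster_lrep[OF cluster_swap[OF cl] f] by auto
  define M where "M = max M1 M2"
  define N where "N = max N1 N2"
  obtain G where G: "X ^ M * Y ^ N * f = ev2 Y X G" "\<And>i. Q ^ (M - i) dvd coeff G i"
    using lrep_mono[OF 1, of M N] by (auto simp: lrep_def M_def N_def)
  obtain F where F: "Y ^ N * X ^ M * f = ev2 X Y F" "\<And>i. P ^ (N - i) dvd coeff F i"
    using lrep_mono[OF 2, of N M] by (auto simp: lrep_def M_def N_def)
  have "ev2 X Y F = ev2 Y X G" using F(1) G(1) by (simp add: mult_ac)
  then have "coeff (coeff F j) i = coeff (coeff G i) j" for i j by (rule ev2_swap_coeff[OF ind])
  then have "bswap F = G" by (intro poly_eqI) (simp add: coeff_bswap)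
  then show ?thesis using F G by (metis mult.commute)
qed

text \<open>A converse of \<open>cluster_lrep\<close>: \<open>Q(Y) ^ (M - i) * X ^ i / X ^ M\<close>
  is a power of the neighbour \<open>u\<close> for \<open>i \<le> M\<close> and a power of
  \<open>X\<close> otherwise, so only the denominator in \<open>Y\<close> remains.\<close>

lemma lrep_imp:
  assumes cl: "cluster A X Y P Q" and rep: "lrep X Y Q M N f"
  shows "Y ^ N * f \<in> A"
proof -
  obtain F where F: "X ^ M * Y ^ N * f = ev2 Y X F" "\<And>i. Q ^ (M - i) dvd coeff F i"
    using rep by (auto simp: lrep_def)
  define u where "u = ev1 Y Q / X"
  note sub = cluster_subalg[OF cl] and nz = cluster_nonzero[OF cl]
  have u: "u \<in> A" "ev1 Y Q = X * u" using cluster_neighbour[OF cl] nz by (auto simp: u_def)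
  have "ev1 Y (coeff F i) * X ^ i \<in> (*) (X ^ M) ` A" for i
  proof -
    obtain h where "coeff F i = Q ^ (M - i) * h" using F(2) by (auto elim: dvdE)
    then have *: "ev1 Y (coeff F i) * X ^ i = X ^ (M - i + i) * (u ^ (M - i) * ev1 Y h)"
      by (simp add: u(2) power_mult_distrib power_add mult_ac)
    \<comment> \<open>By truncated subtraction both sides are the larger of \<open>M\<close> and
      \<open>i\<close>.\<close>
    have "M - i + i = M + (i - M)" by simp
    then have "ev1 Y (coeff F i) * X ^ i = X ^ M * (X ^ (i - M) * (u ^ (M - i) * ev1 Y h))"
      unfolding * by (simp add: power_add mult_ac)
    moreover have "X ^ (i - M) * (u ^ (M - i) * ev1 Y h) \<in> A"
      by (intro subalgD[OF sub(1)] subalg_ev1 sub u)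
    ultimately show ?thesis by blast
  qed
  then have "\<forall>i. \<exists>b. b \<in> A \<and> ev1 Y (coeff F i) * X ^ i = X ^ M * b" by blast
  then obtain b where b: "\<And>i. b i \<in> A" "\<And>i. ev1 Y (coeff F i) * X ^ i = X ^ M * b i" by metis
  have "ev2 Y X F = (\<Sum>i\<le>degree F. ev1 Y (coeff F i) * X ^ i)"
    by (rule eval_with_altdef[OF ring_map_ev1 order.refl])
  also have "\<dots> = X ^ M * (\<Sum>i\<le>degree F. b i)" by (simp add: b(2) sum_distrib_left)
  finally have "X ^ M * (Y ^ N * f) = X ^ M * (\<Sum>i\<le>degree F. b i)" using F(1) by (simp add: mult.assoc)
  then have "Y ^ N * f = (\<Sum>i\<le>degree F. b i)" using nz by simp
  then show ?thesis using subalg_sum[OF sub(1)] b(1) by metis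
qed

text \<open>\<open>X\<close> and \<open>Y\<close> generate the unit ideal, since
  \<open>X * u - Y * r\<close> is a nonzero constant. Multiplying \<open>Y ^ N * f\<close> by this
  identity lowers the power of \<open>Y\<close>.\<close>

lemma cluster_comax:
  assumes cl: "cluster A X Y P Q" and "X * f \<in> A" "Y ^ N * f \<in> A"
  shows "f \<in> A"
  using assms(2,3)
proof (induction N)
  case (Suc N)
  define e where "e = Y ^ N * f"
  define u where "u = ev1 Y Q / X"
  define c where "c = coeff Q 0"
  define r where "r = scal (coeff Q 1) + scal (coeff Q 2) * Y + scal (coeff Q 3) * Y ^ 2"
  note sub = cluster_subalg[OF cl] and nz = cluster_nonzero[OF cl]
  have u: "u \<in> A" "ev1 Y Q = X * u" using cluster_neighbour[OF cl] nz by (auto simp: u_def)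
  have PQ: "cubic_pair P Q" using cl by (simp add: cluster_def)
  have c0: "c \<noteq> 0" using cubic_pair_nonzero[OF PQ] by (simp add: c_def)
  have r: "r \<in> A" unfolding r_def by (intro subalgD[OF sub(1)] sub)
  have "scal c = X * u - Y * r" unfolding u(2)[symmetric]
    using PQ by (simp add: ev1_cubic cubic_pair_def c_def r_def algebra_simps power2_eq_square power3_eq_cube)
  then have "scal c * e = (X * u - Y * r) * e" by simp
  also have "\<dots> = u * (X * e) - r * (Y * e)" by (simp add: algebra_simps)
  finally have "scal c * e = u * (X * e) - r * (Y * e)" .
  moreover have "X * e = Y ^ N * (X * f)" "Y * e = Y ^ Suc N * f" by (simp_all add: e_def)
  ultimately have "scal c * e = u * (Y ^ N * (X * f)) - r * (Y ^ Suc N * f)" by simp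
  moreover have "\<dots> \<in> A" by (intro subalgD[OF sub(1)] sub u r Suc.prems)
  ultimately have "scal c * e \<in> A" by simp
  then have "scal (inverse c) * (scal c * e) \<in> A"
    by (rule subalgD(3)[OF sub(1) subalgD(1)[OF sub(1)]])
  moreover have "scal (inverse c) * (scal c * e) = scal (inverse c * c) * e"
    by (simp only: scal_simps(4) mult.assoc)
  ultimately have "e \<in> A" using c0 by (simp del: scal_simps(4))
  then show ?case using Suc by (simp add: e_def)
qed simp

text \<open>For \<open>f = {X, Y}\<close> this shows that the Jacobian \<open>{X, Y} / (X Y)\<close> has no pole along \<open>X = 0\<close>.\<close>

lemma cluster_div:
  assumes cl: "cluster A X Y P Q" and f: "f \<in> A" and g: "g \<in> A"
    and eq: "f * (ev1 Y Q / X) = X * g"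
  shows "f / X \<in> A"
proof -
  note nz = cluster_nonzero[OF cl]
  have ind: "indep Y X" using cl indep_swap by (auto simp: cluster_def)
  have Q0: "Q \<noteq> 0" using cl by (auto simp: cluster_def cubic_pair_def)
  obtain M1 N1 where 1: "lrep X Y Q M1 N1 f" using cluster_lrep[OF cl f] by auto
  obtain M2 N2 where 2: "lrep X Y Q M2 N2 g" using cluster_lrep[OF cl g] by auto
  define M where "M = max M1 M2"
  define N where "N = max N1 N2"
  obtain F where F: "X ^ M * Y ^ N * f = ev2 Y X F" "\<And>i. Q ^ (M - i) dvd coeff F i"
    using lrep_mono[OF 1, of M N] by (auto simp: lrep_def M_def N_def)
  obtain G where G: "X ^ M * Y ^ N * g = ev2 Y X G" "\<And>i. Q ^ (M - i) dvd coeff G i"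
    using lrep_mono[OF 2, of M N] by (auto simp: lrep_def M_def N_def)
  have "ev2 Y X ([:Q:] * F) = ev1 Y Q * (X ^ M * Y ^ N * f)"
    unfolding F(1) by (simp add: ev2_simps)
  also have "\<dots> = X ^ 2 * (X ^ M * Y ^ N * g)"
  proof -
    have "ev1 Y Q * f = X ^ 2 * g" using eq nz by (simp add: field_simps power2_eq_square)
    then show ?thesis by (simp add: mult_ac)
  qed
  also have "\<dots> = ev2 Y X (monom 1 2 * G)" unfolding G(1) by (simp add: ev2_simps)
  finally have QF: "[:Q:] * F = monom 1 2 * G" by (rule indep_inj[OF ind])
  have co: "Q * coeff F i = (if i < 2 then 0 else coeff G (i - 2))" for i
    using arg_cong[OF QF, of "\<lambda>p. coeff p i"] by (simp add: coeff_monom_mult)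
  \<comment> \<open>Shifting by two columns and cancelling one \<open>Q\<close> leaves one factor
    more than \<open>F\<close> had to have, which pays for the additional pole of
    \<open>f / X\<close>.\<close>
  have "Q ^ (Suc M - i) dvd coeff F i" for i
  proof (cases "i < 2")
    case True
    then show ?thesis using co[of i] Q0 by simp
  next
    case False
    show ?thesis
    proof (cases "i \<le> M")
      case True
      have "M - (i - 2) = Suc (Suc M - i)" using True False by linarith
      then have "Q * Q ^ (Suc M - i) = Q ^ (M - (i - 2))" by simp
      then have "Q * Q ^ (Suc M - i) dvd Q * coeff F i"
        using G(2)[of "i - 2"] False co[of i] by simp
      then show ?thesis using Q0 by simp
    qed simp
  qed
  moreover have "X ^ Suc M * Y ^ N * (f / X) = ev2 Y X F"
    using F(1) nz by (simp add: mult.assoc)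
  ultimately have "lrep X Y Q (Suc M) N (f / X)" unfolding lrep_def by blast
  then have "Y ^ N * (f / X) \<in> A" by (rule lrep_imp[OF cl])
  moreover have "X * (f / X) \<in> A" using f nz by simp
  ultimately show ?thesis by (metis cluster_comax[OF cl])
qed

section \<open>The Poisson bracket and the Newton polygon\<close>

lemma br_ev1: "br f (ev1 g P) = ev1 g (pderiv P) * br f g"
proof (induction P)
  case 0
  then show ?case using br_scal(1)[of f 0] by simp
next
  case (pCons a P)
  then show ?case by (simp add: ev1_simps pderiv_pCons br_add br_mult algebra_simps)
qed

lemma cluster_induct:
  assumes cl: "cluster A X Y P Q" and S: "subalg S" "X \<in> S" "Y \<in> S" "zof X Y P Q \<in> S"
  shows "A \<subseteq> S"
  using cl galg_subset[OF S] by (simp add: cluster_def)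

lemma br_zof_eq:
  assumes cl: "cluster A X Y P Q"
  shows "X * Y * br u (zof X Y P Q) =
    ev1 X (pderiv P) * br u X + ev1 Y (pderiv Q) * br u Y - (br u X * Y + X * br u Y) * zof X Y P Q"
proof -
  have "br u (X * Y * zof X Y P Q) = br u (ev1 X P + ev1 Y Q + scal (- coeff P 0))"
    using zof_mult[OF cluster_nonzero(1,2)[OF cl], of P Q] by simp
  then show ?thesis by (simp add: br_mult br_add br_ev1 algebra_simps del: scal_simps(5))
qed

lemma subalg_br_closed:
  assumes "subalg A"
  shows "subalg {h \<in> A. br u h \<in> A}"
  unfolding subalg_def
  by (auto simp: subalgD[OF assms] br_add br_mult)

lemma subalg_br_kernel: "subalg {h. br u h = 0}"
  unfolding subalg_def by (auto simp: br_add br_mult)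

text \<open>The bracket is a derivation in each argument, so its values on generators suffice:
  \<open>x y\<close>, \<open>q'(y) - x z\<close> and \<open>y z - p'(x)\<close>. The first pass
  varies one argument, the second the other.\<close>

lemma br_closed:
  assumes cl: "cluster A tx ty p q" and f: "f \<in> A" and h: "h \<in> A"
  shows "br f h \<in> A"
proof -
  define z where "z = zof tx ty p q"
  note sub = cluster_subalg[OF cl]
  have yx: "br ty tx = - (tx * ty :: 'a fls fls)" using br_swap[of ty tx] br_tx_ty by metis
  have "tx * ty * br tx z = tx * ty * (ev1 ty (pderiv q) - tx * z)"
    unfolding z_def using br_zof_eq[OF cl, of tx] by (simp add: br_tx_ty algebra_simps)
  then have xz: "br tx z = ev1 ty (pderiv q) - tx * z" by simp
  have "tx * ty * br ty z = tx * ty * (ty * z - ev1 tx (pderiv p))"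
    unfolding z_def using br_zof_eq[OF cl, of ty] by (simp add: yx algebra_simps)
  then have yz: "br ty z = ty * z - ev1 tx (pderiv p)" by simp
  have zA: "z \<in> A" using sub by (simp add: z_def)
  have mem: "br tx ty \<in> A" "br tx z \<in> A" "br ty z \<in> A"
    unfolding br_tx_ty xz yz by (intro subalgD[OF sub(1)] subalg_ev1 sub zA)+
  have neg: "br v w \<in> A" if "br w v \<in> A" for v w
    using subalgD(6)[OF sub(1) that] br_swap[of v w] by simp
  have step: "br u h \<in> A" if "h \<in> A" "br u tx \<in> A" "br u ty \<in> A" "br u z \<in> A" for u h
    using cluster_induct[OF cl subalg_br_closed[OF sub(1), of u]] that sub by (auto simp: z_def)
  have 0: "0 \<in> A" by (rule subalgD(4)[OF sub(1)])
  have "br tx h \<in> A" by (rule step[OF h _ mem(1,2)]) (simp add: 0)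
  moreover have "br ty h \<in> A" by (rule step[OF h neg[OF mem(1)] _ mem(3)]) (simp add: 0)
  moreover have "br z h \<in> A" by (rule step[OF h neg[OF mem(2)] neg[OF mem(3)]]) (simp add: 0)
  ultimately have "br h tx \<in> A" "br h ty \<in> A" "br h z \<in> A" by (auto intro: neg)
  then have "br h f \<in> A" using f step by blast
  then show ?thesis by (rule neg)
qed

lemma br_kernel_cluster:
  assumes cl: "cluster A X Y P Q" and "br u X = 0" "br u Y = 0" "h \<in> A"
  shows "br u h = 0"
proof -
  have "br u (zof X Y P Q) = 0"
    using br_zof_eq[OF cl, of u] cluster_nonzero[OF cl] assms by simp
  then show ?thesis using cluster_induct[OF cl subalg_br_kernel[of u]] assms by auto
qed

text \<open>Algebraic independence is not enough in positive characteristic. If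
  \<open>{X, Y}\<close> were 0, then \<open>X\<close> and \<open>Y\<close> would have zero bracket
  with the whole ring, in particular with \<open>tx\<close>; then \<open>tx\<close> would have zero
  bracket with the whole ring, in particular with \<open>ty\<close>.\<close>

lemma br_cluster_nonzero:
  assumes base: "cluster A tx ty p q" and cl: "cluster A X Y P Q"
  shows "br X Y \<noteq> 0"
proof
  assume XY0: "br X Y = 0"
  then have YX0: "br Y X = 0" using br_swap[of Y X] by simp
  have X: "br X h = 0" if "h \<in> A" for h by (rule br_kernel_cluster[OF cl _ XY0 that]) simp
  have Y: "br Y h = 0" if "h \<in> A" for h by (rule br_kernel_cluster[OF cl YX0 _ that]) simp
  note sub = cluster_subalg[OF base]
  have "br tx X = 0" "br tx Y = 0" using X[OF sub(2)] Y[OF sub(2)] br_swap[of tx X] br_swap[of tx Y] by simp_all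
  then have "br tx ty = (0 :: 'a fls fls)" by (rule br_kernel_cluster[OF cl _ _ sub(3)])
  then show False by (simp add: br_tx_ty)
qed

text \<open>Bracketing \<open>Y\<close> with \<open>X * u = Q(Y)\<close> gives
  \<open>br X Y * u = X * br Y u\<close>, as \<open>cluster_div\<close> requires. This removes the
  pole along \<open>X\<close>, symmetry the one along \<open>Y\<close>, and
  \<open>cluster_comax\<close> combines the two.\<close>

lemma cluster_jacobian:
  assumes base: "cluster A tx ty p q" and cl: "cluster A X Y P Q"
  shows "\<exists>J\<in>A. br X Y = J * (X * Y)"
proof -
  have *: "br X Y / X \<in> A" if cl: "cluster A X Y P Q" for X Y P Q
  proof -
    note sub = cluster_subalg[OF cl] and nz = cluster_nonzero[OF cl]
    define u where "u = ev1 Y Q / X"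
    have u: "X * u = ev1 Y Q" "u \<in> A" using nz cluster_neighbour[OF cl] by (simp_all add: u_def)
    have "br Y (X * u) = 0" unfolding u by (simp add: br_ev1)
    then have "br X Y * u = X * br Y u" using br_swap[of Y X] by (simp add: br_mult)
    then show ?thesis
      using cluster_div[OF cl br_closed[OF base sub(2,3)] br_closed[OF base sub(3) u(2)]]
      by (simp add: u_def)
  qed
  note sub = cluster_subalg[OF cl] and nz = cluster_nonzero[OF cl]
  define J where "J = br X Y / (X * Y)"
  have "br Y X / Y \<in> A" by (rule *[OF cluster_swap[OF cl]])
  then have "- (br Y X / Y) \<in> A" by (rule subalgD(6)[OF sub(1)])
  then have "X * J \<in> A" using nz br_swap[of X Y] by (simp add: J_def)
  moreover have "Y ^ 1 * J \<in> A" using *[OF cl] nz by (simp add: J_def)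
  ultimately have "J \<in> A" by (rule cluster_comax[OF cl])
  moreover have "br X Y = J * (X * Y)" using nz by (simp add: J_def)
  ultimately show ?thesis by blast
qed

text \<open>As \<open>Q\<close> has a constant term, multiplication by \<open>Q ^ n\<close> keeps
  the lowest exponent and raises the degree by \<open>n * degree Q\<close>.\<close>

lemma poly_spread:
  fixes u Q :: "'k::field poly"
  assumes "Q ^ n dvd u" "u \<noteq> 0" "coeff Q 0 \<noteq> 0"
  shows "\<exists>i j. coeff u i \<noteq> 0 \<and> coeff u j \<noteq> 0 \<and> i + n * degree Q \<le> j"
proof -
  obtain h where u: "u = Q ^ n * h" using assms(1) by (auto elim: dvdE)
  have nz: "Q ^ n \<noteq> 0" "h \<noteq> 0" using u assms(2) by auto
  define i where "i = (LEAST i. coeff h i \<noteq> 0)"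
  have ci: "coeff h i \<noteq> 0" unfolding i_def
    by (rule LeastI[of "\<lambda>i. coeff h i \<noteq> 0" "degree h"]) (use nz in simp)
  have lt: "coeff h j = 0" if "j < i" for j using that not_less_Least unfolding i_def by blast
  have "coeff u i = (\<Sum>j\<le>i. coeff (Q ^ n) j * coeff h (i - j))" by (simp add: u coeff_mult)
  also have "\<dots> = (\<Sum>j\<in>{0}. coeff (Q ^ n) j * coeff h (i - j))"
    by (rule sum.mono_neutral_right) (auto simp: lt)
  also have "\<dots> = coeff Q 0 ^ n * coeff h i" by (simp add: coeff_0_power)
  finally have "coeff u i \<noteq> 0" using ci assms(3) by simp
  moreover have "coeff u (degree u) \<noteq> 0" using assms(2) by simp
  moreover have "degree u = n * degree Q + degree h"
    unfolding u using nz assms(3) by (subst degree_mult_eq) (auto simp: degree_power_eq)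
  moreover have "i \<le> degree h" using ci by (rule le_degree)
  ultimately show ?thesis by (metis add.commute add_le_mono1)
qed

text \<open>
  The Newton polygon of the Laurent expansion of \<open>f\<close> in the cluster: a column left of the
  axis is divisible by a power of \<open>Q\<close> and hence long, and likewise for the rows below the axis.
\<close>

lemma cluster_support:
  assumes cl: "cluster A X Y P Q" and w: "wedge X Y \<noteq> 0" and f: "f \<in> A" "f \<noteq> 0"
  obtains M N F where "X ^ M * Y ^ N * f = ev2 X Y F" "F \<noteq> 0"
    and "\<And>i j. coeff (coeff F j) i \<noteq> 0 \<Longrightarrow>
          (int i - int M) * tdeg X + (int j - int N) * tdeg Y \<le> tdeg f"
    and "\<And>i j. coeff (coeff F j) i \<noteq> 0 \<Longrightarrow> i < M \<Longrightarrow>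
          \<exists>j0 j1. coeff (coeff F j0) i \<noteq> 0 \<and> coeff (coeff F j1) i \<noteq> 0 \<and> j0 + 3 * (M - i) \<le> j1"
    and "\<And>i j. coeff (coeff F j) i \<noteq> 0 \<Longrightarrow> j < N \<Longrightarrow>
          \<exists>i0 i1. coeff (coeff F j) i0 \<noteq> 0 \<and> coeff (coeff F j) i1 \<noteq> 0 \<and> i0 + 3 * (N - j) \<le> i1"
proof -
  note nz = cluster_nonzero[OF cl]
  have PQ: "cubic_pair P Q" using cl by (simp add: cluster_def)
  obtain M N F where F: "X ^ M * Y ^ N * f = ev2 X Y F"
      "\<And>j. P ^ (N - j) dvd coeff F j" "\<And>i. Q ^ (M - i) dvd coeff (bswap F) i"
    using cluster_birep[OF cl f(1)] by blast
  have F0: "F \<noteq> 0"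
  proof
    assume "F = 0"
    then have "X ^ M * Y ^ N * f = 0" using F(1) by simp
    then show False using nz f(2) by simp
  qed
  show ?thesis
  proof (rule that[OF F(1) F0])
    fix i j assume ij: "coeff (coeff F j) i \<noteq> 0"
    have "int i * tdeg X + int j * tdeg Y \<le> tdeg (X ^ M * Y ^ N * f)"
      unfolding F(1) by (rule ev2_lval(2)[OF w nz(1,2) F0 ij])
    also have "\<dots> = int M * tdeg X + int N * tdeg Y + tdeg f"
      using nz f(2) by (simp add: tdeg_mult tdeg_power)
    finally show "(int i - int M) * tdeg X + (int j - int N) * tdeg Y \<le> tdeg f"
      by (simp add: algebra_simps)
    show "\<exists>j0 j1. coeff (coeff F j0) i \<noteq> 0 \<and> coeff (coeff F j1) i \<noteq> 0 \<and> j0 + 3 * (M - i) \<le> j1"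
    proof -
      have "coeff (bswap F) i \<noteq> 0" using ij coeff_bswap[of F i j] by auto
      then show ?thesis
        using poly_spread[OF F(3), of i] PQ cubic_pair_nonzero[OF PQ]
        by (auto simp: coeff_bswap cubic_pair_def mult.commute)
    qed
    show "\<exists>i0 i1. coeff (coeff F j) i0 \<noteq> 0 \<and> coeff (coeff F j) i1 \<noteq> 0 \<and> i0 + 3 * (N - j) \<le> i1"
    proof -
      have "coeff F j \<noteq> 0" using ij by auto
      then show ?thesis
        using poly_spread[OF F(2), of j] PQ cubic_pair_nonzero[OF PQ]
        by (auto simp: cubic_pair_def mult.commute)
    qed
  qed
qed

text \<open>If the leftmost column lies at distance \<open>l > 0\<close> left of the axis, it starts
  more than \<open>(3 l - 2) / 2\<close> below the other axis, and the row through its start reaches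
  at least \<open>3 l - 1 > l\<close> to the left, a contradiction. So nothing lies left of the
  axis, hence nothing below, and the degree bound leaves only the constant term.\<close>

lemma cluster_small_degree:
  assumes cl: "cluster A X Y P Q" and w: "wedge X Y \<noteq> 0" and f: "f \<in> A"
    and ab: "0 < tdeg Y" "tdeg Y \<le> tdeg X" "2 * tdeg X \<le> 3 * tdeg Y"
    and small: "tdeg f < tdeg Y"
  shows "f \<in> range scal"
proof (cases "f = 0")
  case False
  define a where "a = tdeg X"
  define b where "b = tdeg Y"
  note ab' = ab[folded a_def b_def]
  obtain M N F where F: "X ^ M * Y ^ N * f = ev2 X Y F" "F \<noteq> 0"
    and deg: "\<And>i j. coeff (coeff F j) i \<noteq> 0 \<Longrightarrow> (int i - int M) * a + (int j - int N) * b \<le> tdeg f"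
    and col: "\<And>i j. coeff (coeff F j) i \<noteq> 0 \<Longrightarrow> i < M \<Longrightarrow>
          \<exists>j0 j1. coeff (coeff F j0) i \<noteq> 0 \<and> coeff (coeff F j1) i \<noteq> 0 \<and> j0 + 3 * (M - i) \<le> j1"
    and row: "\<And>i j. coeff (coeff F j) i \<noteq> 0 \<Longrightarrow> j < N \<Longrightarrow>
          \<exists>i0 i1. coeff (coeff F j) i0 \<noteq> 0 \<and> coeff (coeff F j) i1 \<noteq> 0 \<and> i0 + 3 * (N - j) \<le> i1"
    by (rule cluster_support[OF cl w f False, folded a_def b_def]) (rule that)
  have deg': "(int i - int M) * a + (int j - int N) * b < b" if "coeff (coeff F j) i \<noteq> 0" for i j
    using deg[OF that] small by (simp add: b_def)
  have col': "\<exists>j0. coeff (coeff F j0) i \<noteq> 0 \<and> 2 * (int N - int j0) > 3 * (int M - int i) - 2"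
    if c: "coeff (coeff F j) i \<noteq> 0" "i < M" for i j
  proof -
    obtain j0 j1 where j: "coeff (coeff F j0) i \<noteq> 0" "coeff (coeff F j1) i \<noteq> 0" "j0 + 3 * (M - i) \<le> j1"
      using col[OF c] by blast
    define l where "l = int M - int i"
    have l: "0 < l" "int j0 + 3 * l \<le> int j1" using c(2) j(3) by (auto simp: l_def)
    have "2 * ((int j1 - int N) * b) < 2 * b + l * (2 * a)"
      using deg'[OF j(2)] by (simp add: l_def algebra_simps)
    \<comment> \<open>The ratio bound 3/2 enters here.\<close>
    also have "\<dots> \<le> 2 * b + l * (3 * b)" using ab' l by simp
    finally have "(2 * (int j1 - int N)) * b < (2 + 3 * l) * b" by (simp add: algebra_simps)
    then have "2 * (int j1 - int N) < 2 + 3 * l" using ab'(1) by (simp add: mult_less_cancel_right)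
    then show ?thesis using j(1) l by (intro exI[of _ j0]) (auto simp: l_def)
  qed
  have row': "\<exists>i0. coeff (coeff F j) i0 \<noteq> 0 \<and> int M - int i0 \<ge> 2 * (int N - int j)"
    if c: "coeff (coeff F j) i \<noteq> 0" "j < N" for i j
  proof -
    obtain i0 i1 where i: "coeff (coeff F j) i0 \<noteq> 0" "coeff (coeff F j) i1 \<noteq> 0" "i0 + 3 * (N - j) \<le> i1"
      using row[OF c] by blast
    define l where "l = int N - int j"
    have l: "0 < l" "int i0 + 3 * l \<le> int i1" using c(2) i(3) by (auto simp: l_def)
    have "(int i1 - int M) * a < (1 + l) * b"
      using deg'[OF i(2)] by (simp add: l_def algebra_simps)
    also have "\<dots> \<le> (1 + l) * a" using ab' l by (intro mult_left_mono) auto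
    finally have "int i1 - int M < 1 + l" using ab' by (simp add: mult_less_cancel_right)
    then show ?thesis using i(1) l by (intro exI[of _ i0]) (auto simp: l_def)
  qed
  have iM: "M \<le> i" if "coeff (coeff F j) i \<noteq> 0" for i j
  proof -
    define m where "m = (LEAST i. \<exists>j. coeff (coeff F j) i \<noteq> 0)"
    have ex: "\<exists>i j. coeff (coeff F j) i \<noteq> 0" using that by blast
    have "\<exists>j. coeff (coeff F j) m \<noteq> 0" unfolding m_def using ex by (rule LeastI_ex)
    then obtain j where j: "coeff (coeff F j) m \<noteq> 0" by blast
    have least: "m \<le> i" if "coeff (coeff F j) i \<noteq> 0" for i j
      unfolding m_def by (rule Least_le) (use that in blast)
    have "M \<le> m"
    proof (rule ccontr)
      assume "\<not> M \<le> m"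
      then have mM: "m < M" and mM': "int m + 1 \<le> int M" by auto
      obtain j0 where j0: "coeff (coeff F j0) m \<noteq> 0" "2 * (int N - int j0) > 3 * (int M - int m) - 2"
        using col'[OF j mM] by blast
      have "int j0 < int N" using mM' j0(2) by presburger
      then have "j0 < N" by simp
      then obtain i0 where i0: "coeff (coeff F j0) i0 \<noteq> 0" "int M - int i0 \<ge> 2 * (int N - int j0)"
        using row'[OF j0(1)] by blast
      have "int m \<le> int i0" using least[OF i0(1)] by simp
      then show False using j0(2) i0(2) mM' by presburger
    qed
    then show ?thesis using least[OF that] by simp
  qed
  have jN: "N \<le> j" if c: "coeff (coeff F j) i \<noteq> 0" for i j
  proof (rule ccontr)
    assume "\<not> N \<le> j"
    then have jN: "j < N" by simp
    then obtain i0 where i0: "coeff (coeff F j) i0 \<noteq> 0" "int M - int i0 \<ge> 2 * (int N - int j)"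
      using row'[OF c] by blast
    have "int M \<le> int i0" "int j < int N" using iM[OF i0(1)] jN by simp_all
    then show False using i0(2) by presburger
  qed
  have "bsupp F \<subseteq> {(M, N)}"
  proof safe
    fix i j assume "(i, j) \<in> bsupp F"
    then have c: "coeff (coeff F j) i \<noteq> 0" by (simp add: bsupp_def)
    define i' where "i' = int i - int M"
    define j' where "j' = int j - int N"
    have nn: "0 \<le> i'" "0 \<le> j'" using iM[OF c] jN[OF c] by (auto simp: i'_def j'_def)
    have "(i' + j') * b \<le> i' * a + j' * b" using ab' nn by (simp add: distrib_right mult_left_mono)
    also have "\<dots> < 1 * b" using deg'[OF c] by (simp add: i'_def j'_def)
    finally have "i' + j' < 1" using ab'(1) by (simp add: mult_less_cancel_right)
    then show "i = M" "j = N" using nn by (auto simp: i'_def j'_def)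
  qed
  moreover have "bsupp F \<noteq> {}" using F(2) by (simp add: bsupp_empty_iff)
  ultimately have "bsupp F = {(M, N)}" by blast
  then have "ev2 X Y F = scal (coeff (coeff F N) M) * (X ^ M * Y ^ N)"
    using ev2_bsum[OF bsupp_subset[of F], of X Y] by simp
  then have "f = scal (coeff (coeff F N) M)"
    using F(1) cluster_nonzero[OF cl] by simp
  then show ?thesis by blast
qed (metis rangeI scal_simps(1))

lemma base_small_degree:
  assumes "cluster A tx ty p q" "f \<in> A" "tdeg f \<le> 0"
  shows "f \<in> range scal"
  by (rule cluster_small_degree[OF assms(1) _ assms(2)]) (use assms(3) in \<open>simp_all add: wedge_tx_ty\<close>)

text \<open>The Jacobian lies in the ring and has degree at most 0 by \<open>tdeg_br_le\<close>, so
  it is a constant and \<open>lval_br_wedge\<close> applies.\<close>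

lemma cluster_wedge:
  assumes base: "cluster A tx ty p q" and cl: "cluster A X Y P Q"
  shows "wedge X Y \<noteq> 0"
proof -
  note nz = cluster_nonzero[OF cl]
  obtain J where J: "J \<in> A" "br X Y = J * (X * Y)" using cluster_jacobian[OF base cl] by blast
  have br0: "br X Y \<noteq> 0" by (rule br_cluster_nonzero[OF base cl])
  then have J0: "J \<noteq> 0" using J(2) by auto
  have "tdeg J + (tdeg X + tdeg Y) \<le> tdeg X + tdeg Y"
    using tdeg_br_le[OF br0] J0 nz by (simp add: J(2) tdeg_mult)
  then obtain c where c: "J = scal c" using base_small_degree[OF base J(1)] by auto
  then have "snd (lval X) * fst (lval Y) \<noteq> fst (lval X) * snd (lval Y)"
    using J(2) J0 by (intro lval_br_wedge[OF nz(1,2)]) auto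
  then show ?thesis by (simp add: wedge_def)
qed

text \<open>The same alternation of columns and rows, with degree bound one, keeps both exponents at
  least -1. A row at -1 must stretch from \<open>1/(x y)\<close> to \<open>x^2/y\<close>, and the
  latter forces the leading exponent -1; without such a row only \<open>1\<close>, \<open>x\<close>,
  \<open>y\<close> remain.\<close>

lemma base_degree_one:
  assumes base: "cluster A tx ty p q" and f: "f \<in> A" "f \<noteq> 0" "tdeg f = 1"
  shows "snd (lval f) = -1 \<or> (\<exists>r s t. f = scal r + scal s * tx + scal t * ty)"
proof -
  have w: "wedge tx (ty :: 'a fls fls) \<noteq> 0" by (simp add: wedge_tx_ty)
  obtain M N F where F: "tx ^ M * ty ^ N * f = ev2 tx ty F" "F \<noteq> 0"
    and deg0: "\<And>i j. coeff (coeff F j) i \<noteq> 0 \<Longrightarrow> (int i - int M) * tdeg (tx :: 'a fls fls) + (int j - int N) * tdeg (ty :: 'a fls fls) \<le> tdeg f"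
    and col: "\<And>i j. coeff (coeff F j) i \<noteq> 0 \<Longrightarrow> i < M \<Longrightarrow>
          \<exists>j0 j1. coeff (coeff F j0) i \<noteq> 0 \<and> coeff (coeff F j1) i \<noteq> 0 \<and> j0 + 3 * (M - i) \<le> j1"
    and row: "\<And>i j. coeff (coeff F j) i \<noteq> 0 \<Longrightarrow> j < N \<Longrightarrow>
          \<exists>i0 i1. coeff (coeff F j) i0 \<noteq> 0 \<and> coeff (coeff F j) i1 \<noteq> 0 \<and> i0 + 3 * (N - j) \<le> i1"
    by (rule cluster_support[OF base w f(1,2)]) (rule that)
  have deg: "i + j \<le> M + N + 1" if "coeff (coeff F j) i \<noteq> 0" for i j
    using deg0[OF that] f(3) by simp
  have iM: "M \<le> i + 1" if c: "coeff (coeff F j) i \<noteq> 0" for i j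
  proof -
    define m where "m = (LEAST i. \<exists>j. coeff (coeff F j) i \<noteq> 0)"
    have ex: "\<exists>i j. coeff (coeff F j) i \<noteq> 0" using c by blast
    have "\<exists>j. coeff (coeff F j) m \<noteq> 0" unfolding m_def using ex by (rule LeastI_ex)
    then obtain j where j: "coeff (coeff F j) m \<noteq> 0" by blast
    have least: "m \<le> i" if "coeff (coeff F j) i \<noteq> 0" for i j
      unfolding m_def by (rule Least_le) (use that in blast)
    have "M \<le> m + 1"
    proof (rule ccontr)
      assume "\<not> M \<le> m + 1"
      then have mM: "m + 1 < M" by simp
      obtain j0 j1 where j: "coeff (coeff F j0) m \<noteq> 0" "coeff (coeff F j1) m \<noteq> 0" "j0 + 3 * (M - m) \<le> j1"
        using col[OF j] mM by auto
      have h: "int j0 + 3 * (int M - int m) \<le> int j1" "int m + 2 \<le> int M" using j(3) mM by auto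
      have d: "int m + int j1 \<le> int M + int N + 1" using deg[OF j(2)] by linarith
      have jN: "int j0 + 2 * (int M - int m) \<le> int N + 1" using h(1) d by simp
      then have "int j0 < int N" using h(2) by simp
      then have jN': "j0 < N" by simp
      obtain i0 i1 where i: "coeff (coeff F j0) i0 \<noteq> 0" "coeff (coeff F j0) i1 \<noteq> 0" "i0 + 3 * (N - j0) \<le> i1"
        using row[OF j(1) jN'] by blast
      have "int i0 + 3 * (int N - int j0) \<le> int i1" using i(3) jN' by auto
      moreover have "int i1 + int j0 \<le> int M + int N + 1" using deg[OF i(2)] by linarith
      moreover have "int m \<le> int i0" using least[OF i(1)] by simp
      ultimately show False using jN h(2) by (smt (verit))
    qed
    then show ?thesis using least[OF c] by simp
  qed
  have jN: "N \<le> j + 1" if c: "coeff (coeff F j) i \<noteq> 0" for i j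
  proof (rule ccontr)
    assume "\<not> N \<le> j + 1"
    then obtain i0 i1 where i: "coeff (coeff F j) i0 \<noteq> 0" "coeff (coeff F j) i1 \<noteq> 0" "i0 + 3 * (N - j) \<le> i1"
      using row[OF c] by auto
    have "int i0 + 3 * (int N - int j) \<le> int i1" "int j + 2 \<le> int N"
      using i(3) \<open>\<not> N \<le> j + 1\<close> by auto
    moreover have "int i1 + int j \<le> int M + int N + 1" using deg[OF i(2)] by linarith
    moreover have "int M \<le> int i0 + 1" using iM[OF i(1)] by simp
    ultimately show False by (smt (verit))
  qed
  have nz: "(tx :: 'a fls fls) \<noteq> 0" "(ty :: 'a fls fls) \<noteq> 0" by simp_all
  have val: "lval (tx ^ i * ty ^ j :: 'a fls fls) = (- int i - int j, int j)" for i j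
    by (simp add: lval_mult lval_power lval_tx lval_ty)
  have valf: "lval (ev2 tx ty F) = (- int M - int N, int N) + lval f"
    unfolding F(1)[symmetric] using f(2) by (subst lval_mult) (simp_all add: val)
  have fst1: "fst (lval f) = -1" using f(3) by (simp add: fst_lval)
  show ?thesis
  proof (cases "\<exists>i j. coeff (coeff F j) i \<noteq> 0 \<and> j < N")
    case True
    then obtain i j where c: "coeff (coeff F j) i \<noteq> 0" "j < N" by blast
    obtain i0 i1 where i: "coeff (coeff F j) i0 \<noteq> 0" "coeff (coeff F j) i1 \<noteq> 0" "i0 + 3 * (N - j) \<le> i1"
      using row[OF c] by blast
    have N: "N = j + 1" using jN[OF c(1)] c(2) by simp
    moreover have "i1 = M + 2" using i(3) iM[OF i(1)] deg[OF i(2)] N by simp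
    ultimately have eq: "i1 = M + 2" "N = j + 1" by auto
    have "(- int M - int N, int N) + lval f \<le> (- int i1 - int j, int j)"
      using ev2_lval(4)[OF w nz F(2) i(2)] by (simp only: valf val)
    then have "snd (lval f) \<le> -1"
      using fst1 by (auto simp: less_eq_prod_def eq)
    moreover obtain i' j' where ij: "coeff (coeff F j') i' \<noteq> 0"
        "(- int M - int N, int N) + lval f = (- int i' - int j', int j')"
      using ev2_lval(3)[OF w nz F(2)] unfolding valf val by blast
    then have "snd (lval f) = int j' - int N" by (auto simp: prod_eq_iff)
    ultimately show ?thesis using jN[OF ij(1)] by simp
  next
    case False
    then have jN': "N \<le> j" if "coeff (coeff F j) i \<noteq> 0" for i j using that not_less by blast
    have iM': "M \<le> i" if c: "coeff (coeff F j) i \<noteq> 0" for i j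
    proof (rule ccontr)
      assume "\<not> M \<le> i"
      then obtain j0 j1 where j: "coeff (coeff F j0) i \<noteq> 0" "coeff (coeff F j1) i \<noteq> 0" "j0 + 3 * (M - i) \<le> j1"
        using col[OF c] by auto
      have "int j0 + 3 * (int M - int i) \<le> int j1" "int i + 1 \<le> int M"
        using j(3) \<open>\<not> M \<le> i\<close> by auto
      moreover have "int i + int j1 \<le> int M + int N + 1" using deg[OF j(2)] by linarith
      moreover have "int N \<le> int j0" using jN'[OF j(1)] by simp
      ultimately show False by (smt (verit))
    qed
    define S where "S = {(M, N), (M + 1, N), (M, N + 1)}"
    have "bsupp F \<subseteq> S"
    proof
      fix s assume "s \<in> bsupp F"
      then obtain i j where s: "s = (i, j)" and c: "coeff (coeff F j) i \<noteq> 0" by (auto simp: bsupp_def)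
      show "s \<in> S" using deg[OF c] iM'[OF c] jN'[OF c] by (auto simp: s S_def)
    qed
    then have "ev2 tx ty F = (\<Sum>(i,j)\<in>S. scal (coeff (coeff F j) i) * (tx ^ i * ty ^ j))"
      unfolding ev2_bsum[OF bsupp_subset[of F]]
      by (intro sum.mono_neutral_left) (auto simp: S_def bsupp_def)
    also have "\<dots> = tx ^ M * ty ^ N * (scal (coeff (coeff F N) M) + scal (coeff (coeff F N) (M + 1)) * tx
        + scal (coeff (coeff F (N + 1)) M) * ty)"
      by (simp add: S_def algebra_simps)
    finally show ?thesis using F(1) nz by auto
  qed
qed

section \<open>Clusters of degree one\<close>

lemma tx_not_const: "tx \<notin> range scal"
proof
  assume "(tx :: 'a fls fls) \<in> range scal"
  then obtain c where "(tx :: 'a fls fls) = scal c" by auto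
  then have "tdeg (tx :: 'a fls fls) = 0" by (metis tdeg_scal)
  then show False by simp
qed

text \<open>If both degrees exceeded 1, the nonconstant \<open>tx\<close> would contradict
  \<open>cluster_small_degree\<close>. Once the smaller degree is 1, the ratio bound leaves only 1
  for the larger.\<close>

lemma cluster_degree_eq_one:
  assumes base: "cluster A tx ty p q" and cl: "cluster A X Y P Q"
    and ab: "0 < tdeg X" "0 < tdeg Y" "2 * tdeg X \<le> 3 * tdeg Y" "2 * tdeg Y \<le> 3 * tdeg X"
  shows "tdeg X = 1 \<and> tdeg Y = 1"
proof -
  have *: "tdeg X = 1 \<and> tdeg Y = 1"
    if cl: "cluster A X Y P Q" and ab: "0 < tdeg Y" "tdeg Y \<le> tdeg X" "2 * tdeg X \<le> 3 * tdeg Y"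
    for X Y P Q
  proof -
    have "\<not> tdeg (tx :: 'a fls fls) < tdeg Y"
      using cluster_small_degree[OF cl cluster_wedge[OF base cl] cluster_subalg(2)[OF base] ab]
        tx_not_const by blast
    then show ?thesis using ab by simp
  qed
  show ?thesis
  proof (cases "tdeg Y \<le> tdeg X")
    case True
    then show ?thesis using *[OF cl] ab by blast
  next
    case False
    then show ?thesis using *[OF cluster_swap[OF cl]] ab by auto
  qed
qed

lemma lval_linear:
  fixes r s t :: "'k::field"
  assumes "s \<noteq> 0 \<or> t \<noteq> 0"
  shows "lval (scal r + scal s * tx + scal t * ty) = (-1, if s \<noteq> 0 then 0 else 1)"
proof -
  have x: "lval (scal s * tx) = (-1, 0)" if "s \<noteq> 0"
    using that by (simp add: lval_mult lval_tx zero_prod_def)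
  have y: "lval (scal t * ty) = (-1, 1)" if "t \<noteq> 0"
    using that by (simp add: lval_mult lval_ty zero_prod_def)
  have r: "scal r = 0 \<or> lval (scal r) = (0, 0)"
    by (cases "r = 0") (simp_all add: zero_prod_def)
  define g where "g = scal t * ty + scal r"
  have g: "g \<noteq> 0 \<and> lval g = (-1, 1)" if "t \<noteq> 0"
  proof -
    have "scal r = 0 \<or> lval (scal t * ty) < lval (scal r)" using r y[OF that] by auto
    then show ?thesis
      using lval_add_lt[of "scal t * ty" "scal r"] that y[OF that] by (auto simp: g_def)
  qed
  have g': "g = 0 \<or> lval g = (-1, 1) \<or> lval g = (0, 0)"
    using g r by (cases "t = 0") (auto simp: g_def)
  show ?thesis
  proof (cases "s = 0")
    case True
    then show ?thesis using assms g by (simp add: g_def add.commute)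
  next
    case False
    then have "lval (scal s * tx) < lval g \<or> g = 0" using x g' by auto
    then have "lval (scal s * tx + g) = (-1, 0)"
      using lval_add_lt[of "scal s * tx" g] False x by simp
    then show ?thesis using False by (simp add: g_def add_ac)
  qed
qed

lemma base_degree_one_cases:
  assumes base: "cluster A tx ty p q" and f: "f \<in> A" "tdeg f = 1"
  shows "snd (lval f) = -1
    \<or> (snd (lval f) = 0 \<and> (\<exists>r s t. s \<noteq> 0 \<and> f = scal r + scal s * tx + scal t * ty))
    \<or> (snd (lval f) = 1 \<and> (\<exists>r t. t \<noteq> 0 \<and> f = scal r + scal t * ty))"
proof -
  have "f \<noteq> 0" using f(2) by (auto simp: tdeg_def)
  then consider "snd (lval f) = -1" | r s t where "f = scal r + scal s * tx + scal t * ty"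
    using base_degree_one[OF base f(1) _ f(2)] by blast
  then show ?thesis
  proof cases
    case 2
    have "s \<noteq> 0 \<or> t \<noteq> 0"
    proof (rule ccontr)
      assume "\<not> (s \<noteq> 0 \<or> t \<noteq> 0)"
      then have "f = scal r" using 2 by simp
      then show False using f(2) by simp
    qed
    then show ?thesis using 2 lval_linear[of s t r] by (cases "s = 0") auto
  qed simp
qed

text \<open>As \<open>snd (lval X) < snd (lval Y)\<close>, the cube of \<open>X\<close> gives the
  leading term of \<open>P(X) + Q(Y) - c\<close>, and division by \<open>X * Y\<close> leaves
  \<open>X ^ 2 / Y\<close>.\<close>

lemma lval_zof:
  assumes cl: "cluster A X Y P Q" and w: "wedge X Y \<noteq> 0"
    and deg: "tdeg X = 1" "tdeg Y = 1" and lt: "snd (lval X) < snd (lval Y)"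
  shows "tdeg (zof X Y P Q) = 1" "snd (lval (zof X Y P Q)) = 2 * snd (lval X) - snd (lval Y)"
proof -
  have PQ: "cubic_pair P Q" using cl by (simp add: cluster_def)
  note nz = cluster_nonzero[OF cl]
  define Z where "Z = zof X Y P Q"
  define G where "G = [:P, [:coeff Q 1:], [:coeff Q 2:], [:coeff Q 3:]:]"
  have XYZ: "X * Y * Z = ev2 X Y G"
    unfolding Z_def zof_mult[OF nz(1,2)] G_def using PQ
    by (simp add: ev1_simps ev2_simps ev1_cubic[of Q] cubic_pair_def algebra_simps power2_eq_square power3_eq_cube)
  have c30: "coeff (coeff G 0) 3 \<noteq> 0" using coeff_3_nonzero[OF PQ] by (simp add: G_def)
  then have G0: "G \<noteq> 0" by auto
  have supp: "j = 0 \<and> i \<le> 3 \<or> i = 0 \<and> j \<le> 3" if c: "coeff (coeff G j) i \<noteq> 0" for i j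
  proof -
    have "j \<le> degree G" using c by (metis coeff_0 le_degree)
    also have "degree G \<le> 3" by (simp add: G_def)
    finally have j: "j = 0 \<or> j = 1 \<or> j = 2 \<or> j = 3" by auto
    show ?thesis
    proof (cases "j = 0")
      case True
      then have "i \<le> degree P" using c by (simp add: G_def le_degree)
      then show ?thesis using True PQ by (simp add: cubic_pair_def)
    next
      case False
      then show ?thesis using c j
        by (cases i) (auto simp: G_def numeral_2_eq_2 numeral_3_eq_3)
    qed
  qed
  obtain i j where ij: "coeff (coeff G j) i \<noteq> 0" "lval (ev2 X Y G) = lval (X ^ i * Y ^ j)"
    using ev2_lval(3)[OF w nz(1,2) G0] by blast
  have fst1: "fst (lval X) = -1" "fst (lval Y) = -1" using deg by (auto simp: fst_lval)
  have val: "lval (X ^ i * Y ^ j) = (- int i - int j, int i * snd (lval X) + int j * snd (lval Y))" for i j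
    using nz by (simp add: lval_mult lval_power fst1)
  have le: "lval (ev2 X Y G) \<le> (-3, 3 * snd (lval X))"
    using ev2_lval(4)[OF w nz(1,2) G0 c30] by (simp only: val) simp
  have "lval (ev2 X Y G) = (-3, 3 * snd (lval X))"
    using supp[OF ij(1)] le lt unfolding ij(2) val by (auto simp: less_eq_prod_def)
  moreover have "ev2 X Y G \<noteq> 0" by (rule ev2_lval(1)[OF w nz(1,2) G0])
  then have "Z \<noteq> 0" using XYZ by auto
  then have "lval (X * Y * Z) = lval X + lval Y + lval Z" using nz by (simp add: lval_mult)
  ultimately have "lval X + lval Y + lval Z = (-3, 3 * snd (lval X))" using XYZ by simp
  then have "fst (lval Z) = -1" "snd (lval Z) = 2 * snd (lval X) - snd (lval Y)"
    using fst1 by (auto simp: prod_eq_iff)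
  then show "tdeg (zof X Y P Q) = 1" "snd (lval (zof X Y P Q)) = 2 * snd (lval X) - snd (lval Y)"
    by (auto simp: fst_lval Z_def)
qed

text \<open>Over a domain the factors of a monomial are monomials.\<close>

lemma linear_dvd_monom:
  fixes e f g :: "'a::idom"
  assumes "[:e, f:] * F = monom g M" "f \<noteq> 0" "g \<noteq> 0"
  shows "e = 0"
  using assms(1)
proof (induction M arbitrary: F)
  case 0
  then have "F \<noteq> 0" using assms(3) by (auto simp: monom_0)
  then have "degree ([:e, f:] * F) = 1 + degree F" using assms(2) by (subst degree_mult_eq) auto
  then show ?case using 0 by (simp add: monom_0)
next
  case (Suc M)
  obtain a F' where F: "F = pCons a F'" by (cases F)
  have "e * a = 0" using arg_cong[OF Suc.prems, of "\<lambda>p. coeff p 0"] by (auto simp: F)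
  show ?case
  proof (cases "a = 0")
    case True
    then have "pCons 0 ([:e, f:] * F') = pCons 0 (monom g M)"
      using Suc.prems by (simp add: F monom_Suc)
    then show ?thesis using Suc.IH[of F'] by simp
  qed (use \<open>e * a = 0\<close> in simp)
qed

lemma dvd_monom_mult_cancel:
  fixes p U :: "'a::field poly"
  assumes "p dvd monom 1 M * U" "coeff p 0 \<noteq> 0"
  shows "p dvd U"
proof -
  obtain h where "monom 1 M * U = p * h" using assms(1) by (auto elim: dvdE)
  then show ?thesis
  proof (induction M arbitrary: h)
    case 0
    then show ?case by (simp add: monom_0 one_pCons)
  next
    case (Suc M)
    obtain a h' where h: "h = pCons a h'" by (cases h)
    have "coeff p 0 * a = 0"
      using arg_cong[OF Suc.prems, of "\<lambda>p. coeff p 0"] by (auto simp: h coeff_mult monom_Suc)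
    then have "a = 0" using assms(2) by simp
    then have "pCons 0 (monom 1 M * U) = pCons 0 (p * h')"
      using Suc.prems by (simp add: h monom_Suc)
    then show ?case using Suc.IH[of h'] by simp
  qed
qed

lemma dvd_same_cubic:
  fixes p U :: "'a::field poly"
  assumes "p dvd U" "degree U = degree p" "coeff U 0 = coeff p 0" "coeff p 0 \<noteq> 0"
  shows "U = p"
proof -
  obtain h where h: "U = p * h" using assms(1) by (auto elim: dvdE)
  have "p \<noteq> 0" "h \<noteq> 0" using h assms by auto
  then have "degree h = 0" using assms(2) by (simp add: h degree_mult_eq)
  then obtain a where a: "h = [:a:]" by (metis degree_eq_zeroE)
  have "a = 1" using assms(3,4) by (simp add: h a)
  then show ?thesis by (simp add: h a)
qed

lemma ev1_pcompose: "ev1 (ev1 y R) Q = ev1 y (pcompose Q R)"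
  by (induction Q) (simp_all add: ev1_simps pcompose_pCons)

lemma cluster_swap_neighbour:
  assumes "cluster A X Y P Q" shows "ev1 X P / Y \<in> A"
  by (rule cluster_neighbour[OF cluster_swap[OF assms]])

text \<open>
  The three leading exponents of \<open>Z\<close>, \<open>X\<close>, \<open>Y\<close> form an arithmetic progression in
  \<open>{-1, 0, 1}\<close>, which pins them down.
\<close>

lemma cluster_degree_one_rigid:
  fixes A :: "'k::field fls fls set"
  assumes base: "cluster A tx ty p q" and cl: "cluster A X Y P Q"
    and deg: "tdeg X = 1" "tdeg Y = 1" and lt: "snd (lval X) < snd (lval Y)"
    and c: "coeff P 0 = coeff p 0"
  shows "\<exists>s t. X = scal s * tx \<and> Y = scal t * ty \<and>
           coeff P 3 * s ^ 3 = coeff p 3 \<and> coeff Q 3 * t ^ 3 = coeff q 3"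
proof -
  have PQ: "cubic_pair P Q" and pq: "cubic_pair p q" using cl base by (auto simp: cluster_def)
  note sub = cluster_subalg[OF cl] and nz = cluster_nonzero[OF cl]
  have ind: "indep tx ty" "indep ty tx" using indep_tx_ty indep_swap by blast+
  have w: "wedge X Y \<noteq> 0" by (rule cluster_wedge[OF base cl])
  note Z = lval_zof[OF cl w deg lt]
  note cases = base_degree_one_cases[OF base]
  have sX: "snd (lval X) = 0 \<and> snd (lval Y) = 1"
  proof -
    have v: "snd (lval f) = -1 \<or> snd (lval f) = 0 \<or> snd (lval f) = 1" if "f \<in> A" "tdeg f = 1" for f
      using cases[OF that] by blast
    show ?thesis
      using v[OF sub(2) deg(1)] v[OF sub(3) deg(2)] v[OF sub(4) Z(1)] lt unfolding Z(2) by presburger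
  qed
  obtain r s t where X: "s \<noteq> 0" "X = scal r + scal s * tx + scal t * ty"
    using cases[OF sub(2) deg(1)] sX by auto
  obtain r' t' where Y: "t' \<noteq> 0" "Y = scal r' + scal t' * ty"
    using cases[OF sub(3) deg(2)] sX by auto
  \<comment> \<open>The element \<open>Q(Y) / X\<close> has a Laurent expansion in
    \<open>tx\<close>, \<open>ty\<close>, so \<open>X\<close> divides a power of \<open>tx\<close>
    times a polynomial in \<open>ty\<close>; hence the part of \<open>X\<close> free of
    \<open>tx\<close> vanishes.\<close>
  have "[:r, t:] = 0"
  proof -
    define u where "u = ev1 Y Q / X"
    have "u \<in> A" unfolding u_def by (rule cluster_neighbour[OF cl])
    then obtain M N F where F: "tx ^ M * ty ^ N * u = ev2 ty tx F"
      using cluster_lrep[OF base] unfolding lrep_def by blast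
    define R where "R = pcompose Q [:r', t':]"
    have R: "ev1 Y Q = ev1 ty R" "R \<noteq> 0"
      subgoal unfolding R_def ev1_pcompose[symmetric] by (simp add: Y(2) ev1_simps mult.commute)
      subgoal unfolding R_def using Y(1) PQ by (subst pcompose_eq_0_iff) (auto simp: cubic_pair_def)
      done
    have "ev2 ty tx ([:[:r, t:], [:s:]:] * F) = X * (tx ^ M * ty ^ N * u)"
      unfolding F by (simp add: X(2) ev1_simps ev2_simps algebra_simps)
    also have "\<dots> = tx ^ M * ty ^ N * ev1 ty R" using nz by (simp add: u_def R)
    also have "\<dots> = ev2 ty tx (monom (monom 1 N * R) M)"
      by (simp add: ev1_simps ev2_simps mult_ac)
    finally have "[:[:r, t:], [:s:]:] * F = monom (monom 1 N * R) M" by (rule indep_inj[OF ind(2)])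
    then show ?thesis by (rule linear_dvd_monom) (use X(1) R(2) in auto)
  qed
  then have X': "X = scal s * tx" using X(2) by simp
  define U where "U = pcompose P [:0, s:]"
  have U: "ev1 X P = ev1 tx U"
    unfolding U_def ev1_pcompose[symmetric] by (simp add: X' ev1_simps mult.commute)
  have degU: "degree U = 3" unfolding U_def using X(1) PQ by (simp add: degree_pcompose cubic_pair_def)
  define u where "u = ev1 X P / Y"
  have uA: "u \<in> A" unfolding u_def by (rule cluster_swap_neighbour[OF cl])
  have "[:r':] = 0"
  proof -
    obtain M N F where F: "ty ^ M * tx ^ N * u = ev2 tx ty F"
      using cluster_lrep[OF cluster_swap[OF base] uA] unfolding lrep_def by blast
    have "ev2 tx ty ([:[:r':], [:t':]:] * F) = Y * (ty ^ M * tx ^ N * u)"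
      unfolding F by (simp add: Y(2) ev1_simps ev2_simps algebra_simps)
    also have "\<dots> = ty ^ M * tx ^ N * ev1 tx U" using nz by (simp add: u_def U)
    also have "\<dots> = ev2 tx ty (monom (monom 1 N * U) M)"
      by (simp add: ev1_simps ev2_simps mult_ac)
    finally have "[:[:r':], [:t':]:] * F = monom (monom 1 N * U) M" by (rule indep_inj[OF ind(1)])
    then show ?thesis by (rule linear_dvd_monom) (use Y(1) degU in auto)
  qed
  then have Y': "Y = scal t' * ty" using Y(2) by simp
  \<comment> \<open>Stated for arbitrary variables because it is applied to both orders of the
    pair.\<close>
  have dvd: "p dvd U" if cl: "cluster A (scal s * tx) (scal t' * ty) P Q" and base: "cluster A tx ty p q"
      and ind: "indep tx ty" and U: "ev1 (scal s * tx) P = ev1 tx U" and t': "t' \<noteq> 0"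
    for s t' P Q U p q and tx ty :: "'k fls fls"
  proof -
    define u where "u = ev1 (scal s * tx) P / (scal t' * ty)"
    note nz = cluster_nonzero[OF cl]
    have uA: "u \<in> A" unfolding u_def by (rule cluster_swap_neighbour[OF cl])
    obtain M N where "lrep ty tx p M N u"
      using cluster_lrep[OF cluster_swap[OF base] uA] by blast
    \<comment> \<open>The spare power of \<open>ty\<close> puts the coefficient in question at index
      \<open>M\<close>, where the guaranteed divisor is exactly \<open>p\<close>; with exponent
      \<open>M = 0\<close> there would be no such index.\<close>
    then have "lrep ty tx p (Suc M) N u" by (rule lrep_mono) auto
    then obtain F where F: "ty ^ Suc M * tx ^ N * u = ev2 tx ty F" "\<And>i. p ^ (Suc M - i) dvd coeff F i"
      unfolding lrep_def by blast
    have "ev2 tx ty (monom [:t':] 1 * F) = scal t' * ty * (ty ^ Suc M * tx ^ N * u)"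
      unfolding F by (simp add: ev1_simps ev2_simps algebra_simps)
    also have "\<dots> = ty ^ Suc M * tx ^ N * ev1 tx U" using nz by (simp add: u_def U)
    also have "\<dots> = ev2 tx ty (monom (monom 1 N * U) (Suc M))"
      by (simp add: ev1_simps ev2_simps mult_ac)
    finally have "monom [:t':] 1 * F = monom (monom 1 N * U) (Suc M)" by (rule indep_inj[OF ind])
    then have "coeff (monom [:t':] 1 * F) (Suc M) = coeff (monom (monom 1 N * U) (Suc M)) (Suc M)"
      by simp
    then have "[:t':] * coeff F M = monom 1 N * U" by (simp add: coeff_monom_mult)
    moreover have "p dvd coeff F M" using F(2)[of M] by simp
    ultimately have "p dvd monom 1 N * U" by (metis dvd_mult)
    moreover have "coeff p 0 \<noteq> 0" using base cubic_pair_nonzero by (auto simp: cluster_def)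
    ultimately show ?thesis by (rule dvd_monom_mult_cancel)
  qed
  have cl': "cluster A (scal s * tx) (scal t' * ty) P Q" using cl by (simp add: X' Y')
  have co: "coeff (pcompose R [:0, v:]) n = coeff R n * v ^ n" for R :: "'k poly" and v n
    by (induction R arbitrary: n) (simp_all add: pcompose_pCons coeff_pCons split: nat.splits)
  have pU: "U = p"
  proof (rule dvd_same_cubic)
    show "p dvd U" by (rule dvd[OF cl' base ind(1) _ Y(1)]) (use U X' in simp)
    show "degree U = degree p" using degU pq by (simp add: cubic_pair_def)
    show "coeff U 0 = coeff p 0" using c unfolding U_def co by simp
    show "coeff p 0 \<noteq> 0" using pq cubic_pair_nonzero by blast
  qed
  define V where "V = pcompose Q [:0, t':]"
  have V: "ev1 Y Q = ev1 ty V"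
    unfolding V_def ev1_pcompose[symmetric] by (simp add: Y' ev1_simps mult.commute)
  have qV: "V = q"
  proof (rule dvd_same_cubic)
    show "q dvd V"
      by (rule dvd[OF cluster_swap[OF cl'] cluster_swap[OF base] ind(2) _ X(1)]) (use V Y' in simp)
    show "degree V = degree q" unfolding V_def using Y(1) PQ pq by (simp add: degree_pcompose cubic_pair_def)
    show "coeff V 0 = coeff q 0" using c PQ pq unfolding V_def co by (simp add: cubic_pair_def)
    show "coeff q 0 \<noteq> 0" using pq cubic_pair_nonzero by blast
  qed
  have "coeff P 3 * s ^ 3 = coeff p 3" using arg_cong[OF pU, of "\<lambda>p. coeff p 3"] by (simp add: U_def co)
  moreover have "coeff Q 3 * t' ^ 3 = coeff q 3" using arg_cong[OF qV, of "\<lambda>p. coeff p 3"] by (simp add: V_def co)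
  ultimately show ?thesis using X' Y' by blast
qed

lemma finite_cube_roots:
  fixes a b :: "'k::field"
  assumes "a \<noteq> 0"
  shows "finite {s. a * s ^ 3 = b}"
proof -
  have "monom a 3 - [:b:] \<noteq> 0"
  proof
    assume "monom a 3 - [:b:] = 0"
    then have "coeff (monom a 3 - [:b:]) 3 = 0" by simp
    then show False using assms by (simp add: numeral_3_eq_3)
  qed
  then have "finite {s. poly (monom a 3 - [:b:]) s = 0}" by (rule poly_roots_finite)
  moreover have "{s. poly (monom a 3 - [:b:]) s = 0} = {s. a * s ^ 3 = b}"
    by (simp add: poly_monom)
  ultimately show ?thesis by simp
qed

text \<open>By rigidity such a cluster consists of \<open>tx\<close> and \<open>ty\<close>, in one
  of two orders, scaled by factors with prescribed cubes.\<close>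

lemma finite_balanced_clusters:
  fixes A :: "'k::field fls fls set"
  assumes base: "cluster A tx ty p q" and c: "coeff P 0 = coeff p 0"
  shows "finite {(X, Y). cluster A X Y P Q \<and> 0 < tdeg X \<and> 0 < tdeg Y \<and>
           2 * tdeg X \<le> 3 * tdeg Y \<and> 2 * tdeg Y \<le> 3 * tdeg X}" (is "finite ?S")
proof (cases "cubic_pair P Q")
  case PQ: True
  define R where "R = (\<lambda>a b :: 'k. {s. a * s ^ 3 = b})"
  define T where "T = (\<lambda>(s, t). (scal s * tx, scal t * ty)) ` (R (coeff P 3) (coeff p 3) \<times> R (coeff Q 3) (coeff q 3))
     \<union> (\<lambda>(s, t). (scal t * ty, scal s * tx)) ` (R (coeff Q 3) (coeff p 3) \<times> R (coeff P 3) (coeff q 3))"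
  have "finite T"
    unfolding T_def R_def
    by (intro finite_UnI finite_imageI finite_cartesian_product finite_cube_roots coeff_3_nonzero[OF PQ])
  moreover have "?S \<subseteq> T"
  proof clarify
    fix X Y assume cl: "cluster A X Y P Q" and ab: "0 < tdeg X" "0 < tdeg Y"
           "2 * tdeg X \<le> 3 * tdeg Y" "2 * tdeg Y \<le> 3 * tdeg X"
    have deg: "tdeg X = 1" "tdeg Y = 1" using cluster_degree_eq_one[OF base cl ab] by auto
    have c': "coeff Q 0 = coeff p 0" using PQ c by (simp add: cubic_pair_def)
    have "wedge X Y \<noteq> 0" by (rule cluster_wedge[OF base cl])
    then have "snd (lval X) \<noteq> snd (lval Y)" using deg by (auto simp: wedge_def fst_lval)
    then consider "snd (lval X) < snd (lval Y)" | "snd (lval Y) < snd (lval X)" by linarith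
    then show "(X, Y) \<in> T"
    proof cases
      case 1
      then obtain s t where "X = scal s * tx" "Y = scal t * ty"
           "coeff P 3 * s ^ 3 = coeff p 3" "coeff Q 3 * t ^ 3 = coeff q 3"
        using cluster_degree_one_rigid[OF base cl deg _ c] by blast
      then have "(X, Y) \<in> (\<lambda>(s, t). (scal s * tx, scal t * ty)) ` (R (coeff P 3) (coeff p 3) \<times> R (coeff Q 3) (coeff q 3))"
        by (intro image_eqI[of _ _ "(s, t)"]) (auto simp: R_def)
      then show ?thesis by (simp add: T_def)
    next
      case 2
      then obtain s t where "Y = scal s * tx" "X = scal t * ty"
           "coeff Q 3 * s ^ 3 = coeff p 3" "coeff P 3 * t ^ 3 = coeff q 3"
        using cluster_degree_one_rigid[OF base cluster_swap[OF cl] deg(2,1) _ c'] by blast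
      then have "(X, Y) \<in> (\<lambda>(s, t). (scal t * ty, scal s * tx)) ` (R (coeff Q 3) (coeff p 3) \<times> R (coeff P 3) (coeff q 3))"
        by (intro image_eqI[of _ _ "(s, t)"]) (auto simp: R_def)
      then show ?thesis by (simp add: T_def)
    qed
  qed
  ultimately show ?thesis by (rule finite_subset[rotated])
next
  case False
  then have "?S = {}" by (auto simp: cluster_def)
  then show ?thesis by (simp only: finite.emptyI)
qed

section \<open>Mutation and automorphisms\<close>

lemma prime_elem_pCons_0_1: "prime_elem ([:0, 1:] :: 'a::idom poly)"
proof (rule prime_elemI)
  have dvd: "[:0, 1:] dvd p \<longleftrightarrow> poly p 0 = 0" for p :: "'a poly"
    using poly_eq_0_iff_dvd[of p 0] by simp
  show "\<not> ([:0, 1:] :: 'a poly) dvd 1" by (simp add: dvd)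
  show "[:0, 1:] dvd a \<or> [:0, 1:] dvd b" if "[:0, 1:] dvd a * b" for a b :: "'a poly"
    using that by (simp add: dvd)
qed auto

lemma prime_elem_cancel:
  fixes d :: "'a::idom"
  assumes "prime_elem d" "\<not> d dvd w" "w dvd d * f"
  shows "w dvd f"
proof -
  obtain e where e: "d * f = w * e" using assms(3) by (auto elim: dvdE)
  then have "d dvd w * e" by (metis dvd_triv_left)
  then have "d dvd e" using assms(1,2) prime_elem_dvd_mult_iff by blast
  then obtain e' where "e = d * e'" by (auto elim: dvdE)
  then have "d * f = d * (w * e')" using e by (simp add: mult_ac)
  then have "f = w * e'" using assms(1) by auto
  then show ?thesis by simp
qed

lemma var_relation: "var_x * var_y * var_z - [:g:] = [:- g, [:0, [:0, 1:]:]:]"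
  by (simp add: var_x_def var_y_def var_z_def)

lemma ev3_relation:
  assumes "X * Y * Z = ev2 X Y g" "(var_x * var_y * var_z - [:g:]) dvd F"
  shows "ev3 X Y Z F = 0"
proof -
  have "ev3 X Y Z (var_x * var_y * var_z - [:g:]) = 0"
    unfolding var_relation using assms(1)
    by (simp add: ev3_simps ev2_simps ev1_simps mult_ac)
  then show ?thesis using assms(2) by (auto elim!: dvdE)
qed

lemma pseudo_division:
  fixes D g :: "'a::comm_ring_1"
  shows "\<exists>n c R. [:D ^ n:] * F = [:- g, D:] * R + [:c:]"
proof (induction F)
  case 0
  show ?case by (intro exI[of _ 0]) simp
next
  case (pCons a F)
  then obtain n c R where IH: "[:D ^ n:] * F = [:- g, D:] * R + [:c:]" by blast
  have zD: "[:0, D:] = [:- g, D:] + [:g:]" by simp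
  have "[:D ^ Suc n:] * pCons a F = [:D ^ Suc n * a:] + [:0, D:] * ([:D ^ n:] * F)"
    by (simp add: mult_ac smult_smult)
  also have "\<dots> = [:D ^ Suc n * a:] + [:0, D:] * ([:- g, D:] * R) + ([:- g, D:] + [:g:]) * [:c:]"
    unfolding IH zD[symmetric] by (simp only: distrib_left add.assoc)
  also have "\<dots> = [:- g, D:] * ([:0, D:] * R + [:c:]) + [:D ^ Suc n * a + g * c:]"
    by (simp add: algebra_simps)
  finally show ?case by blast
qed

text \<open>Pseudo-division by \<open>W\<close>, linear in \<open>z\<close>, leaves a remainder in
  \<open>k[x,y]\<close>, which is 0 by independence. The power of \<open>x y\<close> that this costs
  cancels because neither of the primes \<open>x\<close>, \<open>y\<close> divides \<open>W\<close>:
  both \<open>g(0, y)\<close> and \<open>g(x, 0)\<close> are nonzero.\<close>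

lemma ev3_kernel:
  fixes g :: "'k::field poly poly"
  assumes ind: "indep X Y" and XYZ: "X * Y * Z = ev2 X Y g"
    and g: "coeff g 0 \<noteq> 0" "\<exists>j. coeff (coeff g j) 0 \<noteq> 0"
  shows "ev3 X Y Z F = 0 \<longleftrightarrow> (var_x * var_y * var_z - [:g:]) dvd F"
proof
  define D :: "'k poly poly" where "D = [:0, [:0, 1:]:]"
  define W where "W = [:- g, D:]"
  have W: "W = var_x * var_y * var_z - [:g:]" unfolding W_def D_def var_relation ..
  assume F: "ev3 X Y Z F = 0"
  obtain n c R where ncR: "[:D ^ n:] * F = W * R + [:c:]"
    using pseudo_division[of D F g] unfolding W_def by blast
  have "ev3 X Y Z W = 0"
    by (rule ev3_relation[OF XYZ]) (simp add: W)
  then have "ev3 X Y Z [:c:] = 0"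
    using arg_cong[OF ncR, of "ev3 X Y Z"] F by (simp add: ev3_simps)
  then have "c = 0" using ind unfolding indep_def by (simp add: ev3_simps)
  then have dvd: "W dvd [:D ^ n:] * F" using ncR by simp
  define x1 :: "'k poly poly poly" where "x1 = [:[:[:0, 1:]:]:]"
  define y1 :: "'k poly poly poly" where "y1 = [:[:0, 1:]:]"
  have D: "[:D:] = x1 * y1" by (simp add: D_def x1_def y1_def)
  have prime: "prime_elem x1" "prime_elem y1"
    unfolding x1_def y1_def by (intro lift_prime_elem_poly prime_elem_pCons_0_1)+
  have "\<not> x1 dvd W"
  proof
    assume "x1 dvd W"
    then have "[:[:0, 1:]:] dvd coeff W 0" unfolding x1_def const_poly_dvd_iff by blast
    then have "[:0, 1:] dvd coeff g j" for j by (simp add: W_def const_poly_dvd_iff)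
    then have "poly (coeff g j) 0 = 0" for j
      using poly_eq_0_iff_dvd[of "coeff g j" 0] by simp
    then show False using g(2) by (simp add: poly_0_coeff_0)
  qed
  moreover have "\<not> y1 dvd W"
  proof
    assume "y1 dvd W"
    then have "[:0, 1:] dvd coeff W 0" unfolding y1_def const_poly_dvd_iff by blast
    then have "[:0, 1:] dvd g" by (simp add: W_def)
    then show False using g(1) poly_eq_0_iff_dvd[of g 0] by (simp add: poly_0_coeff_0)
  qed
  ultimately have cancel: "W dvd f" if "W dvd [:D:] * f" for f
    using prime_elem_cancel[OF prime(1)] prime_elem_cancel[OF prime(2)] that
    unfolding D by (metis mult.assoc)
  from dvd have "W dvd F"
  proof (induction n)
    case (Suc n)
    have "[:D ^ Suc n:] * F = [:D:] * ([:D ^ n:] * F)" by (simp add: mult.commute)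
    then have "W dvd [:D ^ n:] * F" using Suc.prems cancel by metis
    then show ?case by (rule Suc.IH)
  qed simp
  then show "(var_x * var_y * var_z - [:g:]) dvd F" by (simp only: W)
qed (rule ev3_relation[OF XYZ])

definition row0 :: "'k::field poly poly \<Rightarrow> 'k poly" where
  "row0 g = coeff g 0"

definition col0 :: "'k::field poly poly \<Rightarrow> 'k poly" where
  "col0 g = map_poly (\<lambda>c. coeff c 0) g"

lemma coeff_row0_col0: "coeff (row0 g) i = coeff_xy g i 0" "coeff (col0 g) j = coeff_xy g 0 j"
  by (simp_all add: row0_def col0_def coeff_xy_def coeff_map_poly)

lemma degree_xy_bound:
  assumes "coeff_xy g i j \<noteq> 0"
  shows "i + j \<le> degree_xy g"
proof -
  have "{i + j |i j. coeff_xy g i j \<noteq> 0} = (\<lambda>(i, j). i + j) ` bsupp g"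
    by (auto simp: bsupp_def coeff_xy_def)
  then have "finite {i + j |i j. coeff_xy g i j \<noteq> 0}" by (simp add: finite_bsupp)
  then show ?thesis unfolding degree_xy_def using assms by (intro Max_ge) auto
qed

lemma cubic_pair_row0_col0:
  assumes "degree_xy g = 3" "coeff_xy g 3 0 \<noteq> 0" "coeff_xy g 0 3 \<noteq> 0" "coeff_xy g 0 0 \<noteq> 0"
  shows "cubic_pair (row0 g) (col0 g)"
proof -
  have z: "coeff_xy g i j = 0" if "3 < i + j" for i j
    using degree_xy_bound[of g i j] assms(1) that by linarith
  have "degree (row0 g) = 3" "degree (col0 g) = 3"
    by (intro antisym degree_le le_degree; use assms in \<open>simp add: coeff_row0_col0 z\<close>)+
  then show ?thesis using assms by (simp add: cubic_pair_def coeff_row0_col0)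
qed

lemma ev2_mixed:
  assumes "degree_xy g = 3"
  shows "ev2 X Y g = ev1 X (row0 g) + ev1 Y (col0 g) - scal (coeff (row0 g) 0)
    + X * Y * (scal (coeff_xy g 1 1) + scal (coeff_xy g 2 1) * X + scal (coeff_xy g 1 2) * Y)"
proof -
  have z: "coeff_xy g i j = 0" if "3 < i + j" for i j
    using degree_xy_bound[of g i j] assms that by linarith
  have deg: "degree (coeff g j) \<le> 3" for j
    by (rule degree_le) (use z in \<open>auto simp: coeff_xy_def\<close>)
  have "degree g \<le> 3"
  proof (rule degree_le, safe)
    fix j :: nat assume "3 < j"
    then show "coeff g j = 0" using z by (intro poly_eqI) (auto simp: coeff_xy_def)
  qed
  then have "ev2 X Y g = (\<Sum>j\<le>3. ev1 X (coeff g j) * Y ^ j)"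
    by (rule eval_with_altdef[OF ring_map_ev1])
  also have "\<dots> = (\<Sum>j\<le>3. (\<Sum>i\<le>3. scal (coeff_xy g i j) * X ^ i) * Y ^ j)"
    by (simp add: eval_with_altdef[OF ring_map_scal deg] coeff_xy_def)
  also have "\<dots> = (\<Sum>i\<le>3. scal (coeff_xy g i 0) * X ^ i) + (\<Sum>j\<le>3. scal (coeff_xy g 0 j) * Y ^ j)
      - scal (coeff_xy g 0 0)
      + X * Y * (scal (coeff_xy g 1 1) + scal (coeff_xy g 2 1) * X + scal (coeff_xy g 1 2) * Y)"
    by (simp add: numeral_3_eq_3 z numeral_2_eq_2 algebra_simps)
  also have "(\<Sum>i\<le>3. scal (coeff_xy g i 0) * X ^ i) = ev1 X (row0 g)"
    using deg[of 0] by (simp add: eval_with_altdef[OF ring_map_scal, of _ 3] row0_def coeff_xy_def)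
  also have "(\<Sum>j\<le>3. scal (coeff_xy g 0 j) * Y ^ j) = ev1 Y (col0 g)"
  proof -
    have "degree (col0 g) \<le> 3" by (rule degree_le) (auto simp: coeff_row0_col0 z)
    then show ?thesis by (simp add: eval_with_altdef[OF ring_map_scal, of _ 3] coeff_row0_col0)
  qed
  finally show ?thesis by (simp add: coeff_row0_col0)
qed

text \<open>The two third generators differ by the polynomial \<open>l\<close> in \<open>X\<close>
  and \<open>Y\<close>. The statement covers all pairs so that it can also restore the mixed terms
  of \<open>g\<close> after mutation.\<close>

lemma galg_mixed:
  assumes g: "degree_xy g = 3" and nz: "X \<noteq> 0" "Y \<noteq> 0"
  shows "galg X Y (ev2 X Y g / (X * Y)) = galg X Y (zof X Y (row0 g) (col0 g))"
proof -
  define l where "l = scal (coeff_xy g 1 1) + scal (coeff_xy g 2 1) * X + scal (coeff_xy g 1 2) * Y"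
  have eq: "ev2 X Y g / (X * Y) = zof X Y (row0 g) (col0 g) + l"
    unfolding ev2_mixed[OF g] l_def[symmetric] zof_def using nz by (simp add: add_divide_distrib)
  have l: "l \<in> galg X Y Z" for Z
    unfolding l_def by (intro subalgD[OF subalg_galg] galg_gen)
  define Z where "Z = zof X Y (row0 g) (col0 g)"
  have "(Z + l) - l \<in> galg X Y (Z + l)" "Z + l \<in> galg X Y Z"
    by (intro subalgD(2,7)[OF subalg_galg] galg_gen l)+
  then show ?thesis
    unfolding eq Z_def[symmetric] by (intro equalityI galg_subset subalg_galg galg_gen) simp_all
qed

section \<open>The sequence of cluster variables\<close>

fun pv :: "'k::field poly \<Rightarrow> 'k poly \<Rightarrow> nat \<Rightarrow> 'k poly" where
  "pv p q 0 = p"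
| "pv p q (Suc 0) = q"
| "pv p q (Suc (Suc n)) = mutp (pv p q n)"

fun yv :: "'k::field poly \<Rightarrow> 'k poly \<Rightarrow> nat \<Rightarrow> 'k fls fls" where
  "yv p q 0 = tx"
| "yv p q (Suc 0) = ty"
| "yv p q (Suc (Suc n)) = ev1 (yv p q (Suc n)) (pv p q (Suc n)) / yv p q n"

lemma lval_ev1:
  assumes "Y \<noteq> 0" "0 < tdeg Y" "P \<noteq> 0"
  shows "ev1 Y P \<noteq> 0 \<and> lval (ev1 Y P) = lval (Y ^ degree P)"
  using assms(3)
proof (induction P)
  case (pCons a P)
  show ?case
  proof (cases "P = 0")
    case True
    then have "a \<noteq> 0" using pCons by simp
    then show ?thesis using True by (simp add: ev1_simps lval_1)
  next
    case False
    define u where "u = Y * ev1 Y P"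
    have u: "u \<noteq> 0" "lval u = lval (Y ^ Suc (degree P))"
      using pCons.IH[OF False] assms(1) by (auto simp: u_def lval_mult)
    have "fst (lval u) < 0"
      unfolding u(2) lval_power[OF assms(1)] using assms(2) by (simp add: fst_lval mult_pos_neg)
    then have "lval u < lval (scal a) \<or> scal a = 0" by (auto simp: less_prod_def)
    then have "u + scal a \<noteq> 0 \<and> lval (u + scal a) = lval u" by (rule lval_add_lt[OF u(1)])
    then show ?thesis using u False by (simp add: ev1_simps u_def add.commute)
  qed
qed simp

text \<open>From \<open>X * u = Q(Y)\<close> one gets \<open>lval u = 3 lval Y - lval X\<close>, so
  the determinant stays 1 and the degrees never decrease. The determinant supplies the independence
  that \<open>cluster_mutate\<close> asks for.\<close>

lemma yv_cluster:
  assumes base: "cluster A tx ty p q"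
  shows "cluster A (yv p q n) (yv p q (Suc n)) (pv p q n) (pv p q (Suc n)) \<and>
    0 < tdeg (yv p q n) \<and> tdeg (yv p q n) \<le> tdeg (yv p q (Suc n)) \<and>
    wedge (yv p q n) (yv p q (Suc n)) = 1"
proof (induction n)
  case 0
  then show ?case using base by (simp add: wedge_tx_ty)
next
  case (Suc n)
  define X where "X = yv p q n"
  define Y where "Y = yv p q (Suc n)"
  define P where "P = pv p q n"
  define Q where "Q = pv p q (Suc n)"
  define u where "u = ev1 Y Q / X"
  have IH: "cluster A X Y P Q" "0 < tdeg X" "tdeg X \<le> tdeg Y" "wedge X Y = 1"
    using Suc by (auto simp: X_def Y_def P_def Q_def)
  note nz = cluster_nonzero[OF IH(1)]
  have PQ: "cubic_pair P Q" using IH(1) by (simp add: cluster_def)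
  have Q0: "Q \<noteq> 0" and dQ: "degree Q = 3" using PQ by (auto simp: cubic_pair_def)
  have u0: "u \<noteq> 0" using nz by (simp add: u_def)
  have "lval (X * u) = lval (Y ^ 3)"
    using lval_ev1[OF nz(2) _ Q0] IH(2,3) nz by (simp add: u_def dQ)
  then have sum: "lval X + lval u = (3 * fst (lval Y), 3 * snd (lval Y))"
    using nz u0 by (simp add: lval_mult lval_power)
  then have fu: "fst (lval u) = 3 * fst (lval Y) - fst (lval X)"
    and su: "snd (lval u) = 3 * snd (lval Y) - snd (lval X)"
    by (auto simp: prod_eq_iff)
  have du: "tdeg u = 3 * tdeg Y - tdeg X" using fu by (simp add: fst_lval)
  have wu: "wedge Y u = 1"
    using IH(4) unfolding wedge_def fu su by (simp add: algebra_simps)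
  then have "cluster A Y u Q (mutp P)"
    unfolding u_def
    by (intro cluster_mutate[OF IH(1)] indep_wedge) (use nz u0 in \<open>auto simp: u_def\<close>)
  moreover have "0 < tdeg Y" "tdeg Y \<le> tdeg u" using IH du by simp_all
  ultimately show ?case using wu by (simp add: X_def Y_def P_def Q_def u_def)
qed

lemma pv_period:
  assumes "cubic_pair p q"
  shows "pv p q 4 = p" "pv p q 5 = q"
  using mutp_mutp[OF assms] mutp_mutp[OF cubic_pair_swap[OF assms]]
  by (simp_all add: eval_nat_numeral)

lemma coeff_pv_0: "coeff p 0 = coeff q 0 \<Longrightarrow> coeff (pv p q n) 0 = coeff p 0"
  by (induction p q n rule: pv.induct) (simp_all add: coeff_mutp)

section \<open>Algebra automorphisms and the degrees of their values\<close>

definition alg_auto :: "'k::field fls fls set \<Rightarrow> ('k fls fls \<Rightarrow> 'k fls fls) \<Rightarrow> bool" where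
  "alg_auto A \<phi> \<longleftrightarrow> (\<forall>c. \<phi> (scal c) = scal c) \<and>
     (\<forall>f\<in>A. \<forall>h\<in>A. \<phi> (f + h) = \<phi> f + \<phi> h \<and> \<phi> (f * h) = \<phi> f * \<phi> h) \<and> bij_betw \<phi> A A"

lemma alg_autoD:
  assumes "alg_auto A \<phi>"
  shows "\<phi> (scal c) = scal c" "f \<in> A \<Longrightarrow> h \<in> A \<Longrightarrow> \<phi> (f + h) = \<phi> f + \<phi> h"
    "f \<in> A \<Longrightarrow> h \<in> A \<Longrightarrow> \<phi> (f * h) = \<phi> f * \<phi> h" "f \<in> A \<Longrightarrow> \<phi> f \<in> A" "\<phi> ` A = A" "\<phi> 0 = 0"
    "f \<in> A \<Longrightarrow> h \<in> A \<Longrightarrow> \<phi> f = \<phi> h \<Longrightarrow> f = h"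
proof -
  show s: "\<phi> (scal c) = scal c" for c using assms by (simp add: alg_auto_def)
  show "\<phi> 0 = 0" using s[of 0] by simp
  show "\<phi> ` A = A" using assms by (simp add: alg_auto_def bij_betw_def)
  then show "f \<in> A \<Longrightarrow> \<phi> f \<in> A" by blast
  have "inj_on \<phi> A" using assms by (simp add: alg_auto_def bij_betw_def)
  then show "f \<in> A \<Longrightarrow> h \<in> A \<Longrightarrow> \<phi> f = \<phi> h \<Longrightarrow> f = h" by (rule inj_onD)
  show "f \<in> A \<Longrightarrow> h \<in> A \<Longrightarrow> \<phi> (f + h) = \<phi> f + \<phi> h"
    "f \<in> A \<Longrightarrow> h \<in> A \<Longrightarrow> \<phi> (f * h) = \<phi> f * \<phi> h"
    using assms by (simp_all add: alg_auto_def)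
qed

context
  fixes A :: "'k::field fls fls set" and \<phi>
  assumes auto: "alg_auto A \<phi>" and sub: "subalg A"
begin

lemma alg_auto_ev1: "X \<in> A \<Longrightarrow> \<phi> (ev1 X F) = ev1 (\<phi> X) F"
  by (induction F) (simp_all add: ev1_simps alg_autoD(1-4,6)[OF auto] subalgD[OF sub] subalg_ev1[OF sub])

lemma alg_auto_ev2: "X \<in> A \<Longrightarrow> Y \<in> A \<Longrightarrow> \<phi> (ev2 X Y F) = ev2 (\<phi> X) (\<phi> Y) F"
  by (induction F)
     (simp_all add: ev2_simps alg_autoD(1-4,6)[OF auto] subalgD[OF sub] subalg_ev1[OF sub] subalg_ev2[OF sub] alg_auto_ev1)

lemma alg_auto_ev3: "X \<in> A \<Longrightarrow> Y \<in> A \<Longrightarrow> Z \<in> A \<Longrightarrow> \<phi> (ev3 X Y Z F) = ev3 (\<phi> X) (\<phi> Y) (\<phi> Z) F"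
  by (induction F)
     (simp_all add: ev3_simps alg_autoD(1-4,6)[OF auto] subalgD[OF sub] subalg_ev2[OF sub] subalg_ev3[OF sub] alg_auto_ev2)

lemma alg_auto_indep:
  assumes "indep X Y" "X \<in> A" "Y \<in> A"
  shows "indep (\<phi> X) (\<phi> Y)"
  unfolding indep_def
proof (intro allI impI)
  fix F assume "ev2 (\<phi> X) (\<phi> Y) F = 0"
  then have "\<phi> (ev2 X Y F) = \<phi> 0" using assms by (simp add: alg_auto_ev2 alg_autoD(6)[OF auto])
  then have "ev2 X Y F = 0"
    using alg_autoD(7)[OF auto] subalg_ev2[OF sub assms(2,3)] subalgD(4)[OF sub] by blast
  then show "F = 0" using assms(1) by (simp add: indep_def)
qed

lemma alg_auto_zof:
  assumes cl: "cluster A X Y P Q"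
  shows "\<phi> (zof X Y P Q) = zof (\<phi> X) (\<phi> Y) P Q"
proof -
  note S = cluster_subalg[OF cl]
  have nz: "\<phi> X \<noteq> 0" "\<phi> Y \<noteq> 0"
    using indep_nonzero[OF alg_auto_indep[OF _ S(2,3)]] cl unfolding cluster_def by blast+
  have "\<phi> (X * Y * zof X Y P Q) = \<phi> (ev1 X P + ev1 Y Q + scal (- coeff P 0))"
    unfolding zof_mult[OF cluster_nonzero(1,2)[OF cl]] by simp
  then have "\<phi> X * \<phi> Y * \<phi> (zof X Y P Q) = ev1 (\<phi> X) P + ev1 (\<phi> Y) Q + scal (- coeff P 0)"
    using S by (simp add: alg_autoD(1-4,6)[OF auto] subalgD[OF sub] subalg_ev1[OF sub] alg_auto_ev1 del: scal_simps(5))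
  then show ?thesis unfolding zof_def using nz by (simp add: field_simps)
qed

lemma alg_auto_cluster:
  assumes cl: "cluster A X Y P Q"
  shows "cluster A (\<phi> X) (\<phi> Y) P Q"
proof -
  note S = cluster_subalg[OF cl]
  have "\<phi> ` A = galg (\<phi> X) (\<phi> Y) (\<phi> (zof X Y P Q))"
  proof -
    have "A = range (ev3 X Y (zof X Y P Q))" using cl by (simp add: cluster_def galg_def)
    then have "\<phi> ` A = range (\<lambda>F. \<phi> (ev3 X Y (zof X Y P Q) F))" by auto
    also have "\<dots> = galg (\<phi> X) (\<phi> Y) (\<phi> (zof X Y P Q))"
      unfolding galg_def by (intro arg_cong[of _ _ range] ext alg_auto_ev3 S)
    finally show ?thesis .
  qed
  then show ?thesis
    using cl alg_auto_indep[OF _ S(2,3)] alg_autoD(5)[OF auto] alg_auto_zof[OF cl]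
    unfolding cluster_def by metis
qed

end

text \<open>In a field the relation \<open>X * Y * Z = P(X) + Q(Y) - c\<close> forces the image of
  the third generator.\<close>

lemma alg_auto_determined:
  assumes cl: "cluster A X Y P Q" and auto: "alg_auto A \<phi>" "alg_auto A \<psi>"
    and eq: "\<phi> X = \<psi> X" "\<phi> Y = \<psi> Y" and f: "f \<in> A"
  shows "\<phi> f = \<psi> f"
proof -
  note S = cluster_subalg[OF cl]
  have Z: "\<phi> (zof X Y P Q) = \<psi> (zof X Y P Q)"
    by (simp add: alg_auto_zof[OF auto(1) S(1) cl] alg_auto_zof[OF auto(2) S(1) cl] eq)
  obtain F where "f = ev3 X Y (zof X Y P Q) F" using f cl by (auto simp: cluster_def galg_def)
  then show ?thesis
    using alg_auto_ev3[OF auto(1) S] alg_auto_ev3[OF auto(2) S] eq Z by simp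
qed

lemma alg_auto_comp:
  assumes "alg_auto A \<phi>" "alg_auto A \<psi>"
  shows "alg_auto A (\<phi> \<circ> \<psi>)"
proof -
  have "bij_betw (\<phi> \<circ> \<psi>) A A"
    using assms bij_betw_trans[of \<psi> A A \<phi> A] by (simp add: alg_auto_def)
  then show ?thesis
    unfolding alg_auto_def
    by (simp add: alg_autoD(1-4)[OF assms(1)] alg_autoD(1-4)[OF assms(2)])
qed

lemma alg_auto_degree_pos:
  assumes base: "cluster A tx ty p q" and auto: "alg_auto A \<phi>" and f: "f \<in> A" "0 < tdeg f"
  shows "0 < tdeg (\<phi> f)"
proof (rule ccontr)
  assume "\<not> 0 < tdeg (\<phi> f)"
  then obtain c where "\<phi> f = scal c"
    using base_small_degree[OF base alg_autoD(4)[OF auto f(1)]] by auto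
  then have "\<phi> f = \<phi> (scal c)" by (simp add: alg_autoD(1)[OF auto])
  then have "f = scal c"
    using alg_autoD(7)[OF auto f(1)] subalgD(1)[OF cluster_subalg(1)[OF base]] by blast
  then show False using f(2) by simp
qed

text \<open>An automorphism keeps the exchange relation \<open>X * u = Q(Y)\<close>. Images of
  nonconstant elements are nonconstant and so have positive degree, whence the cubic term of
  \<open>Q\<close> dominates.\<close>

lemma alg_auto_degree_rec:
  assumes base: "cluster A tx ty p q" and auto: "alg_auto A \<phi>"
  shows "0 < tdeg (\<phi> (yv p q n))"
    and "tdeg (\<phi> (yv p q (Suc (Suc n)))) = 3 * tdeg (\<phi> (yv p q (Suc n))) - tdeg (\<phi> (yv p q n))"
proof -
  have mem: "yv p q n \<in> A" "0 < tdeg (yv p q n)" for n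
    using yv_cluster[OF base, of n] cluster_subalg by blast+
  show pos: "0 < tdeg (\<phi> (yv p q n))" for n by (rule alg_auto_degree_pos[OF base auto mem])
  have sub: "subalg A" by (rule cluster_subalg[OF base])
  define X where "X = yv p q n"
  define Y where "Y = yv p q (Suc n)"
  define P where "P = pv p q n"
  define Q where "Q = pv p q (Suc n)"
  define u where "u = yv p q (Suc (Suc n))"
  have cl: "cluster A X Y P Q" using yv_cluster[OF base, of n] by (simp add: X_def Y_def P_def Q_def)
  note nz = cluster_nonzero[OF alg_auto_cluster[OF auto sub cl]]
  have XuA: "X \<in> A" "u \<in> A" "Y \<in> A" unfolding X_def u_def Y_def by (rule mem(1))+
  have "X * u = ev1 Y Q" using cluster_nonzero[OF cl] by (simp add: u_def X_def Y_def Q_def)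
  then have Xu: "\<phi> X * \<phi> u = ev1 (\<phi> Y) Q"
    using alg_autoD(3)[OF auto XuA(1,2)] alg_auto_ev1[OF auto sub XuA(3)] by metis
  have dQ: "degree Q = 3" "Q \<noteq> 0" using cl by (auto simp: cluster_def cubic_pair_def)
  have "lval (ev1 (\<phi> Y) Q) = lval (\<phi> Y ^ 3)"
    using lval_ev1[OF nz(2) _ dQ(2)] pos[of "Suc n"] dQ(1) by (simp add: Y_def)
  then have "tdeg (ev1 (\<phi> Y) Q) = 3 * tdeg (\<phi> Y)"
    using nz(2) by (simp add: lval_power prod_eq_iff fst_lval)
  moreover have "\<phi> u \<noteq> 0" using Xu nz by auto
  then have "tdeg (\<phi> X * \<phi> u) = tdeg (\<phi> X) + tdeg (\<phi> u)" using nz by (simp add: tdeg_mult)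
  ultimately have "tdeg (\<phi> u) = 3 * tdeg (\<phi> Y) - tdeg (\<phi> X)" using Xu by simp
  then show "tdeg (\<phi> (yv p q (Suc (Suc n)))) = 3 * tdeg (\<phi> (yv p q (Suc n))) - tdeg (\<phi> (yv p q n))"
    unfolding X_def Y_def u_def .
qed

definition balanced :: "int \<Rightarrow> int \<Rightarrow> bool" where
  "balanced a b \<longleftrightarrow> 2 * a \<le> 3 * b \<and> 2 * b \<le> 3 * a"

text \<open>
  Without a balanced neighbouring pair a positive solution of the recurrence is monotone
  throughout, so that shifting it by four in one of the two directions makes it smaller.
\<close>

lemma balanced_exists:
  fixes a b :: "nat \<Rightarrow> int"
  assumes pos: "\<And>n. 0 < a n" "\<And>n. 0 < b n"
    and rec: "\<And>n. a (Suc (Suc n)) = 3 * a (Suc n) - a n" "\<And>n. b (Suc (Suc n)) = 3 * b (Suc n) - b n"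
    and glue: "b 4 = a 0" "b 5 = a 1"
    and min: "a 0 + a 1 \<le> a 4 + a 5" "a 0 + a 1 \<le> b 0 + b 1"
  shows "\<exists>n\<le>4. balanced (a n) (a (Suc n)) \<or> balanced (b n) (b (Suc n))"
proof (rule ccontr)
  assume *: "\<not> ?thesis"
  have nb: "\<not> balanced (a n) (a (Suc n))" "\<not> balanced (b n) (b (Suc n))" if "n \<le> 4" for n
    using * that by auto
  show False
  proof (cases "a 0 < a 1")
    case True
    \<comment> \<open>The neighbours of \<open>b (Suc n)\<close> add up to three times it. The right
      one exceeds 3/2 of it, so the left one is less than 3/2 of it, and then smaller than it
      because that pair is not balanced either.\<close>
    have down: "b n < b (Suc n)" if "b (Suc n) < b (Suc (Suc n))" "n \<le> 3" for n
      using that nb(2)[of "Suc n"] nb(2)[of n] pos(2)[of n] pos(2)[of "Suc n"] rec(2)[of n]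
      unfolding balanced_def by linarith
    have "b 4 < b 5" using True glue by simp
    then have "b 3 < b 4" using down[of 3] by (simp add: eval_nat_numeral)
    then have "b 2 < b 3" using down[of 2] by (simp add: eval_nat_numeral)
    then have "b 1 < b 2" using down[of 1] by (simp add: eval_nat_numeral)
    then have "b 0 < b 1" using down[of 0] by (simp add: eval_nat_numeral)
    then show False
      using \<open>b 1 < b 2\<close> \<open>b 2 < b 3\<close> \<open>b 3 < b 4\<close> \<open>b 4 < b 5\<close> min(2) glue by linarith
  next
    case False
    have up: "a (Suc (Suc n)) \<le> a (Suc n)" if "a (Suc n) \<le> a n" "n \<le> 3" for n
      using that nb(1)[of "Suc n"] nb(1)[of n] pos(1)[of n] pos(1)[of "Suc n"] rec(1)[of n]
      unfolding balanced_def by linarith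
    have 1: "a 1 \<le> a 0" using False by simp
    then have 2: "a 2 \<le> a 1" using up[of 0] by (simp add: eval_nat_numeral)
    then have 3: "a 3 \<le> a 2" using up[of 1] by (simp add: eval_nat_numeral)
    then have 4: "a 4 \<le> a 3" using up[of 2] by (simp add: eval_nat_numeral)
    then have 5: "a 5 \<le> a 4" using up[of 3] by (simp add: eval_nat_numeral)
    \<comment> \<open>So far equality is possible; the first pair, not being balanced, makes the sum
      drop strictly.\<close>
    have "2 * a 0 > 3 * a 1" using nb(1)[of 0] 1 pos(1)[of 0] by (simp add: balanced_def)
    then show False using 1 2 3 4 5 min(1) pos(1)[of 0] pos(1)[of 1] by linarith
  qed
qed

section \<open>The automorphism group\<close>

text \<open>Every left coset of the cyclic subgroup meets \<open>T\<close>, so the inverses of the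
  elements of \<open>T\<close> represent all right cosets.\<close>

lemma (in group) cyclic_finite_index:
  assumes s: "s \<in> carrier G" and inf: "\<And>n::nat. 0 < n \<Longrightarrow> s [^] n \<noteq> \<one>"
    and fin: "finite T" and cover: "\<And>f. f \<in> carrier G \<Longrightarrow> \<exists>k::int. f \<otimes> s [^] k \<in> T"
  shows "\<exists>H. subgroup H G \<and> finite (rcosets H) \<and> G\<lparr>carrier := H\<rparr> \<cong> integer_group"
proof -
  define H where "H = range (\<lambda>k::int. s [^] k)"
  have sub: "subgroup H G"
  proof (rule subgroupI)
    show "H \<subseteq> carrier G" "H \<noteq> {}" using s by (auto simp: H_def)
    show "inv a \<in> H" if "a \<in> H" for a
      using that s unfolding H_def by (auto simp: int_pow_neg[symmetric])
    show "a \<otimes> b \<in> H" if "a \<in> H" "b \<in> H" for a b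
      using that s unfolding H_def by (auto simp: int_pow_mult[symmetric])
  qed
  have "rcosets H \<subseteq> (\<lambda>t. H #> inv t) ` T"
  proof
    fix C assume "C \<in> rcosets H"
    then obtain a where a: "a \<in> carrier G" "C = H #> a" by (auto simp: RCOSETS_def)
    obtain k :: int where k: "inv a \<otimes> s [^] k \<in> T" using cover[of "inv a"] a by auto
    have "inv (inv a \<otimes> s [^] k) = s [^] (- k) \<otimes> a"
      using a s by (simp add: inv_mult_group int_pow_neg)
    moreover have "H #> (s [^] (- k) \<otimes> a) = H #> s [^] (- k) #> a"
      using a s subgroup.subset[OF sub] by (simp add: coset_mult_assoc)
    moreover have "H #> s [^] (- k) = H"
      using s by (intro coset_join2 sub) (auto simp: H_def)
    ultimately have "C = H #> inv (inv a \<otimes> s [^] k)" using a(2) by simp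
    then show "C \<in> (\<lambda>t. H #> inv t) ` T" using k by blast
  qed
  then have "finite (rcosets H)" using fin by (meson finite_imageI finite_subset)
  moreover have "(\<lambda>k::int. s [^] k) \<in> iso integer_group (G\<lparr>carrier := H\<rparr>)"
  proof (rule isoI)
    show "(\<lambda>k::int. s [^] k) \<in> hom integer_group (G\<lparr>carrier := H\<rparr>)"
      by (rule homI) (auto simp: H_def int_pow_mult s)
    have "inj (\<lambda>k::int. s [^] k)"
    proof (rule injI)
      fix i j :: int assume ij: "s [^] i = s [^] j"
      have *: "a \<le> b" if "s [^] a = s [^] b" for a b :: int
      proof (rule ccontr)
        assume ab: "\<not> a \<le> b"
        have "s [^] (a - b) = s [^] b \<otimes> inv (s [^] b)" unfolding that[symmetric] int_pow_diff[OF s] ..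
        also have "\<dots> = \<one>" using s by (intro r_inv int_pow_closed)
        finally have "s [^] int (nat (a - b)) = \<one>" using ab by simp
        then have "s [^] nat (a - b) = \<one>" by (simp only: int_pow_int)
        then show False using inf[of "nat (a - b)"] ab by simp
      qed
      show "i = j" using *[OF ij] *[OF ij[symmetric]] by simp
    qed
    then show "bij_betw (\<lambda>k::int. s [^] k) (carrier integer_group) (carrier (G\<lparr>carrier := H\<rparr>))"
      by (simp add: bij_betw_def H_def)
  qed
  then have "integer_group \<cong> G\<lparr>carrier := H\<rparr>" by (rule is_isoI)
  then have "G\<lparr>carrier := H\<rparr> \<cong> integer_group" by (rule group.iso_sym[OF group_integer_group])
  ultimately show ?thesis using sub by blast
qed

lemma alg_auto_inverse:
  assumes auto: "alg_auto A \<phi>" and sub: "subalg A"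
    and inv: "\<And>f. f \<in> A \<Longrightarrow> \<psi> f \<in> A" "\<And>f. f \<in> A \<Longrightarrow> \<phi> (\<psi> f) = f"
  shows "alg_auto A \<psi>"
proof -
  note D = alg_autoD[OF auto] and S = subalgD[OF sub]
  have l: "\<psi> (\<phi> f) = f" if "f \<in> A" for f
    using D(7)[of "\<psi> (\<phi> f)" f] inv D(4) that by blast
  show ?thesis
    unfolding alg_auto_def
  proof (intro conjI allI ballI)
    show "\<psi> (scal c) = scal c" for c using l[OF S(1), of c] by (simp add: D(1))
    show "\<psi> (f + h) = \<psi> f + \<psi> h" if "f \<in> A" "h \<in> A" for f h
      using l[OF S(2)[OF inv(1)[OF that(1)] inv(1)[OF that(2)]]] D(2)[OF inv(1) inv(1)] inv(2) that by simp
    show "\<psi> (f * h) = \<psi> f * \<psi> h" if "f \<in> A" "h \<in> A" for f h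
      using l[OF S(3)[OF inv(1)[OF that(1)] inv(1)[OF that(2)]]] D(3)[OF inv(1) inv(1)] inv(2) that by simp
    show "bij_betw \<psi> A A"
      by (rule bij_betw_byWitness[of A \<phi>]) (use inv l D(4) in auto)
  qed
qed

lemma alg_auto_cong:
  assumes "alg_auto A \<phi>" "subalg A" "\<And>f. f \<in> A \<Longrightarrow> \<psi> f = \<phi> f"
  shows "alg_auto A \<psi>"
  using assms bij_betw_cong[of A \<psi> \<phi> A] by (auto simp: alg_auto_def subalgD(1-3))

text \<open>Both triples satisfy the same equation, so by \<open>ev3_kernel\<close> the two
  evaluations have the same kernel, and both have image \<open>A\<close>.\<close>

lemma exists_alg_auto:
  fixes g :: "'k::field poly poly"
  assumes ind: "indep X Y" "indep X' Y'" and rel: "X * Y * Z = ev2 X Y g" "X' * Y' * Z' = ev2 X' Y' g"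
    and g: "coeff g 0 \<noteq> 0" "\<exists>j. coeff (coeff g j) 0 \<noteq> 0"
    and A: "A = galg X Y Z" "A = galg X' Y' Z'"
  shows "\<exists>\<phi>. alg_auto A \<phi> \<and> \<phi> X = X' \<and> \<phi> Y = Y'"
proof -
  define \<phi> where "\<phi> f = ev3 X' Y' Z' (SOME F. ev3 X Y Z F = f)" for f
  have ker: "ev3 X Y Z F = ev3 X Y Z F' \<longleftrightarrow> ev3 X' Y' Z' F = ev3 X' Y' Z' F'" for F F'
    using ev3_kernel[OF ind(1) rel(1) g, of "F - F'"] ev3_kernel[OF ind(2) rel(2) g, of "F - F'"]
    by simp
  have \<phi>: "\<phi> (ev3 X Y Z F) = ev3 X' Y' Z' F" for F
  proof -
    have "ev3 X Y Z (SOME F'. ev3 X Y Z F' = ev3 X Y Z F) = ev3 X Y Z F" by (rule someI) (rule refl)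
    then show ?thesis unfolding \<phi>_def by (simp only: ker)
  qed
  have AE: "\<exists>F. f = ev3 X Y Z F" if "f \<in> A" for f using that A(1) by (auto simp: galg_def)
  have "alg_auto A \<phi>"
    unfolding alg_auto_def
  proof (intro conjI allI ballI)
    show "\<phi> (scal c) = scal c" for c using \<phi>[of "[:[:[:c:]:]:]"] by (simp only: ev3_var)
    show "\<phi> (f + h) = \<phi> f + \<phi> h" "\<phi> (f * h) = \<phi> f * \<phi> h" if fh: "f \<in> A" "h \<in> A" for f h
    proof -
      obtain F H where FH: "f = ev3 X Y Z F" "h = ev3 X Y Z H" using AE fh by blast
      show "\<phi> (f + h) = \<phi> f + \<phi> h" using \<phi>[of "F + H"] by (simp add: FH \<phi>)
      show "\<phi> (f * h) = \<phi> f * \<phi> h" using \<phi>[of "F * H"] by (simp add: FH \<phi>)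
    qed
    have "inj_on \<phi> A"
    proof (rule inj_onI)
      fix f h assume fh: "f \<in> A" "h \<in> A" "\<phi> f = \<phi> h"
      obtain F H where FH: "f = ev3 X Y Z F" "h = ev3 X Y Z H" using AE fh by blast
      show "f = h" using fh(3) unfolding FH \<phi> ker .
    qed
    moreover have "\<phi> ` A = A"
    proof -
      have "\<phi> ` A = range (\<lambda>F. \<phi> (ev3 X Y Z F))" using A(1) by (auto simp: galg_def)
      also have "\<dots> = A" using A(2) by (simp add: \<phi> galg_def)
      finally show ?thesis .
    qed
    ultimately show "bij_betw \<phi> A A" by (simp add: bij_betw_def)
  qed
  moreover have "\<phi> X = X'" "\<phi> Y = Y'"
    using \<phi>[of "[:[:[:0, 1:]:]:]"] \<phi>[of "[:[:0, 1:]:]"] by (simp_all only: ev3_var)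
  ultimately show ?thesis by blast
qed

section \<open>The coordinate ring and its automorphisms inside the field\<close>

locale cubic_surface =
  fixes g :: "'k::field poly poly"
  assumes degree: "degree_xy g = 3" and coeff_30: "coeff_xy g 3 0 \<noteq> 0"
    and coeff_03: "coeff_xy g 0 3 \<noteq> 0" and coeff_00: "coeff_xy g 0 0 \<noteq> 0"
begin

abbreviation "p \<equiv> row0 g"
abbreviation "q \<equiv> col0 g"
abbreviation "G \<equiv> surface_Aut g"

definition zz :: "'k fls fls" where
  "zz = ev2 tx ty g / (tx * ty)"

definition A :: "'k fls fls set" where
  "A = galg tx ty zz"

lemma pq: "cubic_pair p q"
  by (rule cubic_pair_row0_col0[OF degree coeff_30 coeff_03 coeff_00])

lemma base: "cluster A tx ty p q"
  unfolding cluster_def A_def zz_def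
  using indep_tx_ty pq galg_mixed[OF degree] by simp

lemma sub: "subalg A"
  by (rule cluster_subalg[OF base])

lemma g_nonzero: "coeff g 0 \<noteq> 0" "\<exists>j. coeff (coeff g j) 0 \<noteq> 0"
  using coeff_00 by (auto simp: coeff_xy_def)

lemma relation: "tx * ty * zz = ev2 tx ty g"
  by (simp add: zz_def)

abbreviation target :: "'k fls fls ring" where
  "target \<equiv> ring_of_type_algebra"

text \<open>The common value of the evaluation on a coset, in the shape of the isomorphism theorem
  \<open>FactRing_iso_set_aux\<close>.\<close>

definition coord :: "'k poly poly poly set \<Rightarrow> 'k fls fls" where
  "coord C = the_elem (ev3 tx ty zz ` C)"

lemma ring_hom_ev3: "ring_hom_ring (ring_xyz :: 'k poly poly poly ring) target (ev3 tx ty zz)"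
proof (rule ring_hom_ringI2)
  show "ring (ring_xyz :: 'k poly poly poly ring)" "ring target"
    by (rule ring_from_type_algebra)+
  show "ev3 tx ty zz \<in> ring_hom ring_xyz target"
    by (rule ring_hom_memI) (simp_all add: ring_of_type_algebra_def)
qed

lemma kernel: "a_kernel ring_xyz target (ev3 tx ty zz) = surface_ideal g"
proof -
  define W where "W = var_x * var_y * var_z - [:g:]"
  have "surface_ideal g = cgenideal ring_xyz W"
    unfolding surface_ideal_def W_def
    by (rule cring.cgenideal_eq_genideal[symmetric, OF cring_from_type_algebra])
       (simp add: ring_of_type_algebra_def)
  also have "\<dots> = {F. W dvd F}"
    by (auto simp: cgenideal_def ring_of_type_algebra_def mult.commute elim!: dvdE)
  also have "\<dots> = {F. ev3 tx ty zz F = 0}"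
    using ev3_kernel[OF indep_tx_ty relation g_nonzero] by (simp add: W_def)
  also have "\<dots> = a_kernel ring_xyz target (ev3 tx ty zz)"
    by (simp add: a_kernel_def' ring_of_type_algebra_def)
  finally show ?thesis ..
qed

lemma coord_iso: "coord \<in> ring_iso (surface_ring g) (target\<lparr>carrier := A\<rparr>)"
  using ring_hom_ring.FactRing_iso_set_aux[OF ring_hom_ev3]
  unfolding kernel surface_ring_def coord_def[abs_def]
  by (simp add: ring_of_type_algebra_def A_def galg_def)

abbreviation "S \<equiv> carrier (surface_ring g)"

lemma coord_bij: "bij_betw coord S A"
  using coord_iso by (simp add: ring_iso_def)

lemma coord_in: "a \<in> S \<Longrightarrow> coord a \<in> A"
  using coord_bij by (rule bij_betwE[rule_format])

lemma coord_inj: "a \<in> S \<Longrightarrow> b \<in> S \<Longrightarrow> coord a = coord b \<longleftrightarrow> a = b"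
  using coord_bij by (auto simp: bij_betw_def inj_on_def)

lemma coord_hom:
  assumes "a \<in> S" "b \<in> S"
  shows "coord (a \<oplus>\<^bsub>surface_ring g\<^esub> b) = coord a + coord b"
    "coord (a \<otimes>\<^bsub>surface_ring g\<^esub> b) = coord a * coord b"
  using ring_iso_memE(2,3)[OF coord_iso assms] by (simp_all add: ring_of_type_algebra_def)

lemma ring_surface: "ring (surface_ring g)"
  unfolding surface_ring_def kernel[symmetric]
  by (intro ideal.quotient_is_ring ring_hom_ring.kernel_is_ideal[OF ring_hom_ev3])

lemma surface_const_eq: "surface_const g c \<in> S" "coord (surface_const g c) = scal c"
proof -
  interpret h: ring_hom_ring "ring_xyz :: 'k poly poly poly ring" target "ev3 tx ty zz"
    by (rule ring_hom_ev3)
  have c: "[:[:[:c:]:]:] \<in> carrier (ring_xyz :: 'k poly poly poly ring)"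
    by (simp add: ring_of_type_algebra_def)
  show "surface_const g c \<in> S"
    unfolding surface_const_def surface_ring_def kernel[symmetric] FactRing_def A_RCOSETS_def'
    using c by auto
  show "coord (surface_const g c) = scal c"
    unfolding surface_const_def coord_def kernel[symmetric] h.the_elem_simp[OF c]
    by (rule ev3_var)
qed

definition act :: "('k poly poly poly set \<Rightarrow> 'k poly poly poly set) \<Rightarrow> 'k fls fls \<Rightarrow> 'k fls fls" where
  "act F f = coord (F (inv_into S coord f))"

lemma inv_coord: "f \<in> A \<Longrightarrow> inv_into S coord f \<in> S" "f \<in> A \<Longrightarrow> coord (inv_into S coord f) = f"
  "a \<in> S \<Longrightarrow> inv_into S coord (coord a) = a"
  using coord_bij by (auto simp: bij_betw_def inv_into_into f_inv_into_f)

lemma act_coord: "a \<in> S \<Longrightarrow> act F (coord a) = coord (F a)"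
  by (simp add: act_def inv_coord)

lemma A_coordE: "f \<in> A \<Longrightarrow> \<exists>a\<in>S. f = coord a"
  using inv_coord by metis

text \<open>Transport of structure along \<open>coord\<close>. Preservation of one, required by
  \<open>ring_hom\<close> but absent from \<open>alg_auto\<close>, is the case of the constant
  1.\<close>

lemma surface_auts_iff:
  assumes F: "F \<in> Bij S"
  shows "F \<in> surface_auts g \<longleftrightarrow> alg_auto A (act F)"
proof -
  interpret R: ring "surface_ring g" by (rule ring_surface)
  have FS: "F a \<in> S" if "a \<in> S" for a using F that Bij_imp_funcset by blast
  have bij: "bij_betw (act F) A A"
  proof -
    have "bij_betw (coord \<circ> (F \<circ> inv_into S coord)) A A"
      using F by (intro bij_betw_trans[OF bij_betw_trans[OF bij_betw_inv_into[OF coord_bij]] coord_bij])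
        (simp add: Bij_def)
    then show ?thesis by (simp add: act_def[abs_def] comp_def)
  qed
  show ?thesis
  proof
    assume aut: "F \<in> surface_auts g"
    then have hom: "F \<in> ring_hom (surface_ring g) (surface_ring g)" by (simp add: surface_auts_def)
    show "alg_auto A (act F)"
      unfolding alg_auto_def
    proof (intro conjI allI ballI bij)
      show "act F (scal c) = scal c" for c
        using aut act_coord[OF surface_const_eq(1), of F c] by (simp add: surface_auts_def surface_const_eq)
      show "act F (f + h) = act F f + act F h" "act F (f * h) = act F f * act F h"
        if fh: "f \<in> A" "h \<in> A" for f h
      proof -
        obtain a b where ab: "a \<in> S" "b \<in> S" "f = coord a" "h = coord b" using A_coordE fh by metis
        show "act F (f + h) = act F f + act F h"
          using act_coord[OF R.add.m_closed[OF ab(1,2)], of F]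
          by (simp add: ab coord_hom act_coord ring_hom_add[OF hom] FS)
        show "act F (f * h) = act F f * act F h"
          using act_coord[OF R.m_closed[OF ab(1,2)], of F]
          by (simp add: ab coord_hom act_coord ring_hom_mult[OF hom] FS)
      qed
    qed
  next
    assume auto: "alg_auto A (act F)"
    have const: "F (surface_const g c) = surface_const g c" for c
    proof -
      have "coord (F (surface_const g c)) = coord (surface_const g c)"
        using alg_autoD(1)[OF auto, of c] act_coord[OF surface_const_eq(1), of F c]
        by (simp add: surface_const_eq)
      then show ?thesis using coord_inj FS surface_const_eq(1) by blast
    qed
    have one: "\<one>\<^bsub>surface_ring g\<^esub> = surface_const g 1"
    proof -
      have "coord \<one>\<^bsub>surface_ring g\<^esub> = coord (surface_const g 1)"
        using ring_iso_memE(4)[OF coord_iso] by (simp add: surface_const_eq ring_of_type_algebra_def)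
      then show ?thesis using coord_inj surface_const_eq(1) R.one_closed by blast
    qed
    have "F \<in> ring_hom (surface_ring g) (surface_ring g)"
    proof (rule ring_hom_memI)
      show "F \<one>\<^bsub>surface_ring g\<^esub> = \<one>\<^bsub>surface_ring g\<^esub>" unfolding one by (rule const)
      fix a b assume ab: "a \<in> S" "b \<in> S"
      have "coord (F (a \<otimes>\<^bsub>surface_ring g\<^esub> b)) = coord (F a \<otimes>\<^bsub>surface_ring g\<^esub> F b)"
        using ab alg_autoD(3)[OF auto coord_in coord_in] act_coord[OF R.m_closed[OF ab], of F]
        by (simp add: coord_hom act_coord FS)
      then show "F (a \<otimes>\<^bsub>surface_ring g\<^esub> b) = F a \<otimes>\<^bsub>surface_ring g\<^esub> F b"
        using ab coord_inj FS R.m_closed by metis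
      have "coord (F (a \<oplus>\<^bsub>surface_ring g\<^esub> b)) = coord (F a \<oplus>\<^bsub>surface_ring g\<^esub> F b)"
        using ab alg_autoD(2)[OF auto coord_in coord_in] act_coord[OF R.add.m_closed[OF ab], of F]
        by (simp add: coord_hom act_coord FS)
      then show "F (a \<oplus>\<^bsub>surface_ring g\<^esub> b) = F a \<oplus>\<^bsub>surface_ring g\<^esub> F b"
        using ab coord_inj FS R.add.m_closed by metis
    qed (rule FS)
    then show "F \<in> surface_auts g" using F const by (simp add: surface_auts_def)
  qed
qed

lemma surface_auts_Bij: "F \<in> surface_auts g \<Longrightarrow> F \<in> Bij S"
  by (simp add: surface_auts_def)

lemma act_compose:
  assumes "F' \<in> Bij S" "f \<in> A"
  shows "act (compose S F F') f = act F (act F' f)"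
proof -
  obtain a where a: "a \<in> S" "f = coord a" using A_coordE assms by blast
  then have "F' a \<in> S" using assms(1) Bij_imp_funcset by blast
  then show ?thesis using a by (simp add: act_coord compose_eq)
qed

lemma act_in: "F \<in> Bij S \<Longrightarrow> f \<in> A \<Longrightarrow> act F f \<in> A"
  unfolding act_def using coord_in inv_coord(1) Bij_imp_funcset by blast

lemma act_id: "f \<in> A \<Longrightarrow> act (\<lambda>x\<in>S. x) f = f"
  by (simp add: act_def inv_coord)

lemma subgroup_surface_auts: "subgroup (surface_auts g) (BijGroup S)"
proof (rule subgroup.intro)
  show "surface_auts g \<subseteq> carrier (BijGroup S)" by (auto simp: BijGroup_def surface_auts_Bij)
  show "F \<otimes>\<^bsub>BijGroup S\<^esub> F' \<in> surface_auts g" if "F \<in> surface_auts g" "F' \<in> surface_auts g" for F F'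
  proof -
    note B = surface_auts_Bij[OF that(1)] surface_auts_Bij[OF that(2)]
    have "alg_auto A (act F \<circ> act F')"
      using that surface_auts_iff B by (intro alg_auto_comp) auto
    then have "alg_auto A (act (compose S F F'))"
      by (rule alg_auto_cong[OF _ sub]) (simp add: act_compose B)
    then show ?thesis using surface_auts_iff[OF compose_Bij[OF B]] B by (simp add: BijGroup_def)
  qed
  show "\<one>\<^bsub>BijGroup S\<^esub> \<in> surface_auts g"
  proof -
    have "alg_auto A (act (\<lambda>x\<in>S. x))"
      by (rule alg_auto_cong[of A id, OF _ sub]) (auto simp: alg_auto_def act_id)
    then show ?thesis using surface_auts_iff[OF id_Bij] by (simp add: BijGroup_def)
  qed
  show "inv\<^bsub>BijGroup S\<^esub> F \<in> surface_auts g" if "F \<in> surface_auts g" for F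
  proof -
    note B = surface_auts_Bij[OF that]
    interpret B: group "BijGroup S" by (rule group_BijGroup)
    define F' where "F' = inv\<^bsub>BijGroup S\<^esub> F"
    have F': "F' \<in> Bij S" using B B.inv_closed[of F] by (simp add: F'_def BijGroup_def)
    have "F \<otimes>\<^bsub>BijGroup S\<^esub> F' = \<one>\<^bsub>BijGroup S\<^esub>" unfolding F'_def
      by (rule B.r_inv) (simp add: BijGroup_def B)
    then have "compose S F F' = (\<lambda>x\<in>S. x)" using B F' by (simp add: BijGroup_def)
    then have inv: "act F (act F' f) = f" if "f \<in> A" for f
      using act_compose[OF F' that, of F] act_id[OF that] by simp
    have "alg_auto A (act F)" using surface_auts_iff[OF B] that by blast
    then have "alg_auto A (act F')" by (rule alg_auto_inverse[OF _ sub act_in[OF F'] inv])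
    then show ?thesis using surface_auts_iff[OF F'] by (simp add: F'_def)
  qed
qed

sublocale G: group G
  unfolding surface_Aut_def
  by (rule subgroup.subgroup_is_group[OF subgroup_surface_auts group_BijGroup])

lemma carrier_G: "carrier G = surface_auts g"
  by (simp add: surface_Aut_def)

lemma act_auto: "F \<in> carrier G \<Longrightarrow> alg_auto A (act F)"
  using surface_auts_iff[OF surface_auts_Bij] by (simp add: carrier_G)

lemma act_mult:
  assumes "F \<in> carrier G" "F' \<in> carrier G" "f \<in> A"
  shows "act (F \<otimes>\<^bsub>G\<^esub> F') f = act F (act F' f)"
proof -
  have "F \<in> Bij S" "F' \<in> Bij S" using assms(1,2) surface_auts_Bij by (simp_all add: carrier_G)
  then show ?thesis using act_compose[of F' f F] assms(3) by (simp add: surface_Aut_def BijGroup_def)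
qed

lemma act_one: "f \<in> A \<Longrightarrow> act \<one>\<^bsub>G\<^esub> f = f"
  by (simp add: surface_Aut_def BijGroup_def act_id)

lemma act_eqI:
  assumes "F \<in> carrier G" "F' \<in> carrier G" "\<And>f. f \<in> A \<Longrightarrow> act F f = act F' f"
  shows "F = F'"
proof (rule extensionalityI[of _ S])
  show "F \<in> extensional S" "F' \<in> extensional S"
    using assms surface_auts_Bij Bij_imp_extensional by (auto simp: carrier_G)
  fix a assume a: "a \<in> S"
  have "F \<in> Bij S" "F' \<in> Bij S" using assms(1,2) surface_auts_Bij by (simp_all add: carrier_G)
  then have "F a \<in> S" "F' a \<in> S" using a Bij_imp_funcset by blast+
  then show "F a = F' a" using assms(3)[OF coord_in[OF a]] a coord_inj by (simp add: act_coord)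
qed

lemma act_surj:
  assumes auto: "alg_auto A \<phi>"
  shows "\<exists>F\<in>carrier G. \<forall>f\<in>A. act F f = \<phi> f"
proof -
  define F where "F = restrict (inv_into S coord \<circ> (\<phi> \<circ> coord)) S"
  have F: "F \<in> Bij S"
  proof -
    have "bij_betw (inv_into S coord \<circ> (\<phi> \<circ> coord)) S S"
      using auto by (intro bij_betw_trans[OF bij_betw_trans[OF coord_bij] bij_betw_inv_into[OF coord_bij]])
        (simp add: alg_auto_def)
    then show ?thesis unfolding F_def Bij_def by (simp add: bij_betw_restrict_eq)
  qed
  have act: "act F f = \<phi> f" if f: "f \<in> A" for f
  proof -
    obtain a where "a \<in> S" "f = coord a" using A_coordE f by blast
    then show ?thesis
      using alg_autoD(4)[OF auto f] by (simp add: act_coord F_def inv_coord(2))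
  qed
  then have "alg_auto A (act F)" by (intro alg_auto_cong[OF auto sub])
  then have "F \<in> carrier G" using surface_auts_iff[OF F] by (simp add: carrier_G)
  then show ?thesis using act by blast
qed

abbreviation "y \<equiv> yv p q"

lemma y_mem: "y n \<in> A" "cluster A (y n) (y (Suc n)) (pv p q n) (pv p q (Suc n))"
  using yv_cluster[OF base, of n] cluster_subalg(2) by blast+

text \<open>After four mutations the exchange polynomials are \<open>p\<close>, \<open>q\<close>
  again. By \<open>galg_mixed\<close> the pair \<open>y 4\<close>, \<open>y 5\<close> then satisfies
  the original equation with a suitable third generator.\<close>

lemma shift_exists: "\<exists>s\<in>carrier G. act s (y 0) = y 4 \<and> act s (y 1) = y 5"
proof -
  have cl: "cluster A (y 4) (y 5) p q"
    using y_mem(2)[of 4] pv_period[OF pq] by (simp add: eval_nat_numeral)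
  note nz = cluster_nonzero(1,2)[OF cl]
  have gen: "A = galg (y 4) (y 5) (ev2 (y 4) (y 5) g / (y 4 * y 5))"
    using cl galg_mixed[OF degree nz] by (simp add: cluster_def)
  have rel: "y 4 * y 5 * (ev2 (y 4) (y 5) g / (y 4 * y 5)) = ev2 (y 4) (y 5) g" using nz by simp
  have ind: "indep (y 4) (y 5)" using cl by (simp add: cluster_def)
  obtain \<phi> where \<phi>: "alg_auto A \<phi>" "\<phi> tx = y 4" "\<phi> ty = y 5"
    using exists_alg_auto[OF indep_tx_ty ind relation rel g_nonzero A_def gen] by blast
  then obtain s where "s \<in> carrier G" "\<forall>f\<in>A. act s f = \<phi> f" using act_surj by blast
  then show ?thesis using \<phi> y_mem(1)[of 0] y_mem(1)[of 1] by (intro bexI[of _ s]) auto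
qed

text \<open>An automorphism is determined by the image of one cluster, and the balanced images form
  a finite set.\<close>

lemma finite_balanced_auts:
  "finite {F \<in> carrier G. \<exists>n\<le>4. balanced (tdeg (act F (y n))) (tdeg (act F (y (Suc n))))}"
proof -
  have "finite {F \<in> carrier G. balanced (tdeg (act F (y n))) (tdeg (act F (y (Suc n))))}" (is "finite ?T") for n
  proof -
    define C where "C = {(X, Y). cluster A X Y (pv p q n) (pv p q (Suc n)) \<and> 0 < tdeg X \<and> 0 < tdeg Y \<and>
           2 * tdeg X \<le> 3 * tdeg Y \<and> 2 * tdeg Y \<le> 3 * tdeg X}"
    define h where "h F = (act F (y n), act F (y (Suc n)))" for F
    have "coeff p 0 = coeff q 0" using pq by (simp add: cubic_pair_def)
    then have "finite C" unfolding C_def by (intro finite_balanced_clusters[OF base] coeff_pv_0)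
    moreover have "inj_on h (carrier G)"
    proof (rule inj_onI)
      fix F F' assume *: "F \<in> carrier G" "F' \<in> carrier G" "h F = h F'"
      show "F = F'"
        by (rule act_eqI[OF *(1,2)], rule alg_auto_determined[OF y_mem(2) act_auto[OF *(1)] act_auto[OF *(2)]])
           (use *(3) in \<open>auto simp: h_def\<close>)
    qed
    ultimately have "finite (h -` C \<inter> carrier G)" by (rule finite_vimage_IntI)
    moreover have "?T \<subseteq> h -` C \<inter> carrier G"
      using alg_auto_cluster[OF act_auto sub y_mem(2)] alg_auto_degree_rec(1)[OF base act_auto]
      by (auto simp: h_def C_def balanced_def)
    ultimately show ?thesis by (rule finite_subset[rotated])
  qed
  then have "finite (\<Union>n\<le>4. {F \<in> carrier G. balanced (tdeg (act F (y n))) (tdeg (act F (y (Suc n))))})"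
    by blast
  then show ?thesis by (rule finite_subset[rotated]) blast
qed

text \<open>Once \<open>a 0 \<le> a 1\<close>, the recurrence grows strictly from \<open>a 1\<close>
  on, so each further factor \<open>s\<close> raises the degree of the image of \<open>y 0\<close>,
  which starts at 1.\<close>

lemma shift_infinite_order:
  assumes s: "s \<in> carrier G" "act s (y 0) = y 4" "act s (y 1) = y 5" and n: "0 < n"
  shows "s [^]\<^bsub>G\<^esub> (n::nat) \<noteq> \<one>\<^bsub>G\<^esub>"
proof -
  have "int n < tdeg (act (s [^]\<^bsub>G\<^esub> n) (y 0)) \<and>
      tdeg (act (s [^]\<^bsub>G\<^esub> n) (y 0)) \<le> tdeg (act (s [^]\<^bsub>G\<^esub> n) (y 1))" for n
  proof (induction n)
    case 0
    then show ?case using act_one[OF y_mem(1)[of 0]] act_one[OF y_mem(1)[of 1]] by simp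
  next
    case (Suc n)
    define F where "F = s [^]\<^bsub>G\<^esub> n"
    have F: "F \<in> carrier G" using s by (simp add: F_def)
    define a where "a i = tdeg (act F (y i))" for i
    have rec: "a (Suc (Suc i)) = 3 * a (Suc i) - a i" for i
      unfolding a_def by (rule alg_auto_degree_rec(2)[OF base act_auto[OF F]])
    have "act (s [^]\<^bsub>G\<^esub> Suc n) (y 0) = act F (y 4)" "act (s [^]\<^bsub>G\<^esub> Suc n) (y 1) = act F (y 5)"
      using act_mult[OF F s(1) y_mem(1)[of 0]] act_mult[OF F s(1) y_mem(1)[of 1]] s
      by (simp_all add: F_def)
    moreover have "int n < a 0" "a 0 \<le> a 1" using Suc by (simp_all add: a_def F_def)
    then have "int (Suc n) < a 4" "a 4 \<le> a 5"
      using rec[of 0] rec[of 1] rec[of 2] rec[of 3] by (simp_all add: eval_nat_numeral)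
    ultimately show ?case by (simp add: a_def)
  qed
  then have "int n < tdeg (act (s [^]\<^bsub>G\<^esub> n) (y 0))" by blast
  then have "tdeg (act (s [^]\<^bsub>G\<^esub> n) (y 0)) \<noteq> 1" using n by linarith
  then show ?thesis using act_one[OF y_mem(1)[of 0]] by auto
qed

text \<open>Choose \<open>k\<close> with \<open>a k 0 + a k 1\<close> minimal. As \<open>y n\<close>
  exists only for natural \<open>n\<close>, the terms to its left are read off at
  \<open>k - 1\<close>, and \<open>balanced_exists\<close> finds a pair in one of the two
  windows.\<close>

lemma shift_reduces:
  assumes s: "s \<in> carrier G" "act s (y 0) = y 4" "act s (y 1) = y 5" and F: "F \<in> carrier G"
  shows "\<exists>k::int. \<exists>n\<le>4. balanced (tdeg (act (F \<otimes>\<^bsub>G\<^esub> s [^]\<^bsub>G\<^esub> k) (y n))) (tdeg (act (F \<otimes>\<^bsub>G\<^esub> s [^]\<^bsub>G\<^esub> k) (y (Suc n))))"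
proof -
  define a where "a k n = tdeg (act (F \<otimes>\<^bsub>G\<^esub> s [^]\<^bsub>G\<^esub> k) (y n))" for k :: int and n
  have mem: "F \<otimes>\<^bsub>G\<^esub> s [^]\<^bsub>G\<^esub> k \<in> carrier G" for k :: int using s F by simp
  have pos: "0 < a k n" for k n
    unfolding a_def by (rule alg_auto_degree_rec(1)[OF base act_auto[OF mem]])
  have rec: "a k (Suc (Suc n)) = 3 * a k (Suc n) - a k n" for k n
    unfolding a_def by (rule alg_auto_degree_rec(2)[OF base act_auto[OF mem]])
  have shift: "a (k + 1) 0 = a k 4" "a (k + 1) 1 = a k 5" for k
  proof -
    have "F \<otimes>\<^bsub>G\<^esub> s [^]\<^bsub>G\<^esub> (k + 1) = (F \<otimes>\<^bsub>G\<^esub> s [^]\<^bsub>G\<^esub> k) \<otimes>\<^bsub>G\<^esub> s"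
      using s F by (simp add: G.int_pow_mult G.m_assoc)
    then show "a (k + 1) 0 = a k 4" "a (k + 1) 1 = a k 5"
      unfolding a_def
      using act_mult[OF mem s(1) y_mem(1)[of 0], of k] act_mult[OF mem s(1) y_mem(1)[of 1], of k] s
      by simp_all
  qed
  obtain k where k: "\<And>k'. nat (a k 0 + a k 1) \<le> nat (a k' 0 + a k' 1)"
    using ex_has_least_nat[of "\<lambda>_. True" 0 "\<lambda>k. nat (a k 0 + a k 1)"] by auto
  have k': "a k 0 + a k 1 \<le> a k' 0 + a k' 1" for k'
    using k[of k'] pos[of k' 0] pos[of k' 1] by linarith
  have "\<exists>n\<le>4. balanced (a k n) (a k (Suc n)) \<or> balanced (a (k - 1) n) (a (k - 1) (Suc n))"
    by (rule balanced_exists)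
       (use pos rec shift[of k] shift[of "k - 1"] k'[of "k + 1"] k'[of "k - 1"] in simp_all)
  then show ?thesis unfolding a_def by blast
qed

theorem finite_index_integers:
  "\<exists>H. subgroup H G \<and> finite (rcosets\<^bsub>G\<^esub> H) \<and> G\<lparr>carrier := H\<rparr> \<cong> integer_group"
proof -
  obtain s where s: "s \<in> carrier G" "act s (y 0) = y 4" "act s (y 1) = y 5"
    using shift_exists by blast
  show ?thesis
  proof (rule G.cyclic_finite_index[OF s(1) shift_infinite_order[OF s] finite_balanced_auts])
    fix F assume F: "F \<in> carrier G"
    then show "\<exists>k::int. F \<otimes>\<^bsub>G\<^esub> s [^]\<^bsub>G\<^esub> k \<in> {F \<in> carrier G. \<exists>n\<le>4. balanced (tdeg (act F (y n))) (tdeg (act F (y (Suc n))))}"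
      using shift_reduces[OF s F] s(1) by auto
  qed
qed

end

theorem mainTheorem4:
  fixes g :: "'k::field poly poly"
  assumes "degree_xy g = 3"
    and "coeff_xy g 3 0 \<noteq> 0"
    and "coeff_xy g 0 3 \<noteq> 0"
    and "coeff_xy g 0 0 \<noteq> 0"
  shows "\<exists>H. subgroup H (surface_Aut g) \<and>
             finite (rcosets\<^bsub>surface_Aut g\<^esub> H) \<and>
             surface_Aut g\<lparr>carrier := H\<rparr> \<cong> integer_group"
proof -
  interpret cubic_surface g using assms by unfold_locales
  show ?thesis by (rule finite_index_integers)
qed

end
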